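(* Let $m,p,n$ be positive integers with $p\mid m$, $m$ even and $n\ge 2$. Let $\mathsf t\in\mathbb C$ and let $\underline c=\{\underline c_1,\underline c_\zeta\in\mathbb C : \zeta\in C_{m/p}\setminus\{1\}\}$ be parameters. Define $$p'=\begin{cases}p & \text{if } \tfrac mp \text{ is even},\\ \tfrac p2 & \text{if } \tfrac mp\text{ is odd},\end{cases}\qquad c_1=-\underline c_1,\qquad c_\zeta=\begin{cases}-\underline c_\zeta & \text{if } \zeta\in C_{m/p}\setminus\{1\},\\ 0 & \text{if }\zeta\in C_{m/p'}\setminus C_{m/p}.\end{cases}$$ Then the negative braided Cherednik algebra $\underline H_{\mathsf t,\underline c}(\mu(G(m,p,n)))$ embeds (as a $\mathbb C$-algebra) in the rational Cherednik algebra $H_{\mathsf t,c}(G(m,p',n))$ via the following mapping of generators: $$\underline x_i\mapsto x_i\,t_{i-1}t_{i-2}\cdots t_1,\qquad \underline y_i\mapsto y_i\,t_{i-1}t_{i-2}\cdots t_1\qquad(1\le i\le n),$$ $$\sigma_i\mapsto \tfrac12\left(s_i+\bar s_i+\sigma_i-\sigma_i^{-1}\right)\quad(1\le i\le n-1),\qquad g\mapsto g\ \text{ for all } g\in T(m,p,n).$$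
   Context: $C_k\subset\mathbb C^\times$ is the group of $k$-th roots of unity. For positive integers $m,p,n$ with $p\mid m$: $G(m,p,n)$ is the group of $n\times n$ monomial complex matrices whose non-zero entries are $m$-th roots of unity and such that the product of all non-zero entries is an $\frac mp$-th root of unity; $\mu(G(m,p,n))$ is the group of $n\times n$ monomial complex matrices whose non-zero entries are $m$-th roots of unity and whose determinant is an $\frac mp$-th root of unity. $T(m,p,n)$ is the group of diagonal matrices in $G(m,p,n)$ (equivalently in $\mu(G(m,p,n))$). $V$ is an $n$-dimensional complex vector space with basis $x_1,\dots,x_n$, on which $n\times n$ matrices act; $y_1,\dots,y_n$ is the dual basis of $V^*$, with the dual action. For $\epsilon\in\mathbb C^\times$ and $i\ne j$: $s_{ij}^{(\epsilon)}$ sends $x_i\mapsto\epsilon^{-1}x_j$, $x_j\mapsto \epsilon x_i$ and fixes the other $x_k$; $\sigma_{ij}^{(\epsilon)}$ sends $x_i\mapsto \epsilon^{-1}x_j$, $x_j\mapsto-\epsilon x_i$ and fixes the other $x_k$; $t_i^{(\epsilon)}$ sends $x_i\mapsto\epsilon x_i$ and fixes the other $x_k$. Abbreviations: $s_i=s_{i,i+1}^{(1)}$, $\bar s_i=s_{i,i+1}^{(-1)}$, $\sigma_i=\sigma_{i,i+1}^{(1)}$, $t_i=t_i^{(-1)}$. For $\mathsf t\in\mathbb C$ and $c=\{c_1,c_\zeta : \zeta\in C_{m/p}\setminus\{1\}\}$, the rational Cherednik algebra $H_{\mathsf t,c}(G(m,p,n))$ is the unital $\mathbb C$-algebra generated by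 $x_1,\dots,x_n$, $y_1,\dots,y_n$ and the group algebra of $G(m,p,n)$ subject to, for $i\neq j$ and $g\in G(m,p,n)$: $x_ix_j=x_jx_i$, $y_iy_j=y_jy_i$, $gx_i=g(x_i)g$, $gy_i=g(y_i)g$, $$y_ix_j-x_jy_i=c_1\sum_{\epsilon\in C_m}\epsilon s_{ij}^{(\epsilon)},\qquad y_ix_i-x_iy_i=\mathsf t-c_1\sum_{j\ne i}\sum_{\epsilon\in C_m}s_{ij}^{(\epsilon)}-\sum_{\zeta\in C_{m/p}\setminus\{1\}}c_\zeta t_i^{(\zeta)}.$$ The negative braided Cherednik algebra $\underline H_{\mathsf t,\underline c}(\mu(G(m,p,n)))$ is the unital $\mathbb C$-algebra generated by $\underline x_1,\dots,\underline x_n$ (the basis of $V$), $\underline y_1,\dots,\underline y_n$ (the dual basis of $V^*$) and the group algebra of $\mu(G(m,p,n))$ subject to, for $i\ne j$ and $g\in\mu(G(m,p,n))$: $\underline x_i\underline x_j=-\underline x_j\underline x_i$, $\underline y_i\underline y_j=-\underline y_j\underline y_i$, $g\underline x_i=g(\underline x_i)g$, $g\underline y_i=g(\underline y_i)g$, $$\underline y_i\underline x_j+\underline x_j\underline y_i=\underline c_1\sum_{\epsilon\in C_m}\epsilon\sigma_{ij}^{(\epsilon)},\qquad \underline y_i\underline x_i-\underline x_i\underline y_i=\mathsf t+\underline c_1\sum_{j\ne i}\sum_{\epsilon\in C_m}\sigma_{ij}^{(\epsilon)}+\sum_{\zeta\in C_{m/p}\setminus\{1\}}\underline c_\zeta t_i^{(\zeta)}.$$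 The algebra $\underline H_{\mathsf t,\underline c}(\mu(G(m,p,n)))$ is generated by the $\underline x_i,\underline y_i$, the $\sigma_i$ and $T(m,p,n)$. *)

theory Defs
  imports
    "HOL-Library.Poly_Mapping"
    "HOL-Algebra.QuotRing"
    "HOL-Algebra.Module"
    "Jordan_Normal_Form.Determinant"
begin

section \<open>Complex algebras given by generators and relations\<close>

text \<open>
  A wrapper around lists, so that words form a monoid under concatenation (written additively, as
  the convolution product on \<^typ>\<open>'a \<Rightarrow>\<^sub>0 'b\<close> requires).
\<close>

datatype 'g word = Word (letters: "'g list")

instantiation word :: (type) monoid_add
begin

definition zero_word :: "'a word" where
  "0 = Word []"

definition plus_word :: "'a word \<Rightarrow> 'a word \<Rightarrow> 'a word" where
  "v + w = Word (letters v @ letters w)"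

instance
  by standard (simp_all add: zero_word_def plus_word_def)

end

text \<open>
  Noncommutative polynomials. By \<^class>\<open>ring_1\<close> they already carry the ring structure of the
  free algebra on the whole type of letters.
\<close>

type_synonym 'g ncpoly = "'g word \<Rightarrow>\<^sub>0 complex"

definition letter :: "'g \<Rightarrow> 'g ncpoly" where
  "letter a = Poly_Mapping.single (Word [a]) 1"

definition scale :: "complex \<Rightarrow> 'g ncpoly \<Rightarrow> 'g ncpoly"  (infixr \<open>*\<^sub>C\<close> 75) where
  "k *\<^sub>C f = Poly_Mapping.single 0 k * f"

definition free_algebra :: "'g set \<Rightarrow> (complex, 'g ncpoly) module" where
  "free_algebra S =
    \<lparr>carrier = {f. \<forall>w \<in> Poly_Mapping.keys f. set (letters w) \<subseteq> S},
     monoid.mult = (*), one = 1, zero = 0, add = (+), module.smult = (*\<^sub>C)\<rparr>"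

lemma ring_free_algebra: "ring (free_algebra S)"
proof -
  define C where
    "C = {f :: 'a ncpoly. \<forall>w \<in> Poly_Mapping.keys f. set (letters w) \<subseteq> S}"
  have add: "f + g \<in> C" if "f \<in> C" "g \<in> C" for f g
    using that Poly_Mapping.keys_add [of f g] unfolding C_def by blast
  have mult: "f * g \<in> C" if fg: "f \<in> C" "g \<in> C" for f g
  proof -
    have "set (letters w) \<subseteq> S" if w: "w \<in> Poly_Mapping.keys (f * g)" for w
    proof -
      from w keys_mult [of f g]
      obtain u v where "w = u + v" "u \<in> Poly_Mapping.keys f" "v \<in> Poly_Mapping.keys g"
        by blast
      then show ?thesis
        using fg by (simp add: C_def plus_word_def)
    qed
    then show ?thesis by (simp add: C_def)
  qed
  have uminus: "- f \<in> C" if "f \<in> C" for f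
    using that by (simp add: C_def)
  have zero: "0 \<in> C" and one: "1 \<in> C"
    by (simp_all add: C_def zero_word_def)
  have F: "free_algebra S =
      \<lparr>carrier = C, monoid.mult = (*), one = 1, zero = 0, add = (+), module.smult = (*\<^sub>C)\<rparr>"
    by (simp add: free_algebra_def C_def)
  show ?thesis
    unfolding F
  proof (rule ringI, goal_cases)
    case 1
    show ?case
    proof (rule abelian_groupI, goal_cases)
      case (6 f)
      then show ?case using uminus [of f] by (auto intro!: bexI [of _ "- f"])
    qed (simp_all add: add zero add.assoc add.commute)
  next
    case 2
    show ?case
      by (rule monoidI) (simp_all add: mult one mult.assoc)
  qed (simp_all add: distrib_left distrib_right)
qed

definition relation_ideal :: "'g set \<Rightarrow> 'g ncpoly set \<Rightarrow> 'g ncpoly set" where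
  "relation_ideal S R = Idl\<^bsub>free_algebra S\<^esub> R"

definition presented_class :: "'g set \<Rightarrow> 'g ncpoly set \<Rightarrow> 'g ncpoly \<Rightarrow> 'g ncpoly set" where
  "presented_class S R f = relation_ideal S R +>\<^bsub>free_algebra S\<^esub> f"

text \<open>
  The unital algebra generated by \<open>S\<close> subject to \<open>r = 0\<close> for \<open>r \<in> R\<close>: the quotient ring \<open>Quot\<close>,
  with scalars acting on cosets through representatives in the same way as products do there.
\<close>

definition presented_algebra ::
  "'g set \<Rightarrow> 'g ncpoly set \<Rightarrow> (complex, 'g ncpoly set) module" where
  "presented_algebra S R =
    ring.extend (free_algebra S Quot relation_ideal S R)
      (module.fields (\<lambda>k A. \<Union>f\<in>A. presented_class S R (k *\<^sub>C f)))"

definition algebra_hom ::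
  "(complex, 'a) module \<Rightarrow> (complex, 'b) module \<Rightarrow> ('a \<Rightarrow> 'b) set" where
  "algebra_hom A B =
    {\<phi> \<in> Ring.ring_hom A B. \<forall>k. \<forall>a \<in> carrier A. \<phi> (k \<odot>\<^bsub>A\<^esub> a) = k \<odot>\<^bsub>B\<^esub> \<phi> a}"


section \<open>The groups\<close>

text \<open>
  All indices run over \<open>0, \<dots>, n - 1\<close> (the indexing of \<^typ>\<open>'a mat\<close>), so the basis vector
  called \<open>x\<^sub>1\<close> in mathematical notation has index \<open>0\<close> here.
\<close>

definition unity_roots :: "nat \<Rightarrow> complex set" where
  "unity_roots k = {z. z ^ k = 1}"

definition monomial_mat :: "nat \<Rightarrow> complex mat \<Rightarrow> bool" where
  "monomial_mat n A \<longleftrightarrow> A \<in> carrier_mat n n \<and>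
    (\<forall>i<n. \<exists>!j. j < n \<and> A $$ (i, j) \<noteq> 0) \<and>
    (\<forall>j<n. \<exists>!i. i < n \<and> A $$ (i, j) \<noteq> 0)"

definition nonzero_positions :: "nat \<Rightarrow> complex mat \<Rightarrow> (nat \<times> nat) set" where
  "nonzero_positions n A = {(i, j). i < n \<and> j < n \<and> A $$ (i, j) \<noteq> 0}"

definition mat_monoid :: "nat \<Rightarrow> complex mat set \<Rightarrow> complex mat monoid" where
  "mat_monoid n S = \<lparr>carrier = S, monoid.mult = (*), one = 1\<^sub>m n\<rparr>"

definition Gmpn :: "nat \<Rightarrow> nat \<Rightarrow> nat \<Rightarrow> complex mat monoid" where
  "Gmpn m p n = mat_monoid n
    {A. monomial_mat n A \<and>
        (\<forall>ij \<in> nonzero_positions n A. A $$ ij \<in> unity_roots m) \<and>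
        (\<Prod>ij \<in> nonzero_positions n A. A $$ ij) \<in> unity_roots (m div p)}"

definition \<mu>Gmpn :: "nat \<Rightarrow> nat \<Rightarrow> nat \<Rightarrow> complex mat monoid" where
  "\<mu>Gmpn m p n = mat_monoid n
    {A. monomial_mat n A \<and>
        (\<forall>ij \<in> nonzero_positions n A. A $$ ij \<in> unity_roots m) \<and>
        det A \<in> unity_roots (m div p)}"

definition Tmpn :: "nat \<Rightarrow> nat \<Rightarrow> nat \<Rightarrow> complex mat set" where
  "Tmpn m p n = {A \<in> carrier (Gmpn m p n). diagonal_mat A}"

text \<open>
  Column \<open>b\<close> of a matrix holds the image of the basis vector \<open>x\<^sub>b\<close>. For \<open>i \<noteq> j\<close> the next matrix
  maps \<open>x\<^sub>i\<close> to \<open>\<alpha> x\<^sub>j\<close> and \<open>x\<^sub>j\<close> to \<open>\<beta> x\<^sub>i\<close>, and fixes the other basis vectors.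
\<close>

definition swap_mat :: "nat \<Rightarrow> nat \<Rightarrow> nat \<Rightarrow> complex \<Rightarrow> complex \<Rightarrow> complex mat" where
  "swap_mat n i j \<alpha> \<beta> = mat n n (\<lambda>(a, b).
     if b = i then (if a = j then \<alpha> else 0)
     else if b = j then (if a = i then \<beta> else 0)
     else if a = b then 1 else 0)"

definition s_mat :: "nat \<Rightarrow> nat \<Rightarrow> nat \<Rightarrow> complex \<Rightarrow> complex mat" where
  "s_mat n i j \<epsilon> = swap_mat n i j (inverse \<epsilon>) \<epsilon>"

definition \<sigma>_mat :: "nat \<Rightarrow> nat \<Rightarrow> nat \<Rightarrow> complex \<Rightarrow> complex mat" where
  "\<sigma>_mat n i j \<epsilon> = swap_mat n i j (inverse \<epsilon>) (- \<epsilon>)"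

definition t_mat :: "nat \<Rightarrow> nat \<Rightarrow> complex \<Rightarrow> complex mat" where
  "t_mat n i \<epsilon> = mat n n (\<lambda>(a, b). if a = b then (if a = i then \<epsilon> else 1) else 0)"


section \<open>The two Cherednik algebras\<close>

datatype gen = XGen nat | YGen nat | GrpGen "complex mat"

definition \<x> :: "nat \<Rightarrow> gen ncpoly" where "\<x> i = letter (XGen i)"
definition \<y> :: "nat \<Rightarrow> gen ncpoly" where "\<y> i = letter (YGen i)"
definition grp :: "complex mat \<Rightarrow> gen ncpoly" where "grp g = letter (GrpGen g)"

definition cherednik_gens :: "nat \<Rightarrow> complex mat monoid \<Rightarrow> gen set" where
  "cherednik_gens n \<Gamma> = XGen ` {..<n} \<union> YGen ` {..<n} \<union> GrpGen ` carrier \<Gamma>"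

definition act_x :: "nat \<Rightarrow> complex mat \<Rightarrow> nat \<Rightarrow> gen ncpoly" where
  "act_x n g i = (\<Sum>a<n. (g $$ (a, i)) *\<^sub>C \<x> a)"

text \<open>The dual action \<open>(g f)(v) = f (g\<inverse> v)\<close> on the dual basis.\<close>

definition act_y :: "nat \<Rightarrow> complex mat monoid \<Rightarrow> complex mat \<Rightarrow> nat \<Rightarrow> gen ncpoly" where
  "act_y n \<Gamma> g i = (\<Sum>a<n. ((inv\<^bsub>\<Gamma>\<^esub> g) $$ (i, a)) *\<^sub>C \<y> a)"

text \<open>
  The first two families make the span of the group letters (an image of) the group algebra of
  \<open>\<Gamma>\<close>; the other two are \<open>g x\<^sub>i = g(x\<^sub>i) g\<close> and \<open>g y\<^sub>i = g(y\<^sub>i) g\<close>.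
\<close>

definition group_rels :: "nat \<Rightarrow> complex mat monoid \<Rightarrow> gen ncpoly set" where
  "group_rels n \<Gamma> =
    {grp \<one>\<^bsub>\<Gamma>\<^esub> - 1} \<union>
    {grp g * grp h - grp (g \<otimes>\<^bsub>\<Gamma>\<^esub> h) | g h. g \<in> carrier \<Gamma> \<and> h \<in> carrier \<Gamma>} \<union>
    {grp g * \<x> i - act_x n g i * grp g | g i. g \<in> carrier \<Gamma> \<and> i < n} \<union>
    {grp g * \<y> i - act_y n \<Gamma> g i * grp g | g i. g \<in> carrier \<Gamma> \<and> i < n}"

text \<open>
  The parameter \<open>c\<close> is a function on all complex numbers, but only its values on
  \<open>unity_roots (m div p) - {1}\<close> occur.
\<close>

definition cherednik_rels ::
  "nat \<Rightarrow> nat \<Rightarrow> nat \<Rightarrow> complex \<Rightarrow> complex \<Rightarrow> (complex \<Rightarrow> complex) \<Rightarrow> gen ncpoly set" where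
  "cherednik_rels m p n \<t> c\<^sub>1 c =
    group_rels n (Gmpn m p n) \<union>
    {\<x> i * \<x> j - \<x> j * \<x> i | i j. i < n \<and> j < n \<and> i \<noteq> j} \<union>
    {\<y> i * \<y> j - \<y> j * \<y> i | i j. i < n \<and> j < n \<and> i \<noteq> j} \<union>
    {(\<y> i * \<x> j - \<x> j * \<y> i)
       - c\<^sub>1 *\<^sub>C (\<Sum>\<epsilon>\<in>unity_roots m. \<epsilon> *\<^sub>C grp (s_mat n i j \<epsilon>))
     | i j. i < n \<and> j < n \<and> i \<noteq> j} \<union>
    {(\<y> i * \<x> i - \<x> i * \<y> i)
       - (\<t> *\<^sub>C 1
          - c\<^sub>1 *\<^sub>C (\<Sum>j\<in>{..<n} - {i}. \<Sum>\<epsilon>\<in>unity_roots m. grp (s_mat n i j \<epsilon>))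
          - (\<Sum>\<zeta>\<in>unity_roots (m div p) - {1}. c \<zeta> *\<^sub>C grp (t_mat n i \<zeta>)))
     | i. i < n}"

definition braided_cherednik_rels ::
  "nat \<Rightarrow> nat \<Rightarrow> nat \<Rightarrow> complex \<Rightarrow> complex \<Rightarrow> (complex \<Rightarrow> complex) \<Rightarrow> gen ncpoly set" where
  "braided_cherednik_rels m p n \<t> c\<^sub>1 c =
    group_rels n (\<mu>Gmpn m p n) \<union>
    {\<x> i * \<x> j + \<x> j * \<x> i | i j. i < n \<and> j < n \<and> i \<noteq> j} \<union>
    {\<y> i * \<y> j + \<y> j * \<y> i | i j. i < n \<and> j < n \<and> i \<noteq> j} \<union>
    {(\<y> i * \<x> j + \<x> j * \<y> i)
       - c\<^sub>1 *\<^sub>C (\<Sum>\<epsilon>\<in>unity_roots m. \<epsilon> *\<^sub>C grp (\<sigma>_mat n i j \<epsilon>))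
     | i j. i < n \<and> j < n \<and> i \<noteq> j} \<union>
    {(\<y> i * \<x> i - \<x> i * \<y> i)
       - (\<t> *\<^sub>C 1
          + c\<^sub>1 *\<^sub>C (\<Sum>j\<in>{..<n} - {i}. \<Sum>\<epsilon>\<in>unity_roots m. grp (\<sigma>_mat n i j \<epsilon>))
          + (\<Sum>\<zeta>\<in>unity_roots (m div p) - {1}. c \<zeta> *\<^sub>C grp (t_mat n i \<zeta>)))
     | i. i < n}"

definition cherednik_algebra ::
  "nat \<Rightarrow> nat \<Rightarrow> nat \<Rightarrow> complex \<Rightarrow> complex \<Rightarrow> (complex \<Rightarrow> complex)
    \<Rightarrow> (complex, gen ncpoly set) module" where
  "cherednik_algebra m p n \<t> c\<^sub>1 c =
    presented_algebra (cherednik_gens n (Gmpn m p n)) (cherednik_rels m p n \<t> c\<^sub>1 c)"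

definition cherednik_class ::
  "nat \<Rightarrow> nat \<Rightarrow> nat \<Rightarrow> complex \<Rightarrow> complex \<Rightarrow> (complex \<Rightarrow> complex)
    \<Rightarrow> gen ncpoly \<Rightarrow> gen ncpoly set" where
  "cherednik_class m p n \<t> c\<^sub>1 c =
    presented_class (cherednik_gens n (Gmpn m p n)) (cherednik_rels m p n \<t> c\<^sub>1 c)"

definition braided_cherednik_algebra ::
  "nat \<Rightarrow> nat \<Rightarrow> nat \<Rightarrow> complex \<Rightarrow> complex \<Rightarrow> (complex \<Rightarrow> complex)
    \<Rightarrow> (complex, gen ncpoly set) module" where
  "braided_cherednik_algebra m p n \<t> c\<^sub>1 c =
    presented_algebra (cherednik_gens n (\<mu>Gmpn m p n)) (braided_cherednik_rels m p n \<t> c\<^sub>1 c)"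

definition braided_cherednik_class ::
  "nat \<Rightarrow> nat \<Rightarrow> nat \<Rightarrow> complex \<Rightarrow> complex \<Rightarrow> (complex \<Rightarrow> complex)
    \<Rightarrow> gen ncpoly \<Rightarrow> gen ncpoly set" where
  "braided_cherednik_class m p n \<t> c\<^sub>1 c =
    presented_class (cherednik_gens n (\<mu>Gmpn m p n)) (braided_cherednik_rels m p n \<t> c\<^sub>1 c)"

text \<open>
  The product \<open>t\<^bsub>i-1\<^esub> \<cdots> t\<^sub>0\<close> of all sign changes at indices below \<open>i\<close>; it is \<open>1\<close> for \<open>i = 0\<close>.
\<close>

definition t_chain :: "nat \<Rightarrow> nat \<Rightarrow> gen ncpoly" where
  "t_chain n i = prod_list (map (\<lambda>k. grp (t_mat n k (- 1))) (rev [0..<i]))"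

end

theory Submission
  imports Defs
begin

text \<open>
  The proof needs no basis theorem for either algebra: injectivity comes from explicit homomorphisms
  in the opposite direction.

  \<^emph>\<open>One family of relations.\<close> With \<open>c\<^sub>1\<close> and \<open>c\<^sub>\<zeta>\<close> replaced by their negatives on the braided side, the
  two presentations differ only in a sign \<open>\<eta>\<close>, which is \<open>1\<close> for the rational and \<open>-1\<close> for the braided
  algebra: \<open>x\<^sub>i x\<^sub>j = \<eta> x\<^sub>j x\<^sub>i\<close>, the same for the \<open>y\<^sub>i\<close>, and the group elements that occur in the mixed
  relations send \<open>x\<^sub>i\<close> to \<open>\<epsilon>\<^bsup>-1\<^esup> x\<^sub>j\<close> and \<open>x\<^sub>j\<close> to \<open>\<eta> \<epsilon> x\<^sub>i\<close>. The number \<open>m/p'\<close> is even, so the sign of a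
  permutation disappears in the \<open>m/p'\<close>-th power of a determinant; hence \<open>G(m,p',n)\<close> and
  \<open>\<mu>(G(m,p',n))\<close> are the same group \<open>\<Gamma>\<close> of matrices, and it contains every sign change.

  \<^emph>\<open>The twist.\<close> Conjugation by the sign changes grades both algebras of \<open>\<Gamma>\<close>, and multiplying homogeneous
  elements by sign changes that depend linearly on the degree alters their commutation signs. The map
  so obtained is \<open>x\<^sub>i \<mapsto> x\<^sub>i t\<^bsub>i-1\<^esub> \<cdots> t\<^sub>1\<close>, likewise for \<open>y\<^sub>i\<close>, and \<open>g \<mapsto> g D(\<epsilon>\<^sub>w)\<close> for \<open>g\<close> with underlying
  permutation \<open>w\<close>. Here \<open>D(f)\<close> is the combination of sign changes that acts by \<open>f(X)\<close> on the common
  eigenvectors on which exactly the \<open>t\<^sub>i\<close> with \<open>i \<in> X\<close> act by \<open>-1\<close>, and \<open>\<epsilon>\<^sub>w(X)\<close> is \<open>1\<close> or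
  \<open>-1\<close> by the parity of the number of inversions of \<open>w\<close> inside \<open>X\<close>: the sign with which \<open>w\<close> acts on the exterior monomial indexed by \<open>X\<close>.
  Since \<open>D\<close> turns pointwise products into products, every relation reduces to an identity between signs.
  The substitution carries the relations for \<open>-\<eta>\<close> into the ideal for \<open>\<eta>\<close> (\<open>twist_rels\<close>), and it is an
  involution modulo the relations because all the signs square to \<open>1\<close> (\<open>twist_twist\<close>). So it identifies
  the braided and the rational algebra of \<open>\<Gamma>\<close>.

  \<^emph>\<open>The subgroup.\<close> The group \<open>\<mu>(G(m,p,n))\<close> is \<open>\<Gamma>\<close> if \<open>m/p\<close> is even and has index two in \<open>\<Gamma>\<close> otherwise. In both
  cases the braided algebra \<open>A\<close> of the subgroup maps injectively to the braided algebra of \<open>\<Gamma>\<close>: the latter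
  has a homomorphism to the two-by-two matrices over \<open>A\<close>, which for index two is its action on the module
  induced from \<open>A\<close>, and an element of \<open>A\<close> is the upper left entry of its own matrix (\<open>subgroup_ideal\<close>).

  An element of \<open>A\<close> in the kernel of the twist therefore vanishes in the braided algebra of \<open>\<Gamma>\<close>, by a second
  application of the twist, and then in \<open>A\<close>.
\<close>

section \<open>Scalars in algebras of noncommutative polynomials\<close>

lemma letters_plus [simp]: "letters (v + w) = letters v @ letters w"
  by (simp add: plus_word_def)

lemma letters_zero [simp]: "letters 0 = []"
  by (simp add: zero_word_def)

lemma sum_monomials: "f = (\<Sum>w\<in>Poly_Mapping.keys f. Poly_Mapping.single w (Poly_Mapping.lookup f w))"
proof (rule poly_mapping_eqI)
  fix w
  show "Poly_Mapping.lookup f w =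
    Poly_Mapping.lookup (\<Sum>w\<in>Poly_Mapping.keys f. Poly_Mapping.single w (Poly_Mapping.lookup f w)) w"
    by (simp add: lookup_sum lookup_single when_def in_keys_iff)
qed

lemma scalar_central: "Poly_Mapping.single 0 k * f = f * (Poly_Mapping.single 0 k :: 'g ncpoly)"
proof -
  let ?W = "Poly_Mapping.keys f" and ?f = "\<lambda>w. Poly_Mapping.single w (Poly_Mapping.lookup f w)"
  have "Poly_Mapping.single 0 k * sum ?f ?W = sum ?f ?W * Poly_Mapping.single 0 k"
    by (simp add: sum_distrib_left sum_distrib_right mult_single mult.commute)
  then show ?thesis by (simp only: sum_monomials [symmetric])
qed

lemma scale_add_right: "k *\<^sub>C (f + g) = k *\<^sub>C f + k *\<^sub>C g"
  by (simp add: scale_def distrib_left)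

lemma scale_add_left: "(k + l) *\<^sub>C f = k *\<^sub>C f + l *\<^sub>C f"
  by (simp add: scale_def distrib_right single_add)

lemma scale_scale [simp]: "k *\<^sub>C l *\<^sub>C f = (k * l) *\<^sub>C f"
  by (simp add: scale_def mult.assoc [symmetric] mult_single)

lemma scale_one [simp]: "1 *\<^sub>C f = f"
  by (simp add: scale_def)

interpretation ncpoly: vector_space "scale :: complex \<Rightarrow> 'g ncpoly \<Rightarrow> 'g ncpoly"
  by unfold_locales (simp_all add: scale_add_right scale_add_left)

lemma scale_mult_left: "(k *\<^sub>C f) * g = k *\<^sub>C (f * g)"
  by (simp add: scale_def mult.assoc)

lemma scale_mult_right: "f * (k *\<^sub>C g) = k *\<^sub>C (f * g)"
  unfolding scale_def by (metis mult.assoc scalar_central)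

section \<open>Two-sided ideals and congruences\<close>

text \<open>
  The ideal is generated inside the whole type of noncommutative polynomials, so that congruences
  can be manipulated without conditions on the letters that occur. The comparison with the ideal inside
  a free algebra on fewer letters is \<open>relation_ideal_eq\<close> below.
\<close>

inductive_set gen_ideal :: "'r::ring_1 set \<Rightarrow> 'r set" for R where
  zero: "0 \<in> gen_ideal R"
| step: "f \<in> gen_ideal R \<Longrightarrow> r \<in> R \<Longrightarrow> f + a * r * b \<in> gen_ideal R"

lemma gen_ideal_base: "r \<in> R \<Longrightarrow> r \<in> gen_ideal R"
  using gen_ideal.step [OF gen_ideal.zero, of r R 1 1] by simp

lemma gen_ideal_add:
  assumes f: "f \<in> gen_ideal R" and g: "g \<in> gen_ideal R"
  shows "f + g \<in> gen_ideal R"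
  using g
proof (induction g rule: gen_ideal.induct)
  case (step g r a b)
  then show ?case using gen_ideal.step [of "f + g" R r a b] by (simp add: add.assoc)
qed (simp add: f)

lemma gen_ideal_mult_left: "f \<in> gen_ideal R \<Longrightarrow> a * f \<in> gen_ideal R"
proof (induction f rule: gen_ideal.induct)
  case (step g r u v)
  then show ?case using gen_ideal.step [of "a * g" R r "a * u" v] by (simp add: distrib_left mult.assoc)
qed (simp add: gen_ideal.zero)

lemma gen_ideal_mult_right: "f \<in> gen_ideal R \<Longrightarrow> f * a \<in> gen_ideal R"
proof (induction f rule: gen_ideal.induct)
  case (step g r u v)
  then show ?case using gen_ideal.step [of "g * a" R r u "v * a"] by (simp add: distrib_right mult.assoc)
qed (simp add: gen_ideal.zero)

lemma gen_ideal_uminus: "f \<in> gen_ideal R \<Longrightarrow> - f \<in> gen_ideal R"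
  using gen_ideal_mult_left [of f R "- 1"] by simp

definition cong_mod :: "'r::ring_1 set \<Rightarrow> 'r \<Rightarrow> 'r \<Rightarrow> bool" where
  "cong_mod R f g \<longleftrightarrow> f - g \<in> gen_ideal R"

lemma cong_mod_refl [simp]: "cong_mod R f f"
  by (simp add: cong_mod_def gen_ideal.zero)

lemma cong_mod_sym: "cong_mod R f g \<Longrightarrow> cong_mod R g f"
  using gen_ideal_uminus [of "f - g" R] by (simp add: cong_mod_def)

lemma cong_mod_trans [trans]: "cong_mod R f g \<Longrightarrow> cong_mod R g h \<Longrightarrow> cong_mod R f h"
  using gen_ideal_add [of "f - g" R "g - h"] by (simp add: cong_mod_def)

lemma cong_mod_add: "cong_mod R f f' \<Longrightarrow> cong_mod R g g' \<Longrightarrow> cong_mod R (f + g) (f' + g')"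
  using gen_ideal_add [of "f - f'" R "g - g'"] by (simp add: cong_mod_def algebra_simps)

lemma cong_mod_uminus: "cong_mod R f f' \<Longrightarrow> cong_mod R (- f) (- f')"
  using gen_ideal_uminus [of "f - f'" R] by (simp add: cong_mod_def)

lemma cong_mod_diff: "cong_mod R f f' \<Longrightarrow> cong_mod R g g' \<Longrightarrow> cong_mod R (f - g) (f' - g')"
  using cong_mod_add [of R f f' "- g" "- g'"] cong_mod_uminus [of R g g'] by simp

lemma cong_mod_mult:
  assumes "cong_mod R f f'" "cong_mod R g g'"
  shows "cong_mod R (f * g) (f' * g')"
proof -
  have "f * g - f' * g' = (f - f') * g + f' * (g - g')" by (simp add: algebra_simps)
  then show ?thesis
    using assms by (simp add: cong_mod_def gen_ideal_add gen_ideal_mult_left gen_ideal_mult_right)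
qed

lemma cong_mod_mult_left: "cong_mod R g g' \<Longrightarrow> cong_mod R (f * g) (f * g')"
  and cong_mod_mult_right: "cong_mod R f f' \<Longrightarrow> cong_mod R (f * g) (f' * g)"
  by (simp_all add: cong_mod_mult)

lemma cong_mod_scale: "cong_mod R f g \<Longrightarrow> cong_mod R (k *\<^sub>C f) (k *\<^sub>C g)"
  by (simp add: scale_def cong_mod_mult_left)

lemma cong_mod_sum: "(\<And>i. i \<in> I \<Longrightarrow> cong_mod R (f i) (g i)) \<Longrightarrow> cong_mod R (sum f I) (sum g I)"
  by (induction I rule: infinite_finite_induct) (auto intro: cong_mod_add)

lemma cong_mod_base: "f - g \<in> R \<Longrightarrow> cong_mod R f g"
  by (simp add: cong_mod_def gen_ideal_base)

section \<open>Free algebras and substitution\<close>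

abbreviation Free :: "'g set \<Rightarrow> 'g ncpoly set" where "Free S \<equiv> carrier (free_algebra S)"

lemma Free_def: "Free S = {f. \<forall>w \<in> Poly_Mapping.keys f. set (letters w) \<subseteq> S}"
  by (simp add: free_algebra_def)

lemma free_algebra_simps [simp]:
  "monoid.mult (free_algebra S) = (*)" "one (free_algebra S) = 1" "zero (free_algebra S) = 0"
  "add (free_algebra S) = (+)" "module.smult (free_algebra S) = (*\<^sub>C)"
  by (simp_all add: free_algebra_def)

lemma Free_zero [simp]: "0 \<in> Free S" and Free_one [simp]: "1 \<in> Free S"
  by (simp_all add: Free_def)

lemma Free_add [intro]: "f \<in> Free S \<Longrightarrow> g \<in> Free S \<Longrightarrow> f + g \<in> Free S"
  using ring.ring_simprules(1) [OF ring_free_algebra, of f S g] by simp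

lemma Free_mult [intro]: "f \<in> Free S \<Longrightarrow> g \<in> Free S \<Longrightarrow> f * g \<in> Free S"
  using ring.ring_simprules(5) [OF ring_free_algebra, of f S g] by simp

lemma Free_letter [simp]: "letter a \<in> Free S \<longleftrightarrow> a \<in> S"
  by (simp add: Free_def letter_def)

lemma Free_scalar [simp]: "Poly_Mapping.single 0 k \<in> Free S"
  by (simp add: Free_def)

lemma Free_scale [intro]: "f \<in> Free S \<Longrightarrow> k *\<^sub>C f \<in> Free S"
  unfolding scale_def by (intro Free_mult Free_scalar)

lemma Free_uminus: "f \<in> Free S \<Longrightarrow> - f \<in> Free S"
  by (simp add: Free_def)

lemma Free_diff [intro]: "f \<in> Free S \<Longrightarrow> g \<in> Free S \<Longrightarrow> f - g \<in> Free S"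
  using Free_add [of f S "- g"] Free_uminus [of g S] by simp

lemma Free_sum [intro]: "(\<And>i. i \<in> I \<Longrightarrow> f i \<in> Free S) \<Longrightarrow> sum f I \<in> Free S"
  by (induction I rule: infinite_finite_induct) auto

lemma Free_prod_list: "(\<And>f. f \<in> set fs \<Longrightarrow> f \<in> Free S) \<Longrightarrow> prod_list fs \<in> Free S"
  by (induction fs) auto

text \<open>
  The polynomials in the letters of \<open>S\<close> are generated as a ring by scalars and letters; this is the form
  in which properties of substitutions are checked.
\<close>

lemma free_algebra_induct [consumes 1, case_names scalar letter add mult]:
  assumes f: "f \<in> Free S"
    and P: "\<And>k. P (Poly_Mapping.single 0 k)" "\<And>a. a \<in> S \<Longrightarrow> P (letter a)"
      "\<And>f g. P f \<Longrightarrow> P g \<Longrightarrow> P (f + g)" "\<And>f g. P f \<Longrightarrow> P g \<Longrightarrow> P (f * g)"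
  shows "P f"
proof -
  have word: "P (Poly_Mapping.single (Word as) k)" if "set as \<subseteq> S" for as k
    using that
  proof (induction as arbitrary: k)
    case Nil
    then show ?case using P(1) by (simp add: zero_word_def [symmetric])
  next
    case (Cons a as)
    have "Poly_Mapping.single (Word (a # as)) k = letter a * Poly_Mapping.single (Word as) k"
      by (simp add: letter_def mult_single plus_word_def)
    then show ?case using Cons P by simp
  qed
  have "P (\<Sum>w\<in>W. Poly_Mapping.single w (Poly_Mapping.lookup f w))"
    if "finite W" "W \<subseteq> Poly_Mapping.keys f" for W
    using that
  proof (induction W)
    case empty
    then show ?case using P(1) [of 0] by simp
  next
    case (insert w W)
    then have "P (Poly_Mapping.single w (Poly_Mapping.lookup f w))"
      using word [of "letters w"] f by (auto simp: Free_def)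
    then show ?case using insert P(3) by auto
  qed
  from this [of "Poly_Mapping.keys f"] show ?thesis by (subst sum_monomials) simp
qed

lemma Free_UNIV [simp]: "Free UNIV = UNIV"
  by (simp add: Free_def)

text \<open>
  Evaluation of noncommutative polynomials in an arbitrary ring \<open>'r\<close> that is made into a complex algebra
  by the central map \<open>\<kappa>\<close>. Both the polynomials themselves and two-by-two matrices over them occur as
  values.
\<close>

locale substitution =
  fixes \<kappa> :: "complex \<Rightarrow> 'r::ring_1" and h :: "'g \<Rightarrow> 'r"
  assumes \<kappa>_add: "\<kappa> (k + l) = \<kappa> k + \<kappa> l"
    and \<kappa>_mult: "\<kappa> (k * l) = \<kappa> k * \<kappa> l"
    and \<kappa>_one [simp]: "\<kappa> 1 = 1"
    and \<kappa>_central: "\<kappa> k * a = a * \<kappa> k"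
begin

definition eval :: "'g ncpoly \<Rightarrow> 'r" where
  "eval f = (\<Sum>w\<in>Poly_Mapping.keys f. \<kappa> (Poly_Mapping.lookup f w) * prod_list (map h (letters w)))"

lemma \<kappa>_zero [simp]: "\<kappa> 0 = 0"
  using \<kappa>_add [of 0 0] by simp

lemma eval_superset:
  assumes "finite W" "Poly_Mapping.keys f \<subseteq> W"
  shows "eval f = (\<Sum>w\<in>W. \<kappa> (Poly_Mapping.lookup f w) * prod_list (map h (letters w)))"
  unfolding eval_def
  by (rule sum.mono_neutral_left) (use assms in \<open>auto simp: in_keys_iff\<close>)

lemma eval_add [simp]: "eval (f + g) = eval f + eval g"
proof -
  let ?W = "Poly_Mapping.keys f \<union> Poly_Mapping.keys g"
  have "Poly_Mapping.keys (f + g) \<subseteq> ?W" by (rule Poly_Mapping.keys_add)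
  then show ?thesis
    by (simp add: eval_superset [of ?W] lookup_add \<kappa>_add distrib_right sum.distrib)
qed

lemma eval_zero [simp]: "eval 0 = 0"
  by (simp add: eval_def)

lemma eval_sum [simp]: "eval (sum f I) = (\<Sum>i\<in>I. eval (f i))"
  by (induction I rule: infinite_finite_induct) simp_all

lemma eval_single: "eval (Poly_Mapping.single w k) = \<kappa> k * prod_list (map h (letters w))"
  by (subst eval_superset [of "{w}"]) (simp_all add: Poly_Mapping.keys_single)

lemma eval_mult [simp]: "eval (f * g) = eval f * eval g"
proof -
  have single: "eval (Poly_Mapping.single u k * Poly_Mapping.single v l) =
      eval (Poly_Mapping.single u k) * eval (Poly_Mapping.single v l)" for u v k l
  proof -
    have "\<kappa> l * (prod_list (map h (letters u)) * a) = prod_list (map h (letters u)) * (\<kappa> l * a)" for a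
      by (metis \<kappa>_central mult.assoc)
    then show ?thesis by (simp add: mult_single eval_single \<kappa>_mult mult.assoc)
  qed
  have "eval (f * g) = eval ((\<Sum>u\<in>Poly_Mapping.keys f. Poly_Mapping.single u (Poly_Mapping.lookup f u)) *
      (\<Sum>v\<in>Poly_Mapping.keys g. Poly_Mapping.single v (Poly_Mapping.lookup g v)))"
    by (simp add: sum_monomials [symmetric])
  also have "\<dots> = eval (\<Sum>u\<in>Poly_Mapping.keys f. Poly_Mapping.single u (Poly_Mapping.lookup f u)) *
      eval (\<Sum>v\<in>Poly_Mapping.keys g. Poly_Mapping.single v (Poly_Mapping.lookup g v))"
    by (simp add: sum_product single)
  finally show ?thesis by (simp add: sum_monomials [symmetric])
qed

lemma eval_scalar [simp]: "eval (Poly_Mapping.single 0 k) = \<kappa> k"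
  by (simp add: eval_single)

lemma eval_one [simp]: "eval 1 = 1"
  using eval_scalar [of 1] by (simp del: eval_scalar)

lemma eval_letter [simp]: "eval (letter a) = h a"
  by (simp add: letter_def eval_single)

lemma eval_scale: "eval (k *\<^sub>C f) = \<kappa> k * eval f"
  by (simp add: scale_def)

lemma eval_uminus [simp]: "eval (- f) = - eval f"
  using eval_add [of f "- f"] by (metis add.right_inverse eval_zero minus_unique)

lemma eval_diff [simp]: "eval (f - g) = eval f - eval g"
  using eval_add [of f "- g"] by simp

lemma eval_gen_ideal:
  assumes "\<And>r. r \<in> R \<Longrightarrow> eval r \<in> K" "0 \<in> K" "\<And>f g. f \<in> K \<Longrightarrow> g \<in> K \<Longrightarrow> f + g \<in> K"
    "\<And>f a b. f \<in> K \<Longrightarrow> a * f * b \<in> K" and f: "f \<in> gen_ideal R"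
  shows "eval f \<in> K"
  using f by induction (simp_all add: assms)

end

abbreviation ncscalar :: "complex \<Rightarrow> 'g ncpoly" where "ncscalar \<equiv> Poly_Mapping.single 0"

lemma substitution_ncpoly: "substitution (ncscalar :: complex \<Rightarrow> 'h ncpoly)"
  by unfold_locales (simp_all add: single_add mult_single scalar_central)

section \<open>Embeddings of presented algebras\<close>

lemma relation_ideal_ideal: "R \<subseteq> Free S \<Longrightarrow> ideal (relation_ideal S R) (free_algebra S)"
  unfolding relation_ideal_def by (rule ring.genideal_ideal [OF ring_free_algebra])

text \<open>
  Sending every letter outside \<open>S\<close> to \<open>0\<close> is a retraction onto the free algebra on \<open>S\<close> that fixes the
  relations, so it maps the large ideal into the small one.
\<close>

lemma relation_ideal_eq:
  assumes R: "R \<subseteq> Free S"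
  shows "relation_ideal S R = gen_ideal R \<inter> Free S"
proof
  interpret I: ideal "relation_ideal S R" "free_algebra S"
    by (rule relation_ideal_ideal [OF R])
  have uminus: "\<ominus>\<^bsub>free_algebra S\<^esub> f = - f" if "f \<in> Free S" for f
    using I.r_neg [of f] I.a_inv_closed [OF that] that by (simp add: minus_unique)
  have "ideal (gen_ideal R \<inter> Free S) (free_algebra S)"
  proof (rule idealI [OF ring_free_algebra])
    show "subgroup (gen_ideal R \<inter> Free S) (add_monoid (free_algebra S))"
    proof (rule subgroup.intro)
      fix f assume f: "f \<in> gen_ideal R \<inter> Free S"
      have "inv\<^bsub>add_monoid (free_algebra S)\<^esub> f = - f"
        using uminus [of f] f by (simp add: a_inv_def)
      then show "inv\<^bsub>add_monoid (free_algebra S)\<^esub> f \<in> gen_ideal R \<inter> Free S"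
        using f by (simp add: gen_ideal_uminus Free_uminus)
    qed (auto intro: gen_ideal_add gen_ideal.zero)
  qed (auto intro: gen_ideal_mult_left gen_ideal_mult_right)
  then show "relation_ideal S R \<subseteq> gen_ideal R \<inter> Free S"
    unfolding relation_ideal_def
    by (rule ring.genideal_minimal [OF ring_free_algebra]) (use R in \<open>auto intro: gen_ideal_base\<close>)
  interpret retract: substitution ncscalar "\<lambda>a. if a \<in> S then letter a else 0"
    by (rule substitution_ncpoly)
  have id: "retract.eval f = f" if "f \<in> Free S" for f
    using that by (induction rule: free_algebra_induct) simp_all
  have into: "retract.eval f \<in> Free S" for f
  proof -
    have "f \<in> Free UNIV" by simp
    then show ?thesis by (induction rule: free_algebra_induct) auto
  qed
  have "retract.eval f \<in> relation_ideal S R" if "f \<in> gen_ideal R" for f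
    using that
  proof induction
    case zero
    then show ?case
      using additive_subgroup.zero_closed [OF I.additive_subgroup_axioms] by simp
  next
    case (step f r a b)
    have "r \<in> relation_ideal S R" "r \<in> Free S"
      using step(2) R ring.genideal_self [OF ring_free_algebra R] by (auto simp: relation_ideal_def)
    then have "retract.eval a * r * retract.eval b \<in> relation_ideal S R"
      using I.I_l_closed [of r "retract.eval a"] I.I_r_closed into by simp
    then show ?case
      using step additive_subgroup.a_closed [OF I.additive_subgroup_axioms] \<open>r \<in> Free S\<close>
      by (simp add: id)
  qed
  then show "gen_ideal R \<inter> Free S \<subseteq> relation_ideal S R"
    using id by fastforce
qed

lemma presented_class_eq_iff:
  assumes R: "R \<subseteq> Free S" and "f \<in> Free S" "g \<in> Free S"
  shows "presented_class S R f = presented_class S R g \<longleftrightarrow> f - g \<in> gen_ideal R"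
proof -
  interpret I: ideal "relation_ideal S R" "free_algebra S"
    by (rule relation_ideal_ideal [OF R])
  have cl: "presented_class S R f = {i + f |i. i \<in> relation_ideal S R}" for f
    by (auto simp: presented_class_def a_r_coset_def r_coset_def)
  have in_ideal: "f - g \<in> relation_ideal S R \<longleftrightarrow> f - g \<in> gen_ideal R"
    using assms by (auto simp: relation_ideal_eq)
  have add: "a + b \<in> relation_ideal S R" if "a \<in> relation_ideal S R" "b \<in> relation_ideal S R" for a b
    using that R by (simp add: relation_ideal_eq gen_ideal_add Free_add)
  have neg: "- a \<in> relation_ideal S R" if "a \<in> relation_ideal S R" for a
    using that R by (simp add: relation_ideal_eq gen_ideal_uminus Free_uminus)
  show ?thesis
  proof
    assume eq: "presented_class S R f = presented_class S R g"
    have "f \<in> presented_class S R f" using R by (force simp: cl relation_ideal_eq gen_ideal.zero)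
    then obtain i where "i \<in> relation_ideal S R" "f = i + g"
      unfolding eq by (auto simp: cl)
    then show "f - g \<in> gen_ideal R" using in_ideal by simp
  next
    assume "f - g \<in> gen_ideal R"
    then have d: "f - g \<in> relation_ideal S R" using in_ideal by simp
    show "presented_class S R f = presented_class S R g"
    proof (intro subset_antisym subsetI)
      fix a assume "a \<in> presented_class S R f"
      then obtain i where "i \<in> relation_ideal S R" "a = i + f" by (auto simp: cl)
      then show "a \<in> presented_class S R g"
        using add [OF _ d, of i] by (auto simp: cl intro!: exI [of _ "i + (f - g)"])
    next
      fix a assume "a \<in> presented_class S R g"
      then obtain i where "i \<in> relation_ideal S R" "a = i + g" by (auto simp: cl)
      then show "a \<in> presented_class S R f"
        using add [OF _ neg [OF d], of i] by (auto simp: cl intro!: exI [of _ "i + (g - f)"])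
    qed
  qed
qed

text \<open>
  The union that defines the scalar action ranges over all representatives of a coset; they all give the
  same coset.
\<close>

lemma presented_class_scale:
  assumes R: "R \<subseteq> Free S" and f: "f \<in> Free S"
  shows "(\<Union>g\<in>presented_class S R f. presented_class S R (k *\<^sub>C g)) = presented_class S R (k *\<^sub>C f)"
proof -
  interpret I: ideal "relation_ideal S R" "free_algebra S"
    by (rule relation_ideal_ideal [OF R])
  have mem: "f \<in> presented_class S R f"
    using I.a_rcos_self [OF f] by (simp add: presented_class_def)
  have "presented_class S R (k *\<^sub>C g) = presented_class S R (k *\<^sub>C f)"
    if "g \<in> presented_class S R f" for g
  proof -
    obtain i where "i \<in> relation_ideal S R" "g = i + f"
      using \<open>g \<in> _\<close> by (auto simp: presented_class_def a_r_coset_def r_coset_def)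
    then have "k *\<^sub>C g - k *\<^sub>C f \<in> gen_ideal R" "g \<in> Free S"
      using f R by (auto simp: relation_ideal_eq scale_def distrib_left gen_ideal_mult_left)
    then show ?thesis using presented_class_eq_iff [OF R] f Free_scale by metis
  qed
  then show ?thesis using mem by blast
qed

lemma presented_algebra_simps:
  assumes R: "R \<subseteq> Free S"
  shows "carrier (presented_algebra S R) = presented_class S R ` Free S"
    and "one (presented_algebra S R) = presented_class S R 1"
    and "f \<in> Free S \<Longrightarrow> g \<in> Free S \<Longrightarrow> presented_class S R f \<otimes>\<^bsub>presented_algebra S R\<^esub> presented_class S R g
          = presented_class S R (f * g)"
    and "f \<in> Free S \<Longrightarrow> g \<in> Free S \<Longrightarrow> presented_class S R f \<oplus>\<^bsub>presented_algebra S R\<^esub> presented_class S R g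
          = presented_class S R (f + g)"
    and "f \<in> Free S \<Longrightarrow> k \<odot>\<^bsub>presented_algebra S R\<^esub> presented_class S R f = presented_class S R (k *\<^sub>C f)"
proof -
  interpret I: ideal "relation_ideal S R" "free_algebra S"
    by (rule relation_ideal_ideal [OF R])
  note ext = presented_algebra_def ring.defs module.defs FactRing_def
  show "carrier (presented_algebra S R) = presented_class S R ` Free S"
    by (auto simp: ext A_RCOSETS_def' presented_class_def)
  show "one (presented_algebra S R) = presented_class S R 1"
    by (simp add: ext presented_class_def)
  show "presented_class S R f \<otimes>\<^bsub>presented_algebra S R\<^esub> presented_class S R g
          = presented_class S R (f * g)" if "f \<in> Free S" "g \<in> Free S"
    using I.rcoset_mult_add [OF that] by (simp add: ext presented_class_def)
  show "presented_class S R f \<oplus>\<^bsub>presented_algebra S R\<^esub> presented_class S R g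
          = presented_class S R (f + g)" if "f \<in> Free S" "g \<in> Free S"
    using I.a_rcos_sum [OF that] by (simp add: ext presented_class_def)
  show "k \<odot>\<^bsub>presented_algebra S R\<^esub> presented_class S R f = presented_class S R (k *\<^sub>C f)"
    if "f \<in> Free S"
    using presented_class_scale [OF R that] by (simp add: ext)
qed

text \<open>
  A substitution induces an injective homomorphism of presented algebras as soon as it maps relations
  into the ideal and only elements of the ideal to elements of the ideal.
\<close>

proposition presented_algebra_embedding:
  fixes h :: "'g \<Rightarrow> 'h ncpoly"
  defines "\<Phi> \<equiv> substitution.eval ncscalar h"
  assumes R: "R \<subseteq> Free S" and R': "R' \<subseteq> Free S'"
    and letters: "\<And>a. a \<in> S \<Longrightarrow> h a \<in> Free S'"
    and rels: "\<And>r. r \<in> R \<Longrightarrow> \<Phi> r \<in> gen_ideal R'"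
    and inj: "\<And>f. f \<in> Free S \<Longrightarrow> \<Phi> f \<in> gen_ideal R' \<Longrightarrow> f \<in> gen_ideal R"
  shows "\<exists>\<phi> \<in> algebra_hom (presented_algebra S R) (presented_algebra S' R').
    inj_on \<phi> (carrier (presented_algebra S R)) \<and>
    (\<forall>f \<in> Free S. \<phi> (presented_class S R f) = presented_class S' R' (\<Phi> f))"
proof -
  interpret substitution ncscalar h by (rule substitution_ncpoly)
  have \<Phi>: "\<Phi> = eval" by (simp add: \<Phi>_def)
  have into: "eval f \<in> Free S'" if "f \<in> Free S" for f
    using that by (induction rule: free_algebra_induct) (auto simp: letters)
  have ideal: "eval f \<in> gen_ideal R'" if "f \<in> gen_ideal R" for f
    by (rule eval_gen_ideal [OF _ _ _ _ that])
      (use rels \<Phi> in \<open>auto intro: gen_ideal.zero gen_ideal_add gen_ideal_mult_left gen_ideal_mult_right\<close>)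
  define \<phi> where "\<phi> A = (SOME B. \<exists>f\<in>Free S. A = presented_class S R f \<and> B = presented_class S' R' (eval f))" for A
  have \<phi>: "\<phi> (presented_class S R f) = presented_class S' R' (eval f)" if f: "f \<in> Free S" for f
    unfolding \<phi>_def
  proof (rule some_equality)
    fix B assume "\<exists>g\<in>Free S. presented_class S R f = presented_class S R g \<and> B = presented_class S' R' (eval g)"
    then obtain g where g: "g \<in> Free S" "f - g \<in> gen_ideal R" "B = presented_class S' R' (eval g)"
      using f R by (auto simp: presented_class_eq_iff)
    then have "eval f - eval g \<in> gen_ideal R'" using ideal [of "f - g"] by simp
    then show "B = presented_class S' R' (eval f)"
      using g f into by (metis presented_class_eq_iff [OF R'])
  qed (use f in blast)
  show ?thesis
  proof (intro bexI [of _ \<phi>] conjI ballI)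
    show "inj_on \<phi> (carrier (presented_algebra S R))"
    proof (rule inj_onI)
      fix A B assume "A \<in> carrier (presented_algebra S R)" "B \<in> carrier (presented_algebra S R)"
        and eq: "\<phi> A = \<phi> B"
      then obtain f g where f: "f \<in> Free S" "A = presented_class S R f"
        and g: "g \<in> Free S" "B = presented_class S R g"
        by (auto simp: presented_algebra_simps [OF R])
      have "\<Phi> (f - g) \<in> gen_ideal R'"
        using eq f g into by (simp add: \<phi> \<Phi> presented_class_eq_iff [OF R'])
      then have "f - g \<in> gen_ideal R" using f g inj by blast
      then show "A = B" using f g by (simp add: presented_class_eq_iff [OF R])
    qed
    show "\<phi> (presented_class S R f) = presented_class S' R' (\<Phi> f)" if "f \<in> Free S" for f
      using \<phi> [OF that] by (simp add: \<Phi>)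
    show "\<phi> \<in> algebra_hom (presented_algebra S R) (presented_algebra S' R')"
      unfolding algebra_hom_def
    proof (intro CollectI conjI allI ballI)
      show "\<phi> \<in> Ring.ring_hom (presented_algebra S R) (presented_algebra S' R')"
        by (rule ring_hom_memI)
          (auto simp: presented_algebra_simps [OF R] presented_algebra_simps [OF R'] \<phi> into Free_mult Free_add)
      show "\<phi> (k \<odot>\<^bsub>presented_algebra S R\<^esub> A) = k \<odot>\<^bsub>presented_algebra S' R'\<^esub> \<phi> A"
        if "A \<in> carrier (presented_algebra S R)" for k A
        using that by (auto simp: presented_algebra_simps [OF R] presented_algebra_simps [OF R'] \<phi> into
            Free_scale eval_scale scale_def [symmetric])
    qed
  qed
qed

section \<open>Characters of the group of sign changes\<close>

text \<open>
  A set \<open>U\<close> of indices stands for the product of the sign changes at the indices in \<open>U\<close>, and \<open>X\<close> for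
  the joint eigenspace on which exactly the sign changes at indices in \<open>X\<close> act by \<open>-1\<close>. The value is
  the eigenvalue.
\<close>

definition sign_char :: "nat set \<Rightarrow> nat set \<Rightarrow> complex" where
  "sign_char U X = (\<Prod>k\<in>X. if k \<in> U then - 1 else 1)"

lemma sign_char_symmetric: "finite U \<Longrightarrow> finite X \<Longrightarrow> sign_char U X = sign_char X U"
  by (simp add: sign_char_def prod.If_cases Int_commute)

lemma sign_char_empty [simp]: "sign_char U {} = 1"
  by (simp add: sign_char_def)

lemma sign_char_empty_left [simp]: "sign_char {} X = 1"
  by (simp add: sign_char_def)

lemma sign_char_insert: "finite X \<Longrightarrow> i \<notin> X \<Longrightarrow> sign_char U (insert i X) = (if i \<in> U then - 1 else 1) * sign_char U X"
  by (simp add: sign_char_def)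

lemma sign_char_square [simp]: "sign_char U X * sign_char U X = 1"
  unfolding sign_char_def by (simp add: prod.distrib [symmetric] if_distrib cong: if_cong)

lemma sign_char_sym_diff: "sign_char (sym_diff U V) X = sign_char U X * sign_char V X"
  unfolding sign_char_def prod.distrib [symmetric] by (intro prod.cong) auto

lemma sign_char_flip:
  assumes "finite X"
  shows "sign_char U (sym_diff X {i}) = (if i \<in> U then - 1 else 1) * sign_char U X"
proof (cases "i \<in> X")
  case True
  then have "sign_char U X = (if i \<in> U then - 1 else 1) * sign_char U (X - {i})"
    using sign_char_insert [of "X - {i}" i U] assms by (simp add: insert_absorb)
  moreover have "sym_diff X {i} = X - {i}" using True by auto
  ultimately show ?thesis by simp
next
  case False
  then have "sym_diff X {i} = insert i X" by auto
  then show ?thesis using sign_char_insert [of X i U] False assms by simp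
qed

lemma sign_char_image: "inj_on w X \<Longrightarrow> sign_char U (w ` X) = sign_char {k. w k \<in> U} X"
  by (simp add: sign_char_def prod.reindex)

lemma sign_char_singleton: "finite X \<Longrightarrow> sign_char {i} X = (if i \<in> X then - 1 else 1)"
  by (subst sign_char_symmetric) (simp_all add: sign_char_def)

lemma sign_char_pair:
  "finite X \<Longrightarrow> i \<noteq> j \<Longrightarrow> sign_char {i, j} X = (if i \<in> X then - 1 else 1) * (if j \<in> X then - 1 else 1)"
  by (subst sign_char_symmetric) (simp_all add: sign_char_def)

lemma sign_char_below_product:
  assumes "i < j" "finite X"
  shows "sign_char {..<i} X * sign_char {..<j} X = (if i \<in> X then - 1 else 1) * sign_char {i<..<j} X"
proof -
  have "sym_diff {..<i} {..<j} = sym_diff {i} {i<..<j}" using assms(1) by auto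
  then show ?thesis
    unfolding sign_char_singleton [OF assms(2), symmetric] sign_char_sym_diff [symmetric] by simp
qed

text \<open>
  The sum over \<open>X\<close> is the expanded product of the factors \<open>1 \<plusminus> 1\<close>, one for each index; an index in
  exactly one of \<open>U\<close> and \<open>V\<close> contributes \<open>1 - 1\<close>.
\<close>

lemma sign_char_orthogonal:
  assumes "U \<subseteq> {..<n}" "V \<subseteq> {..<n}"
  shows "(\<Sum>X\<in>Pow {..<n}. sign_char U X * sign_char V X) = (if U = V then 2 ^ n else 0)"
proof -
  let ?W = "sym_diff U V"
  have "(\<Sum>X\<in>Pow {..<n}. sign_char U X * sign_char V X) = (\<Sum>X\<in>Pow {..<n}. sign_char ?W X * (\<Prod>k\<in>{..<n} - X. 1))"
    by (simp add: sign_char_sym_diff)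
  also have "\<dots> = (\<Prod>k<n. (if k \<in> ?W then - 1 else 1) + 1)"
    unfolding sign_char_def by (rule prod_add [symmetric]) simp
  also have "\<dots> = (if U = V then 2 ^ n else 0)"
  proof (cases "U = V")
    case False
    then obtain k where "k \<in> ?W" "k < n" using assms by blast
    then have "(\<Prod>k<n. (if k \<in> ?W then - 1 else 1) + 1 :: complex) = 0"
      by (intro prod_zero) auto
    then show ?thesis using False by simp
  qed simp
  finally show ?thesis .
qed

definition fourier :: "nat \<Rightarrow> (nat set \<Rightarrow> complex) \<Rightarrow> nat set \<Rightarrow> complex" where
  "fourier n f U = (\<Sum>X\<in>Pow {..<n}. f X * sign_char U X) / 2 ^ n"

lemma fourier_sign_char:
  assumes "U \<subseteq> {..<n}" "V \<subseteq> {..<n}"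
  shows "fourier n (sign_char U) V = (if U = V then 1 else 0)"
  using sign_char_orthogonal [OF assms] by (simp add: fourier_def)

lemma fourier_expansion:
  assumes X: "X \<subseteq> {..<n}"
  shows "f X = (\<Sum>U\<in>Pow {..<n}. fourier n f U * sign_char U X)"
proof -
  have sym: "sign_char U Y = sign_char Y U" if "U \<subseteq> {..<n}" "Y \<subseteq> {..<n}" for U Y
    using that by (intro sign_char_symmetric) (auto intro: finite_subset)
  have "(\<Sum>U\<in>Pow {..<n}. fourier n f U * sign_char U X) =
      (\<Sum>U\<in>Pow {..<n}. \<Sum>Y\<in>Pow {..<n}. f Y * (sign_char U Y * sign_char U X) / 2 ^ n)"
    by (simp add: fourier_def sum_divide_distrib sum_distrib_right mult.assoc)
  also have "\<dots> = (\<Sum>Y\<in>Pow {..<n}. \<Sum>U\<in>Pow {..<n}. f Y * (sign_char U Y * sign_char U X) / 2 ^ n)"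
    by (rule sum.swap)
  also have "\<dots> = (\<Sum>Y\<in>Pow {..<n}. f Y * (\<Sum>U\<in>Pow {..<n}. sign_char Y U * sign_char X U) / 2 ^ n)"
    by (intro sum.cong refl) (simp add: sum_distrib_left sum_divide_distrib sym X)
  also have "\<dots> = (\<Sum>Y\<in>Pow {..<n}. if Y = X then f Y else 0)"
    by (intro sum.cong refl) (simp add: sign_char_orthogonal X)
  also have "\<dots> = f X" using X by simp
  finally show ?thesis ..
qed

section \<open>Inversion signs of permutations\<close>

text \<open>
  The sign with which \<open>w\<close> acts on the exterior monomial with index set \<open>X\<close>.
\<close>

definition inv_sign :: "(nat \<Rightarrow> nat) \<Rightarrow> nat set \<Rightarrow> complex" where
  "inv_sign w X = (\<Prod>i\<in>X. \<Prod>j\<in>X. if i < j \<and> w j < w i then - 1 else 1)"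

lemma inv_sign_square [simp]: "inv_sign w X * inv_sign w X = 1"
  unfolding inv_sign_def prod.distrib [symmetric] by (intro prod.neutral ballI) simp

lemma inv_sign_increasing: "(\<And>i j. i \<in> X \<Longrightarrow> j \<in> X \<Longrightarrow> i < j \<Longrightarrow> w i \<le> w j) \<Longrightarrow> inv_sign w X = 1"
  unfolding inv_sign_def by (intro prod.neutral ballI) (meson not_le)

lemma inv_sign_id [simp]: "inv_sign id = (\<lambda>_. 1)"
  by (rule ext) (simp add: inv_sign_increasing)

text \<open>
  A pair \<open>i\<close>, \<open>k\<close> is an inversion iff exactly one of \<open>k < i\<close> and \<open>w k < w i\<close> holds, so the new inversions
  split into two characters of \<open>X\<close>.
\<close>

lemma inv_sign_insert:
  assumes X: "finite X" "i \<notin> X" and w: "inj_on w (insert i X)"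
  shows "inv_sign w (insert i X) = inv_sign w X * (sign_char {..<i} X * sign_char {k. w k < w i} X)"
proof -
  let ?c = "\<lambda>i j. if i < j \<and> w j < w i then - 1 else 1 :: complex"
  have "inv_sign w (insert i X) = (\<Prod>j\<in>X. ?c i j) * (\<Prod>a\<in>X. ?c a i * (\<Prod>j\<in>X. ?c a j))"
    using X by (simp add: inv_sign_def)
  also have "\<dots> = (\<Prod>k\<in>X. ?c i k * ?c k i) * inv_sign w X"
    by (simp add: prod.distrib inv_sign_def mult.assoc)
  also have "(\<Prod>k\<in>X. ?c i k * ?c k i) = sign_char {..<i} X * sign_char {k. w k < w i} X"
    unfolding sign_char_def prod.distrib [symmetric]
  proof (rule prod.cong)
    fix k assume k: "k \<in> X"
    then have "w k \<noteq> w i" "k \<noteq> i" using X w by (auto simp: inj_on_def)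
    then show "?c i k * ?c k i = (if k \<in> {..<i} then - 1 else 1) * (if k \<in> {k. w k < w i} then - 1 else 1)"
      by auto
  qed simp
  finally show ?thesis by (simp add: mult_ac)
qed

text \<open>
  The cocycle identity, which makes the twist multiplicative on the group.
\<close>

lemma inv_sign_compose:
  assumes "finite X" "inj_on v X" "inj_on w (v ` X)"
  shows "inv_sign (w \<circ> v) X = inv_sign w (v ` X) * inv_sign v X"
  using assms
proof (induction X)
  case empty
  then show ?case by (simp add: inv_sign_def)
next
  case (insert i X)
  have inj: "inj_on v X" "inj_on w (v ` X)" "v i \<notin> v ` X"
    "inj_on w (insert (v i) (v ` X))" "inj_on (w \<circ> v) (insert i X)"
    using insert.prems insert.hyps by (auto simp: inj_on_def)
  have "inv_sign (w \<circ> v) (insert i X) =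
      inv_sign w (v ` X) * inv_sign v X * (sign_char {..<i} X * sign_char {k. w (v k) < w (v i)} X)"
    using insert inj by (simp add: inv_sign_insert comp_def)
  moreover have "inv_sign w (v ` insert i X) =
      inv_sign w (v ` X) * (sign_char {k. v k < v i} X * sign_char {k. w (v k) < w (v i)} X)"
    using insert.hyps inj by (simp add: inv_sign_insert sign_char_image)
  moreover have "inv_sign v (insert i X) = inv_sign v X * (sign_char {..<i} X * sign_char {k. v k < v i} X)"
    using insert.hyps insert.prems(1) by (rule inv_sign_insert)
  moreover have perm: "(a * (c * d)) * (b * (e * c)) = a * b * (e * d) * (c * c)" for a b c d e :: complex
    by (simp add: mult_ac)
  ultimately show ?case by (simp only: perm sign_char_square mult_1_right)
qed

text \<open>
  This is the compatibility of the twist with the action of the group on the \<open>x\<^sub>i\<close>: moving a group element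
  past \<open>x\<^sub>i\<close> flips the eigenvalue of \<open>t\<^sub>i\<close>, and replaces the chain of sign changes below \<open>i\<close> by the one
  below \<open>w i\<close>.
\<close>

lemma inv_sign_flip:
  assumes X: "finite X" and w: "inj_on w (insert i X)"
  shows "inv_sign w (sym_diff X {i}) * sign_char {..<i} X = inv_sign w X * sign_char {k. w k < w i} X"
proof -
  have sq: "sign_char U X * (sign_char U X * a) = a" for U and X and a :: complex
    by (simp add: mult.assoc [symmetric])
  show ?thesis
  proof (cases "i \<in> X")
    case True
    define Y where "Y = X - {i}"
    have Y: "X = insert i Y" "i \<notin> Y" "finite Y" "sym_diff X {i} = Y"
      using True X by (auto simp: Y_def)
    have "inj_on w (insert i Y)" using w Y by simp
    then show ?thesis using Y
      by (simp add: inv_sign_insert sign_char_insert mult_ac sq) 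
  next
    case False
    then have "sym_diff X {i} = insert i X" by auto
    then show ?thesis using inv_sign_insert [OF X False w] by (simp add: mult_ac sq)
  qed
qed

text \<open>
  The inversions of a transposition are the pair \<open>i\<close>, \<open>j\<close> and, for each \<open>k\<close> in between, the pairs \<open>i\<close>, \<open>k\<close>
  and \<open>k\<close>, \<open>j\<close>.
\<close>

lemma inv_sign_transpose:
  assumes ij: "i < j" and X: "finite X"
  shows "inv_sign (transpose i j) X =
    (if i \<in> X then (if j \<in> X then - 1 else sign_char {i<..<j} X) else (if j \<in> X then sign_char {i<..<j} X else 1))"
proof -
  let ?w = "transpose i j"
  define Y where "Y = X - {i, j}"
  have Y: "finite Y" "i \<notin> Y" "j \<notin> Y" using X by (auto simp: Y_def)
  have w: "inj_on ?w Z" for Z by (simp add: inj_on_def transpose_def)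
  have fix_Y: "?w k = k" if "k \<in> Y" for k
    using that Y by (metis transpose_apply_other)
  have base: "inv_sign ?w Y = 1"
    by (rule inv_sign_increasing) (simp add: fix_Y)
  have low: "sign_char {k. ?w k < a} Y = sign_char {..<a} Y" for a
    unfolding sign_char_def by (intro prod.cong) (auto simp: fix_Y)
  have mid: "sign_char {..<i} Y * sign_char {..<j} Y = sign_char {i<..<j} Y"
    unfolding sign_char_def prod.distrib [symmetric] 
  proof (rule prod.cong)
    fix k assume "k \<in> Y"
    then have "k \<noteq> i" "k \<noteq> j" using Y by auto
    then show "(if k \<in> {..<i} then - 1 else 1) * (if k \<in> {..<j} then - 1 else 1) =
        (if k \<in> {i<..<j} then - 1 else 1 :: complex)"
      using ij by auto
  qed simp
  have i: "inv_sign ?w (insert i Y) = sign_char {i<..<j} Y"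
    using inv_sign_insert [OF Y(1,2) w] by (simp add: base low mid)
  have j: "inv_sign ?w (insert j Y) = sign_char {i<..<j} Y"
    using inv_sign_insert [OF Y(1,3) w] by (simp add: base low mid mult.commute)
  have ijY: "inv_sign ?w (insert j (insert i Y)) = - 1"
    using inv_sign_insert [of "insert i Y" j ?w] Y ij w
    by (simp add: i sign_char_insert low mid mult_ac)
  consider "X = Y" "i \<notin> X" "j \<notin> X" | "X = insert i Y" "i \<in> X" "j \<notin> X"
    | "X = insert j Y" "i \<notin> X" "j \<in> X" | "X = insert j (insert i Y)" "i \<in> X" "j \<in> X"
    by (auto simp: Y_def)
  then show ?thesis
    by cases (use base i j ijY Y ij in \<open>simp_all add: sign_char_insert\<close>)
qed

text \<open>
  Averages over the roots of unity only see the eigenspaces on which \<open>t\<^sub>i t\<^sub>j\<close> has one fixed eigenvalue.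
  There the sign of the transposition is a single character, with \<open>i\<close> and \<open>j\<close> in either order; this lemma
  treats the eigenvalue \<open>-1\<close> and the next one the eigenvalue \<open>1\<close>.
\<close>

lemma inv_sign_transpose_unequal:
  assumes "i \<noteq> j" "finite X" "(i \<in> X) \<noteq> (j \<in> X)"
  shows "inv_sign (transpose i j) X =
    (if j < i then 1 else - 1) * (sign_char {j} X * (sign_char {..<i} X * sign_char {..<j} X))"
proof (cases "i < j")
  case True
  then show ?thesis
    using assms by (simp add: inv_sign_transpose sign_char_below_product sign_char_singleton)
next
  case False
  then have "j < i" using assms by simp
  then show ?thesis
    using assms sign_char_below_product [of j i X]
    by (simp add: inv_sign_transpose transpose_commute [of i j] mult.commute [of "sign_char {..<i} X"] sign_char_singleton)
qed

lemma inv_sign_transpose_equal: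
  assumes "i \<noteq> j" "finite X" "(i \<in> X) = (j \<in> X)"
  shows "inv_sign (transpose i j) X = sign_char {j} X"
proof (cases "i < j")
  case True
  then show ?thesis using assms by (simp add: inv_sign_transpose sign_char_singleton)
next
  case False
  then have "j < i" using assms by simp
  then show ?thesis
    using assms by (simp add: inv_sign_transpose transpose_commute [of i j] sign_char_singleton)
qed

section \<open>Monomial matrices\<close>

text \<open>
  The permutation and the entries of a monomial matrix: it sends \<open>x\<^sub>i\<close> to \<open>mcoef n g i\<close> times the basis
  vector with index \<open>mperm n g i\<close>. Fixing all \<open>i \<ge> n\<close> makes \<open>mperm n g\<close> a permutation of the type of
  natural numbers.
\<close>

definition mperm :: "nat \<Rightarrow> complex mat \<Rightarrow> nat \<Rightarrow> nat" where
  "mperm n g i = (if i < n then THE a. a < n \<and> g $$ (a, i) \<noteq> 0 else i)"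

definition mcoef :: "nat \<Rightarrow> complex mat \<Rightarrow> nat \<Rightarrow> complex" where
  "mcoef n g i = g $$ (mperm n g i, i)"

definition mono_mat :: "nat \<Rightarrow> (nat \<Rightarrow> nat) \<Rightarrow> (nat \<Rightarrow> complex) \<Rightarrow> complex mat" where
  "mono_mat n w d = mat n n (\<lambda>(a, b). if a = w b then d b else 0)"

lemma mono_mat_carrier [simp]: "mono_mat n w d \<in> carrier_mat n n"
  and mono_mat_dim [simp]: "dim_row (mono_mat n w d) = n" "dim_col (mono_mat n w d) = n"
  by (simp_all add: mono_mat_def)

lemma mono_mat_index [simp]: "a < n \<Longrightarrow> b < n \<Longrightarrow> mono_mat n w d $$ (a, b) = (if a = w b then d b else 0)"
  by (simp add: mono_mat_def)

lemma mono_mat_cong: "(\<And>i. i < n \<Longrightarrow> w i = w' i \<and> d i = d' i) \<Longrightarrow> mono_mat n w d = mono_mat n w' d'"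
  unfolding mono_mat_def by (rule cong_mat) auto

lemma permutes_lt: "w permutes {..<n} \<Longrightarrow> i < n \<Longrightarrow> w i < (n :: nat)"
  using permutes_in_image [of w "{..<n}" i] by simp

lemma mono_mat_monomial:
  assumes w: "w permutes {..<n}" and d: "\<And>i. i < n \<Longrightarrow> d i \<noteq> 0"
  shows "monomial_mat n (mono_mat n w d)"
  unfolding monomial_mat_def
proof (intro conjI allI impI)
  fix i assume i: "i < n"
  have inv: "inv_into UNIV w i < n" "w (inv_into UNIV w i) = i"
    using permutes_lt [OF permutes_inv [OF w] i] permutes_inverses [OF w] by auto
  show "\<exists>!j. j < n \<and> mono_mat n w d $$ (i, j) \<noteq> 0"
  proof (rule ex1I [of _ "inv_into UNIV w i"])
    show "j = inv_into UNIV w i" if "j < n \<and> mono_mat n w d $$ (i, j) \<noteq> 0" for j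
      using that i permutes_inverses [OF w] by (auto split: if_splits)
  qed (use i inv d in auto)
  show "\<exists>!a. a < n \<and> mono_mat n w d $$ (a, i) \<noteq> 0"
    by (rule ex1I [of _ "w i"]) (use i d permutes_lt [OF w] in \<open>auto split: if_splits\<close>)
qed simp

lemma mperm_mono_mat [simp]:
  assumes w: "w permutes {..<n}" and d: "\<And>i. i < n \<Longrightarrow> d i \<noteq> 0"
  shows "mperm n (mono_mat n w d) = w"
proof
  fix i
  show "mperm n (mono_mat n w d) i = w i"
  proof (cases "i < n")
    case True
    then show ?thesis unfolding mperm_def
      by simp (rule the_equality, use d permutes_lt [OF w] in \<open>auto split: if_splits\<close>)
  next
    case False
    then show ?thesis using permutes_not_in [OF w] by (simp add: mperm_def)
  qed
qed

lemma mcoef_mono_mat [simp]: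
  assumes "w permutes {..<n}" "\<And>i. i < n \<Longrightarrow> d i \<noteq> 0" "i < n"
  shows "mcoef n (mono_mat n w d) i = d i"
  using assms by (simp add: mcoef_def permutes_lt)

lemma monomial_mat_column:
  assumes g: "monomial_mat n g" and i: "i < n"
  shows "mperm n g i < n" "mcoef n g i \<noteq> 0"
    and "\<And>a. a < n \<Longrightarrow> g $$ (a, i) = (if a = mperm n g i then mcoef n g i else 0)"
proof -
  have ex: "\<exists>!a. a < n \<and> g $$ (a, i) \<noteq> 0" using g i by (simp add: monomial_mat_def)
  have p: "mperm n g i < n \<and> g $$ (mperm n g i, i) \<noteq> 0"
    using theI' [OF ex] i by (simp add: mperm_def)
  then show "mperm n g i < n" "mcoef n g i \<noteq> 0" by (simp_all add: mcoef_def)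
  show "g $$ (a, i) = (if a = mperm n g i then mcoef n g i else 0)" if "a < n" for a
    using ex p that by (auto simp: mcoef_def)
qed

lemma mperm_permutes:
  assumes g: "monomial_mat n g"
  shows "mperm n g permutes {..<n}"
proof (rule bij_imp_permutes)
  have "inj_on (mperm n g) {..<n}"
  proof (rule inj_onI)
    fix i j assume ij: "i \<in> {..<n}" "j \<in> {..<n}" "mperm n g i = mperm n g j"
    let ?a = "mperm n g i"
    have "\<exists>!j. j < n \<and> g $$ (?a, j) \<noteq> 0"
      using g monomial_mat_column(1) [OF g, of i] ij by (simp add: monomial_mat_def)
    moreover have "g $$ (?a, i) \<noteq> 0" "g $$ (?a, j) \<noteq> 0"
      using monomial_mat_column [OF g] ij by auto
    ultimately show "i = j" using ij by blast
  qed
  moreover have "mperm n g ` {..<n} \<subseteq> {..<n}" using monomial_mat_column(1) [OF g] by auto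
  ultimately show "bij_betw (mperm n g) {..<n} {..<n}"
    by (simp add: bij_betw_def endo_inj_surj)
qed (simp add: mperm_def)

lemma monomial_mat_eq:
  assumes g: "monomial_mat n g"
  shows "g = mono_mat n (mperm n g) (mcoef n g)"
proof (rule eq_matI)
  fix a b assume "a < dim_row (mono_mat n (mperm n g) (mcoef n g))"
    "b < dim_col (mono_mat n (mperm n g) (mcoef n g))"
  then show "g $$ (a, b) = mono_mat n (mperm n g) (mcoef n g) $$ (a, b)"
    using monomial_mat_column(3) [OF g] by simp
qed (use g in \<open>auto simp: monomial_mat_def\<close>)

lemma mono_mat_mult:
  assumes v: "v permutes {..<n}"
  shows "mono_mat n w d * mono_mat n v e = mono_mat n (w \<circ> v) (\<lambda>i. d (v i) * e i)"
proof (rule eq_matI)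
  fix a b assume "a < dim_row (mono_mat n (w \<circ> v) (\<lambda>i. d (v i) * e i))"
    "b < dim_col (mono_mat n (w \<circ> v) (\<lambda>i. d (v i) * e i))"
  then have ab: "a < n" "b < n" by simp_all
  have "(mono_mat n w d * mono_mat n v e) $$ (a, b) =
      (\<Sum>k<n. mono_mat n w d $$ (a, k) * mono_mat n v e $$ (k, b))"
    using ab by (simp add: scalar_prod_def atLeast0LessThan)
  also have "\<dots> = (\<Sum>k<n. if k = v b then mono_mat n w d $$ (a, v b) * e b else 0)"
    using ab by (intro sum.cong refl) auto
  finally show "(mono_mat n w d * mono_mat n v e) $$ (a, b) =
      mono_mat n (w \<circ> v) (\<lambda>i. d (v i) * e i) $$ (a, b)"
    using ab permutes_lt [OF v] by simp
qed simp_all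

lemma mono_mat_one: "1\<^sub>m n = mono_mat n id (\<lambda>_. 1)"
  by (rule eq_matI) auto

lemma monomial_mat_mult:
  assumes g: "monomial_mat n g" and h: "monomial_mat n h"
  shows "monomial_mat n (g * h)" "mperm n (g * h) = mperm n g \<circ> mperm n h"
    and "i < n \<Longrightarrow> mcoef n (g * h) i = mcoef n g (mperm n h i) * mcoef n h i"
proof -
  have eq: "g * h = mono_mat n (mperm n g \<circ> mperm n h) (\<lambda>i. mcoef n g (mperm n h i) * mcoef n h i)"
    using mono_mat_mult [OF mperm_permutes [OF h]] monomial_mat_eq [OF g] monomial_mat_eq [OF h] by metis
  have w: "mperm n g \<circ> mperm n h permutes {..<n}"
    by (intro permutes_compose mperm_permutes g h)
  have d: "mcoef n g (mperm n h i) * mcoef n h i \<noteq> 0" if "i < n" for i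
    using that g h by (simp add: monomial_mat_column)
  show "monomial_mat n (g * h)" "mperm n (g * h) = mperm n g \<circ> mperm n h"
    and "i < n \<Longrightarrow> mcoef n (g * h) i = mcoef n g (mperm n h i) * mcoef n h i"
    unfolding eq using mono_mat_monomial [OF w d] mperm_mono_mat [OF w d] mcoef_mono_mat [OF w d] by auto
qed

lemma monomial_mat_eqI:
  assumes "monomial_mat n g" "monomial_mat n h"
    "\<And>i. i < n \<Longrightarrow> mperm n g i = mperm n h i" "\<And>i. i < n \<Longrightarrow> mcoef n g i = mcoef n h i"
  shows "g = h"
  using monomial_mat_eq [OF assms(1)] monomial_mat_eq [OF assms(2)] mono_mat_cong assms(3,4) by metis

definition mono_inv :: "nat \<Rightarrow> complex mat \<Rightarrow> complex mat" where
  "mono_inv n g = mono_mat n (inv_into UNIV (mperm n g)) (\<lambda>i. inverse (mcoef n g (inv_into UNIV (mperm n g) i)))"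

lemma mono_inv:
  assumes g: "monomial_mat n g"
  shows "monomial_mat n (mono_inv n g)" "mono_inv n g * g = 1\<^sub>m n" "g * mono_inv n g = 1\<^sub>m n"
    and "i < n \<Longrightarrow> mcoef n (mono_inv n g) i = inverse (mcoef n g (inv_into UNIV (mperm n g) i))"
    and "\<And>i a. i < n \<Longrightarrow> a < n \<Longrightarrow>
      mono_inv n g $$ (i, a) = (if a = mperm n g i then inverse (mcoef n g i) else 0)"
proof -
  let ?w = "mperm n g"
  have w: "?w permutes {..<n}" by (rule mperm_permutes [OF g])
  note w' = permutes_inv [OF w] and wi = permutes_inverses [OF w]
  have d': "inverse (mcoef n g (inv_into UNIV ?w i)) \<noteq> 0" if "i < n" for i
    using monomial_mat_column(2) [OF g permutes_lt [OF w' that]] by simp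
  show "monomial_mat n (mono_inv n g)"
    unfolding mono_inv_def using w' d' by (rule mono_mat_monomial)
  show "i < n \<Longrightarrow> mcoef n (mono_inv n g) i = inverse (mcoef n g (inv_into UNIV (mperm n g) i))"
    unfolding mono_inv_def using w' d' by (rule mcoef_mono_mat)
  show "mono_inv n g $$ (i, a) = (if a = ?w i then inverse (mcoef n g i) else 0)"
    if "i < n" "a < n" for i a
    using that wi permutes_lt [OF w] by (auto simp: mono_inv_def)
  have "mono_inv n g * mono_mat n ?w (mcoef n g) = 1\<^sub>m n"
    unfolding mono_inv_def mono_mat_mult [OF w] mono_mat_one
    by (rule mono_mat_cong) (use wi monomial_mat_column(2) [OF g] in auto)
  then show "mono_inv n g * g = 1\<^sub>m n" using monomial_mat_eq [OF g] by simp
  have "mono_mat n ?w (mcoef n g) * mono_inv n g = 1\<^sub>m n"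
    unfolding mono_inv_def mono_mat_mult [OF w'] mono_mat_one
    by (rule mono_mat_cong) (use wi monomial_mat_column(2) [OF g] permutes_lt [OF w'] in auto)
  then show "g * mono_inv n g = 1\<^sub>m n" using monomial_mat_eq [OF g] by simp
qed

lemma det_monomial_mat:
  assumes g: "monomial_mat n g"
  shows "det g = signof (mperm n g) * (\<Prod>i<n. mcoef n g i)"
proof -
  let ?w = "mperm n g"
  have w: "?w permutes {..<n}" by (rule mperm_permutes [OF g])
  have gc: "g \<in> carrier_mat n n" using g by (simp add: monomial_mat_def)
  have "det g = (\<Sum>p\<in>{p. p permutes {0..<n}}. signof p * (\<Prod>i<n. g $$ (p i, i)))"
    using det_col [OF gc] by simp
  also have "\<dots> = (\<Sum>p\<in>{p. p permutes {0..<n}}. if p = ?w then signof ?w * (\<Prod>i<n. mcoef n g i) else 0)"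
  proof (rule sum.cong)
    fix p assume "p \<in> {p. p permutes {0..<n}}"
    then have p: "p permutes {..<n}" by (simp add: atLeast0LessThan)
    show "signof p * (\<Prod>i<n. g $$ (p i, i)) = (if p = ?w then signof ?w * (\<Prod>i<n. mcoef n g i) else 0)"
    proof (cases "p = ?w")
      case True
      then show ?thesis by (simp add: mcoef_def)
    next
      case False
      then obtain i where "p i \<noteq> ?w i" by blast
      then have "i < n" using permutes_not_in [OF p] permutes_not_in [OF w] by (metis lessThan_iff)
      then have "g $$ (p i, i) = 0"
        using monomial_mat_column(3) [OF g] permutes_lt [OF p] \<open>p i \<noteq> ?w i\<close> by simp
      then have "(\<Prod>i<n. g $$ (p i, i)) = 0" using \<open>i < n\<close> by (intro prod_zero) auto
      then show ?thesis using False by simp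
    qed
  qed simp
  also have "\<dots> = signof ?w * (\<Prod>i<n. mcoef n g i)"
    using w by (simp add: atLeast0LessThan finite_permutations)
  finally show ?thesis .
qed

lemma nonzero_positions_eq:
  assumes g: "monomial_mat n g"
  shows "nonzero_positions n g = (\<lambda>i. (mperm n g i, i)) ` {..<n}"
  using monomial_mat_column [OF g] by (force simp: nonzero_positions_def split: if_splits)

section \<open>The groups of monomial matrices\<close>

text \<open>
  The group \<open>\<mu>(G(m,p,n))\<close>, with \<open>k\<close> for \<open>m div p\<close>.
\<close>

definition mono_group :: "nat \<Rightarrow> nat \<Rightarrow> nat \<Rightarrow> complex mat set" where
  "mono_group m k n = {g. monomial_mat n g \<and> (\<forall>i<n. mcoef n g i ^ m = 1) \<and> det g ^ k = 1}"

lemma nonzero_positions_roots: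
  assumes g: "monomial_mat n g"
  shows "(\<forall>ij \<in> nonzero_positions n g. g $$ ij \<in> unity_roots m) \<longleftrightarrow> (\<forall>i<n. mcoef n g i ^ m = 1)"
    and "(\<Prod>ij \<in> nonzero_positions n g. g $$ ij) = (\<Prod>i<n. mcoef n g i)"
  by (auto simp: nonzero_positions_eq [OF g] unity_roots_def mcoef_def prod.reindex inj_on_def)

lemma carrier_\<mu>Gmpn: "carrier (\<mu>Gmpn m p n) = mono_group m (m div p) n"
  unfolding \<mu>Gmpn_def mat_monoid_def mono_group_def
  by (simp add: nonzero_positions_roots cong: conj_cong) (simp add: unity_roots_def)

text \<open>
  The product of the entries and the determinant differ by the sign of the permutation, whose even powers
  are trivial.
\<close>

lemma carrier_Gmpn_even:
  assumes "even (m div p)"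
  shows "carrier (Gmpn m p n) = mono_group m (m div p) n"
proof -
  have "det g ^ (m div p) = (\<Prod>i<n. mcoef n g i) ^ (m div p)" if "monomial_mat n g" for g
    using assms det_monomial_mat [OF that] by (auto simp: power_mult_distrib sign_def)
  then show ?thesis
    unfolding Gmpn_def mat_monoid_def mono_group_def
    by (simp add: nonzero_positions_roots cong: conj_cong) (simp add: unity_roots_def cong: conj_cong)
qed

lemma mono_group_monomial: "g \<in> mono_group m k n \<Longrightarrow> monomial_mat n g"
  by (simp add: mono_group_def)

lemma det_mult_monomial:
  "monomial_mat n g \<Longrightarrow> monomial_mat n h \<Longrightarrow> det (g * h) = det g * det h"
  by (intro det_mult [of _ n]) (simp_all add: monomial_mat_def)

lemma mono_group_mult: "g \<in> mono_group m k n \<Longrightarrow> h \<in> mono_group m k n \<Longrightarrow> g * h \<in> mono_group m k n"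
  by (auto simp: mono_group_def monomial_mat_mult det_mult_monomial power_mult_distrib monomial_mat_column(1))

lemma mono_group_inv:
  assumes g: "g \<in> mono_group m k n"
  shows "mono_inv n g \<in> mono_group m k n"
proof -
  have mg: "monomial_mat n g" using g by (simp add: mono_group_def)
  have "det (mono_inv n g) * det g = 1"
    using det_mult_monomial [OF mono_inv(1) [OF mg] mg] mono_inv(2) [OF mg] by simp
  then have "det (mono_inv n g) ^ k * det g ^ k = 1" by (simp add: power_mult_distrib [symmetric])
  then show ?thesis
    using g mono_inv [OF mg] permutes_lt [OF permutes_inv [OF mperm_permutes [OF mg]]]
    by (simp add: mono_group_def power_inverse)
qed

lemma mono_mat_group:
  assumes "w permutes {..<n}" "\<And>i. i < n \<Longrightarrow> d i ^ m = 1" "m > 0"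
    "(signof w * (\<Prod>i<n. d i)) ^ k = 1"
  shows "mono_mat n w d \<in> mono_group m k n"
proof -
  have d: "d i \<noteq> 0" if "i < n" for i using assms(2) [OF that] assms(3) by (auto simp: power_0_left)
  note m = mono_mat_monomial [OF assms(1) d] and c = mcoef_mono_mat [OF assms(1) d]
  show ?thesis
    using assms m c det_monomial_mat [OF m] mperm_mono_mat [OF assms(1) d] by (simp add: mono_group_def)
qed

lemma mono_group_one: "1\<^sub>m n \<in> mono_group m k n"
proof -
  have "mcoef n (1\<^sub>m n) i = 1" if "i < n" for i
    unfolding mono_mat_one by (rule mcoef_mono_mat) (use that in \<open>simp_all add: permutes_id\<close>)
  moreover have "monomial_mat n (1\<^sub>m n)"
    unfolding mono_mat_one by (rule mono_mat_monomial) (simp_all add: permutes_id)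
  ultimately show ?thesis by (simp add: mono_group_def)
qed

text \<open>
  The inverse in the group does not depend on the group in which it is taken.
\<close>

lemma m_inv_mono_group:
  assumes \<Gamma>: "\<Gamma> = mat_monoid n (mono_group m k n)" and g: "g \<in> mono_group m k n"
  shows "inv\<^bsub>\<Gamma>\<^esub> g = mono_inv n g"
proof -
  have mg: "monomial_mat n g" using g by (simp add: mono_group_def)
  have carr: "h \<in> carrier_mat n n" if "h \<in> mono_group m k n" for h
    using that by (simp add: mono_group_def monomial_mat_def)
  have uniq: "h = mono_inv n g" if "h \<in> mono_group m k n" "g * h = 1\<^sub>m n" for h
  proof -
    have "h = (mono_inv n g * g) * h" using mono_inv(2) [OF mg] carr [OF that(1)] by simp
    also have "\<dots> = mono_inv n g * (g * h)"
      by (rule assoc_mult_mat [of _ n n _ n _ n]) (simp_all add: carr that(1) g mono_group_inv)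
    also have "\<dots> = mono_inv n g" using that(2) carr [OF mono_group_inv [OF g]] by simp
    finally show ?thesis .
  qed
  show ?thesis
    unfolding m_inv_def \<Gamma> mat_monoid_def
    by (rule the_equality) (simp_all add: mono_inv [OF mg] mono_group_inv [OF g], blast intro: uniq)
qed

section \<open>Sign changes and reflections\<close>

definition sgn_mat :: "nat \<Rightarrow> nat set \<Rightarrow> complex mat" where
  "sgn_mat n U = mono_mat n id (\<lambda>i. if i \<in> U then - 1 else 1)"

lemma sgn_mat_monomial [simp]: "monomial_mat n (sgn_mat n U)"
  and mperm_sgn_mat [simp]: "mperm n (sgn_mat n U) = id"
  and mcoef_sgn_mat [simp]: "i < n \<Longrightarrow> mcoef n (sgn_mat n U) i = (if i \<in> U then - 1 else 1)"
  unfolding sgn_mat_def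
  by (rule mono_mat_monomial mperm_mono_mat mcoef_mono_mat; simp add: permutes_id)+

lemma sgn_mat_mult: "sgn_mat n U * sgn_mat n V = sgn_mat n (sym_diff U V)"
  by (rule monomial_mat_eqI [of n]) (auto simp: monomial_mat_mult)

lemma sgn_mat_empty: "sgn_mat n {} = 1\<^sub>m n"
  by (simp add: sgn_mat_def mono_mat_one)

lemma sgn_mat_group:
  assumes "even m" "even k" "m > 0"
  shows "sgn_mat n U \<in> mono_group m k n"
proof -
  have "(\<Prod>i<n. if i \<in> U then - 1 else 1 :: complex) ^ k = 1"
    using assms(2) by (simp add: prod_power_distrib if_distrib [of "\<lambda>x. x ^ k"] prod.neutral cong: if_cong)
  then show ?thesis
    unfolding sgn_mat_def using assms by (intro mono_mat_group) (auto simp: permutes_id)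
qed

lemma t_mat_mono: "t_mat n i z = mono_mat n id (\<lambda>a. if a = i then z else 1)"
  unfolding t_mat_def by (rule eq_matI) auto

lemma t_mat_sgn: "t_mat n i (- 1) = sgn_mat n {i}"
  unfolding t_mat_mono sgn_mat_def by (rule mono_mat_cong) auto

lemma t_mat_group:
  assumes "z ^ m = 1" "z ^ k = 1" "m > 0"
  shows "t_mat n i z \<in> mono_group m k n"
  unfolding t_mat_mono using assms by (intro mono_mat_group) (auto simp: permutes_id)

lemma swap_mat_mono: "i \<noteq> j \<Longrightarrow> i < n \<Longrightarrow> j < n \<Longrightarrow>
  swap_mat n i j a b = mono_mat n (transpose i j) (\<lambda>k. if k = i then a else if k = j then b else 1)"
  unfolding swap_mat_def by (rule eq_matI) (auto simp: transpose_def)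

context
  fixes n i j :: nat and a b :: complex
  assumes ij: "i \<noteq> j" "i < n" "j < n" and ab: "a \<noteq> 0" "b \<noteq> 0"
begin

lemma transpose_permutes: "transpose i j permutes {..<n}"
  using ij by (intro permutes_swap_id) auto

lemma swap_mat_monomial [simp]: "monomial_mat n (swap_mat n i j a b)"
  and mperm_swap_mat [simp]: "mperm n (swap_mat n i j a b) = transpose i j"
  and mcoef_swap_mat [simp]: "l < n \<Longrightarrow> mcoef n (swap_mat n i j a b) l = (if l = i then a else if l = j then b else 1)"
  unfolding swap_mat_mono [OF ij]
  by (rule mono_mat_monomial mperm_mono_mat mcoef_mono_mat; use transpose_permutes ab in simp)+

lemma det_swap_mat: "det (swap_mat n i j a b) = - (a * b)"
proof -
  have "(\<Prod>l<n. mcoef n (swap_mat n i j a b) l) = (\<Prod>l\<in>{i, j}. if l = i then a else if l = j then b else 1)"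
    by (rule prod.mono_neutral_cong_right) (use ij in auto)
  then show ?thesis
    using ij by (simp add: det_monomial_mat [OF swap_mat_monomial] sign_swap_id)
qed

end

lemma swap_mat_group:
  assumes "i \<noteq> j" "i < n" "j < n" "m > 0" "even m" "\<epsilon> ^ m = 1" "\<theta> = 1 \<or> \<theta> = - 1" "\<theta> = - 1 \<or> even k"
  shows "swap_mat n i j (inverse \<epsilon>) (\<theta> * \<epsilon>) \<in> mono_group m k n"
proof -
  have e: "inverse \<epsilon> \<noteq> 0" "\<theta> * \<epsilon> \<noteq> 0" using assms by (auto simp: power_0_left)
  have "(- \<theta>) ^ k = 1" "\<theta> ^ m = 1" using assms by auto
  then show ?thesis
    using e assms det_swap_mat [OF assms(1-3) e]
    by (auto simp: mono_group_def power_mult_distrib power_inverse)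
qed

lemma swap_mat_mult_sgn:
  assumes ij: "i \<noteq> j" "i < n" "j < n" and ab: "a \<noteq> 0" "b \<noteq> 0"
  shows "swap_mat n i j a b * sgn_mat n {j} = swap_mat n i j a (- b)"
    and "swap_mat n i j a b * sgn_mat n {i, j} = swap_mat n i j (- a) (- b)"
proof -
  have 1: "- a \<noteq> 0" "- b \<noteq> 0" using ab by simp_all
  note swap = swap_mat_monomial [OF ij] mperm_swap_mat [OF ij] mcoef_swap_mat [OF ij]
  show "swap_mat n i j a b * sgn_mat n {j} = swap_mat n i j a (- b)"
    "swap_mat n i j a b * sgn_mat n {i, j} = swap_mat n i j (- a) (- b)"
    by (rule monomial_mat_eqI [of n]; use ij ab in \<open>simp add: monomial_mat_mult swap\<close>)+
qed

section \<open>Both families of relations at once\<close>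

text \<open>
  The sign \<open>\<eta>\<close> is \<open>1\<close> for the rational Cherednik algebra and \<open>-1\<close> for the negative braided one; in the
  second case \<open>c\<^sub>1\<close> and \<open>c\<close> are the negatives of the usual parameters. The action of a monomial matrix on
  the \<open>x\<^sub>i\<close> and \<open>y\<^sub>i\<close> is written out, and \<open>k\<close> stands for \<open>m div p\<close>.
\<close>

definition twisted_rels ::
  "complex \<Rightarrow> nat \<Rightarrow> nat \<Rightarrow> nat \<Rightarrow> complex \<Rightarrow> complex \<Rightarrow> (complex \<Rightarrow> complex) \<Rightarrow> gen ncpoly set" where
  "twisted_rels \<eta> m k n \<t> c\<^sub>1 c =
    {grp (1\<^sub>m n) - 1} \<union>
    {grp g * grp h - grp (g * h) | g h. g \<in> mono_group m k n \<and> h \<in> mono_group m k n} \<union>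
    {grp g * \<x> i - mcoef n g i *\<^sub>C (\<x> (mperm n g i) * grp g) | g i. g \<in> mono_group m k n \<and> i < n} \<union>
    {grp g * \<y> i - inverse (mcoef n g i) *\<^sub>C (\<y> (mperm n g i) * grp g) | g i. g \<in> mono_group m k n \<and> i < n} \<union>
    {\<x> i * \<x> j - \<eta> *\<^sub>C (\<x> j * \<x> i) | i j. i < n \<and> j < n \<and> i \<noteq> j} \<union>
    {\<y> i * \<y> j - \<eta> *\<^sub>C (\<y> j * \<y> i) | i j. i < n \<and> j < n \<and> i \<noteq> j} \<union>
    {(\<y> i * \<x> j - \<eta> *\<^sub>C (\<x> j * \<y> i))
       - (\<eta> * c\<^sub>1) *\<^sub>C (\<Sum>\<epsilon>\<in>unity_roots m. \<epsilon> *\<^sub>C grp (swap_mat n i j (inverse \<epsilon>) (\<eta> * \<epsilon>)))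
     | i j. i < n \<and> j < n \<and> i \<noteq> j} \<union>
    {(\<y> i * \<x> i - \<x> i * \<y> i)
       - (\<t> *\<^sub>C 1
          - c\<^sub>1 *\<^sub>C (\<Sum>j\<in>{..<n} - {i}. \<Sum>\<epsilon>\<in>unity_roots m. grp (swap_mat n i j (inverse \<epsilon>) (\<eta> * \<epsilon>)))
          - (\<Sum>\<zeta>\<in>unity_roots k - {1}. c \<zeta> *\<^sub>C grp (t_mat n i \<zeta>)))
     | i. i < n}"

lemma act_x_monomial:
  assumes g: "monomial_mat n g" and i: "i < n"
  shows "act_x n g i = mcoef n g i *\<^sub>C \<x> (mperm n g i)"
proof -
  have "act_x n g i = (\<Sum>a<n. if a = mperm n g i then mcoef n g i *\<^sub>C \<x> a else 0)"
    unfolding act_x_def by (intro sum.cong refl) (simp add: monomial_mat_column(3) [OF g i])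
  then show ?thesis using monomial_mat_column(1) [OF g i] by simp
qed

lemma act_y_monomial:
  assumes \<Gamma>: "\<Gamma> = mat_monoid n (mono_group m k n)" and g: "g \<in> mono_group m k n" and i: "i < n"
  shows "act_y n \<Gamma> g i = inverse (mcoef n g i) *\<^sub>C \<y> (mperm n g i)"
proof -
  have mg: "monomial_mat n g" using g by (rule mono_group_monomial)
  have "act_y n \<Gamma> g i = (\<Sum>a<n. if a = mperm n g i then inverse (mcoef n g i) *\<^sub>C \<y> a else 0)"
    unfolding act_y_def m_inv_mono_group [OF \<Gamma> g]
    by (intro sum.cong refl) (simp add: mono_inv(5) [OF mg i])
  then show ?thesis using monomial_mat_column(1) [OF mg i] by simp
qed

lemma group_rels_eq:
  assumes \<Gamma>: "\<Gamma> = mat_monoid n (mono_group m k n)"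
  shows "group_rels n \<Gamma> =
    {grp (1\<^sub>m n) - 1} \<union>
    {grp g * grp h - grp (g * h) | g h. g \<in> mono_group m k n \<and> h \<in> mono_group m k n} \<union>
    {grp g * \<x> i - mcoef n g i *\<^sub>C (\<x> (mperm n g i) * grp g) | g i. g \<in> mono_group m k n \<and> i < n} \<union>
    {grp g * \<y> i - inverse (mcoef n g i) *\<^sub>C (\<y> (mperm n g i) * grp g) | g i. g \<in> mono_group m k n \<and> i < n}"
proof -
  have C: "carrier \<Gamma> = mono_group m k n" "\<one>\<^bsub>\<Gamma>\<^esub> = 1\<^sub>m n" "g \<otimes>\<^bsub>\<Gamma>\<^esub> h = g * h" for g h
    by (simp_all add: \<Gamma> mat_monoid_def)
  have x: "act_x n g i * grp g = mcoef n g i *\<^sub>C (\<x> (mperm n g i) * grp g)"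
    if "g \<in> mono_group m k n" "i < n" for g i
    using that by (simp add: act_x_monomial [OF mono_group_monomial] scale_mult_left)
  have y: "act_y n \<Gamma> g i * grp g = inverse (mcoef n g i) *\<^sub>C (\<y> (mperm n g i) * grp g)"
    if "g \<in> mono_group m k n" "i < n" for g i
    using that by (simp add: act_y_monomial [OF \<Gamma>] scale_mult_left)
  have "{grp g * \<x> i - act_x n g i * grp g | g i. g \<in> mono_group m k n \<and> i < n} =
      {grp g * \<x> i - mcoef n g i *\<^sub>C (\<x> (mperm n g i) * grp g) | g i. g \<in> mono_group m k n \<and> i < n}"
    by (intro Collect_cong ex_cong1) (metis x)
  moreover have "{grp g * \<y> i - act_y n \<Gamma> g i * grp g | g i. g \<in> mono_group m k n \<and> i < n} =
      {grp g * \<y> i - inverse (mcoef n g i) *\<^sub>C (\<y> (mperm n g i) * grp g) | g i. g \<in> mono_group m k n \<and> i < n}"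
    by (intro Collect_cong ex_cong1) (metis y)
  ultimately show ?thesis unfolding group_rels_def C by simp
qed

lemma cherednik_rels_twisted:
  assumes "even (m div p)"
  shows "cherednik_rels m p n \<t> c\<^sub>1 c = twisted_rels 1 m (m div p) n \<t> c\<^sub>1 c"
proof -
  have \<Gamma>: "Gmpn m p n = mat_monoid n (mono_group m (m div p) n)"
    using carrier_Gmpn_even [OF assms, of n] by (simp add: Gmpn_def mat_monoid_def)
  show ?thesis
    unfolding cherednik_rels_def twisted_rels_def group_rels_eq [OF \<Gamma>] s_mat_def by simp
qed

lemma braided_cherednik_rels_twisted:
  "braided_cherednik_rels m p n \<t> c\<^sub>1 c = twisted_rels (- 1) m (m div p) n \<t> (- c\<^sub>1) (\<lambda>\<zeta>. - c \<zeta>)"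
proof -
  have \<Gamma>: "\<mu>Gmpn m p n = mat_monoid n (mono_group m (m div p) n)"
    using carrier_\<mu>Gmpn [of m p n] by (simp add: \<mu>Gmpn_def mat_monoid_def)
  show ?thesis
    unfolding braided_cherednik_rels_def twisted_rels_def group_rels_eq [OF \<Gamma>] \<sigma>_mat_def
    by (simp add: sum_negf)
qed

section \<open>Spectral calculus for the sign changes\<close>

text \<open>
  The element of the group algebra of the sign changes that acts by \<open>f X\<close> on the eigenspace belonging to
  \<open>X\<close>, given by Fourier inversion.
\<close>

definition spectral :: "nat \<Rightarrow> (nat set \<Rightarrow> complex) \<Rightarrow> gen ncpoly" where
  "spectral n f = (\<Sum>U\<in>Pow {..<n}. fourier n f U *\<^sub>C grp (sgn_mat n U))"

lemma spectral_sign_char: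
  assumes "U \<subseteq> {..<n}"
  shows "spectral n (sign_char U) = grp (sgn_mat n U)"
proof -
  have "spectral n (sign_char U) = (\<Sum>V\<in>Pow {..<n}. if V = U then grp (sgn_mat n U) else 0)"
    unfolding spectral_def using assms by (intro sum.cong refl) (auto simp: fourier_sign_char)
  then show ?thesis using assms by simp
qed

lemma spectral_cong: "(\<And>X. X \<subseteq> {..<n} \<Longrightarrow> f X = g X) \<Longrightarrow> spectral n f = spectral n g"
  by (simp add: spectral_def fourier_def)

lemma spectral_one: "spectral n (\<lambda>_. 1) = grp (1\<^sub>m n)"
proof -
  have "sign_char {} = (\<lambda>_. 1)" by (simp add: fun_eq_iff)
  then show ?thesis using spectral_sign_char [of "{}" n] by (simp add: sgn_mat_empty)
qed

lemma spectral_linear: "spectral n (\<lambda>X. \<Sum>i\<in>I. a i * f i X) = (\<Sum>i\<in>I. a i *\<^sub>C spectral n (f i))"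
proof -
  have "fourier n (\<lambda>X. \<Sum>i\<in>I. a i * f i X) U = (\<Sum>i\<in>I. a i * fourier n (f i) U)" for U
  proof -
    have "(\<Sum>X\<in>Pow {..<n}. (\<Sum>i\<in>I. a i * f i X) * sign_char U X) =
        (\<Sum>i\<in>I. a i * (\<Sum>X\<in>Pow {..<n}. f i X * sign_char U X))"
      by (simp add: sum_distrib_right sum_distrib_left mult.assoc) (rule sum.swap)
    then show ?thesis
      unfolding fourier_def by (simp only: times_divide_eq_right sum_divide_distrib [symmetric])
  qed
  then have "spectral n (\<lambda>X. \<Sum>i\<in>I. a i * f i X) =
      (\<Sum>U\<in>Pow {..<n}. \<Sum>i\<in>I. (a i * fourier n (f i) U) *\<^sub>C grp (sgn_mat n U))"
    by (simp add: spectral_def ncpoly.scale_sum_left)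
  also have "\<dots> = (\<Sum>i\<in>I. \<Sum>U\<in>Pow {..<n}. (a i * fourier n (f i) U) *\<^sub>C grp (sgn_mat n U))"
    by (rule sum.swap)
  finally show ?thesis by (simp add: spectral_def ncpoly.scale_sum_right)
qed

lemma spectral_scale: "spectral n (\<lambda>X. a * f X) = a *\<^sub>C spectral n f"
  using spectral_linear [of n "\<lambda>_. a" "\<lambda>_. f" "{()}"] by simp

lemma spectral_diff: "spectral n (\<lambda>X. f X - g X) = spectral n f - spectral n g"
  using spectral_linear [of n "\<lambda>b. if b then 1 else - 1" "\<lambda>b. if b then f else g" "{True, False}"] by simp

lemma spectral_expand: "spectral n f = (\<Sum>U\<in>Pow {..<n}. fourier n f U *\<^sub>C spectral n (sign_char U))"
  by (simp add: spectral_sign_char) (simp add: spectral_def)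

text \<open>
  Characters span all functions on subsets of \<open>{..<n}\<close>, so a congruence linear in \<open>f\<close> needs to be checked
  for characters only, where \<open>spectral n f\<close> is a single group element.
\<close>

lemma spectral_cong_mod_linear:
  assumes T: "\<And>X. X \<subseteq> {..<n} \<Longrightarrow> T X \<subseteq> {..<n}"
    and sign_char: "\<And>U. U \<subseteq> {..<n} \<Longrightarrow>
      cong_mod R (a * spectral n (sign_char U) * b) (a' * spectral n (\<lambda>X. q X * sign_char U (T X)) * b')"
  shows "cong_mod R (a * spectral n f * b) (a' * spectral n (\<lambda>X. q X * f (T X)) * b')"
proof -
  have "a * spectral n f * b = (\<Sum>U\<in>Pow {..<n}. fourier n f U *\<^sub>C (a * spectral n (sign_char U) * b))"
    by (subst spectral_expand) (simp add: sum_distrib_left sum_distrib_right scale_mult_left scale_mult_right)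
  also have "cong_mod R \<dots>
      (\<Sum>U\<in>Pow {..<n}. fourier n f U *\<^sub>C (a' * spectral n (\<lambda>X. q X * sign_char U (T X)) * b'))"
    by (intro cong_mod_sum cong_mod_scale sign_char) auto
  also have "\<dots> = a' * spectral n (\<lambda>X. \<Sum>U\<in>Pow {..<n}. fourier n f U * (q X * sign_char U (T X))) * b'"
    by (simp add: spectral_linear sum_distrib_left sum_distrib_right scale_mult_left scale_mult_right)
  also have "spectral n (\<lambda>X. \<Sum>U\<in>Pow {..<n}. fourier n f U * (q X * sign_char U (T X))) =
      spectral n (\<lambda>X. q X * f (T X))"
  proof (rule spectral_cong)
    fix X :: "nat set" assume "X \<subseteq> {..<n}"
    then show "(\<Sum>U\<in>Pow {..<n}. fourier n f U * (q X * sign_char U (T X))) = q X * f (T X)"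
      using fourier_expansion [OF T, of X f] by (simp add: sum_distrib_left mult_ac)
  qed
  finally show ?thesis .
qed

locale twisted_cherednik =
  fixes \<eta> :: complex and m k n :: nat and \<t> c\<^sub>1 :: complex and c :: "complex \<Rightarrow> complex"
  assumes m: "m > 0" "even m" and k: "k dvd m" and \<eta>: "\<eta> = 1 \<or> \<eta> = - 1"
begin

abbreviation \<Gamma> :: "complex mat set" where "\<Gamma> \<equiv> mono_group m k n"

abbreviation rels :: "gen ncpoly set" where "rels \<equiv> twisted_rels \<eta> m k n \<t> c\<^sub>1 c"

abbreviation equiv_rels :: "gen ncpoly \<Rightarrow> gen ncpoly \<Rightarrow> bool" (infix "\<approx>" 50) where
  "f \<approx> g \<equiv> cong_mod rels f g"

lemma grp_one: "grp (1\<^sub>m n) \<approx> 1"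
  by (rule cong_mod_base) (auto simp: twisted_rels_def)

lemma grp_mult: "g \<in> \<Gamma> \<Longrightarrow> h \<in> \<Gamma> \<Longrightarrow> grp g * grp h \<approx> grp (g * h)"
  by (rule cong_mod_base) (unfold twisted_rels_def, blast)

lemma grp_x: "g \<in> \<Gamma> \<Longrightarrow> i < n \<Longrightarrow> grp g * \<x> i \<approx> mcoef n g i *\<^sub>C (\<x> (mperm n g i) * grp g)"
  by (rule cong_mod_base) (unfold twisted_rels_def, blast)

lemma grp_y: "g \<in> \<Gamma> \<Longrightarrow> i < n \<Longrightarrow> grp g * \<y> i \<approx> inverse (mcoef n g i) *\<^sub>C (\<y> (mperm n g i) * grp g)"
  by (rule cong_mod_base) (unfold twisted_rels_def, blast)

lemma x_x: "i < n \<Longrightarrow> j < n \<Longrightarrow> i \<noteq> j \<Longrightarrow> \<x> i * \<x> j \<approx> \<eta> *\<^sub>C (\<x> j * \<x> i)"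
  by (rule cong_mod_base) (unfold twisted_rels_def, blast)

lemma y_y: "i < n \<Longrightarrow> j < n \<Longrightarrow> i \<noteq> j \<Longrightarrow> \<y> i * \<y> j \<approx> \<eta> *\<^sub>C (\<y> j * \<y> i)"
  by (rule cong_mod_base) (unfold twisted_rels_def, blast)

lemma y_x: "i < n \<Longrightarrow> j < n \<Longrightarrow> i \<noteq> j \<Longrightarrow> \<y> i * \<x> j - \<eta> *\<^sub>C (\<x> j * \<y> i) \<approx>
    (\<eta> * c\<^sub>1) *\<^sub>C (\<Sum>\<epsilon>\<in>unity_roots m. \<epsilon> *\<^sub>C grp (swap_mat n i j (inverse \<epsilon>) (\<eta> * \<epsilon>)))"
  by (rule cong_mod_base) (unfold twisted_rels_def, blast)

lemma y_x_same: "i < n \<Longrightarrow> \<y> i * \<x> i - \<x> i * \<y> i \<approx> \<t> *\<^sub>C 1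
    - c\<^sub>1 *\<^sub>C (\<Sum>j\<in>{..<n} - {i}. \<Sum>\<epsilon>\<in>unity_roots m. grp (swap_mat n i j (inverse \<epsilon>) (\<eta> * \<epsilon>)))
    - (\<Sum>\<zeta>\<in>unity_roots k - {1}. c \<zeta> *\<^sub>C grp (t_mat n i \<zeta>))"
  by (rule cong_mod_base) (unfold twisted_rels_def, blast)

lemma root_nonzero: "\<epsilon> \<in> unity_roots m \<Longrightarrow> \<epsilon> \<noteq> 0"
  using m by (auto simp: unity_roots_def power_0_left)

lemma root_minus: "- \<epsilon> \<in> unity_roots m \<longleftrightarrow> \<epsilon> \<in> unity_roots m"
  using m by (simp add: unity_roots_def)

lemma t_mat_in: "\<zeta> \<in> unity_roots k \<Longrightarrow> t_mat n i \<zeta> \<in> \<Gamma>"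
  using m k by (auto simp: unity_roots_def intro!: t_mat_group elim!: dvdE simp: power_mult)

end

text \<open>
  For even \<open>k\<close> all sign changes belong to the group.
\<close>

locale full_twisted_cherednik = twisted_cherednik +
  assumes even_k: "even k"
begin

lemma sgn_in: "sgn_mat n U \<in> \<Gamma>"
  using sgn_mat_group m even_k by simp

lemma swap_in: "i \<noteq> j \<Longrightarrow> i < n \<Longrightarrow> j < n \<Longrightarrow> \<epsilon> \<in> unity_roots m \<Longrightarrow> \<theta> = 1 \<or> \<theta> = - 1 \<Longrightarrow>
    swap_mat n i j (inverse \<epsilon>) (\<theta> * \<epsilon>) \<in> \<Gamma>"
  using swap_mat_group m even_k by (simp add: unity_roots_def)

lemma grp_spectral_sign_char: "g \<in> \<Gamma> \<Longrightarrow> U \<subseteq> {..<n} \<Longrightarrow> grp g * spectral n (sign_char U) \<approx> grp (g * sgn_mat n U)"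
  by (simp add: spectral_sign_char grp_mult sgn_in)

lemma spectral_one_equiv: "spectral n (\<lambda>_. 1) \<approx> 1"
  by (simp add: spectral_one grp_one)

lemma spectral_mult: "spectral n f * spectral n g \<approx> spectral n (\<lambda>X. f X * g X)"
proof -
  have sign_char: "1 * spectral n (sign_char U) * spectral n (sign_char V) \<approx> 1 * spectral n (\<lambda>X. sign_char V X * sign_char U X) * 1"
    if "U \<subseteq> {..<n}" "V \<subseteq> {..<n}" for U V
  proof -
    have "spectral n (sign_char U) * spectral n (sign_char V) \<approx> grp (sgn_mat n U * sgn_mat n V)"
      using that by (simp add: spectral_sign_char grp_mult sgn_in)
    also have "\<dots> = spectral n (sign_char (sym_diff U V))"
      using that by (subst spectral_sign_char) (auto simp: sgn_mat_mult)
    also have "\<dots> = spectral n (\<lambda>X. sign_char V X * sign_char U X)"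
      by (rule spectral_cong) (simp add: sign_char_sym_diff)
    finally show ?thesis by simp
  qed
  have fV: "spectral n f * spectral n (sign_char V) \<approx> spectral n (\<lambda>X. sign_char V X * f X)"
    if "V \<subseteq> {..<n}" for V
    using spectral_cong_mod_linear [of n "\<lambda>X. X" rels 1 "spectral n (sign_char V)" 1 "sign_char V" 1 f] sign_char that by simp
  have "spectral n f * spectral n g * 1 \<approx> 1 * spectral n (\<lambda>X. f X * g X) * 1"
    by (rule spectral_cong_mod_linear [of n "\<lambda>X. X"]) (use fV in \<open>simp_all add: mult.commute [of "sign_char _ _"]\<close>)
  then show ?thesis by simp
qed

lemma spectral_x:
  assumes i: "i < n"
  shows "spectral n f * \<x> i \<approx> \<x> i * spectral n (\<lambda>X. f (sym_diff X {i}))"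
proof -
  have "1 * spectral n f * \<x> i \<approx> \<x> i * spectral n (\<lambda>X. 1 * f (sym_diff X {i})) * 1"
  proof (rule spectral_cong_mod_linear [of n "\<lambda>X. sym_diff X {i}"])
    fix U :: "nat set" assume U: "U \<subseteq> {..<n}"
    let ?s = "if i \<in> U then - 1 else 1 :: complex"
    have "grp (sgn_mat n U) * \<x> i \<approx> ?s *\<^sub>C (\<x> i * grp (sgn_mat n U))"
      using grp_x [OF sgn_in i, of U] i by simp
    also have "\<dots> = \<x> i * spectral n (\<lambda>X. ?s * sign_char U X)"
      using U by (simp add: spectral_scale spectral_sign_char scale_mult_right)
    also have "spectral n (\<lambda>X. ?s * sign_char U X) = spectral n (\<lambda>X. 1 * sign_char U (sym_diff X {i}))"
      by (rule spectral_cong) (simp only: sign_char_flip finite_subset [OF _ finite_lessThan] mult_1)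
    finally show "1 * spectral n (sign_char U) * \<x> i \<approx> \<x> i * spectral n (\<lambda>X. 1 * sign_char U (sym_diff X {i})) * 1"
      using U by (simp add: spectral_sign_char)
  qed (use i in auto)
  then show ?thesis by simp
qed

lemma spectral_y:
  assumes i: "i < n"
  shows "spectral n f * \<y> i \<approx> \<y> i * spectral n (\<lambda>X. f (sym_diff X {i}))"
proof -
  have "1 * spectral n f * \<y> i \<approx> \<y> i * spectral n (\<lambda>X. 1 * f (sym_diff X {i})) * 1"
  proof (rule spectral_cong_mod_linear [of n "\<lambda>X. sym_diff X {i}"])
    fix U :: "nat set" assume U: "U \<subseteq> {..<n}"
    let ?s = "if i \<in> U then - 1 else 1 :: complex"
    have "grp (sgn_mat n U) * \<y> i \<approx> ?s *\<^sub>C (\<y> i * grp (sgn_mat n U))"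
      using grp_y [OF sgn_in i, of U] i by (simp split: if_splits)
    also have "\<dots> = \<y> i * spectral n (\<lambda>X. ?s * sign_char U X)"
      using U by (simp add: spectral_scale spectral_sign_char scale_mult_right)
    also have "spectral n (\<lambda>X. ?s * sign_char U X) = spectral n (\<lambda>X. 1 * sign_char U (sym_diff X {i}))"
      by (rule spectral_cong) (simp only: sign_char_flip finite_subset [OF _ finite_lessThan] mult_1)
    finally show "1 * spectral n (sign_char U) * \<y> i \<approx> \<y> i * spectral n (\<lambda>X. 1 * sign_char U (sym_diff X {i})) * 1"
      using U by (simp add: spectral_sign_char)
  qed (use i in auto)
  then show ?thesis by simp
qed

lemma spectral_grp:
  assumes g: "g \<in> \<Gamma>"
  shows "spectral n f * grp g \<approx> grp g * spectral n (\<lambda>X. f (mperm n g ` X))"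
proof -
  have mg: "monomial_mat n g" using g by (rule mono_group_monomial)
  have w: "mperm n g permutes {..<n}" by (rule mperm_permutes [OF mg])
  have "1 * spectral n f * grp g \<approx> grp g * spectral n (\<lambda>X. 1 * f (mperm n g ` X)) * 1"
  proof (rule spectral_cong_mod_linear [of n "\<lambda>X. mperm n g ` X"])
    fix U :: "nat set" assume U: "U \<subseteq> {..<n}"
    let ?V = "{k. k < n \<and> mperm n g k \<in> U}"
    have eq: "sgn_mat n U * g = g * sgn_mat n ?V"
      by (rule monomial_mat_eqI [of n]) (use mg monomial_mat_column(1) [OF mg] in \<open>auto simp: monomial_mat_mult\<close>)
    have "spectral n (sign_char U) * grp g \<approx> grp (sgn_mat n U * g)"
      using U g by (simp add: spectral_sign_char grp_mult sgn_in)
    also have "grp (sgn_mat n U * g) \<approx> grp g * spectral n (sign_char ?V)"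
      unfolding eq by (rule cong_mod_sym [OF grp_spectral_sign_char]) (use g in auto)
    also have "spectral n (sign_char ?V) = spectral n (\<lambda>X. 1 * sign_char U (mperm n g ` X))"
    proof (rule spectral_cong)
      fix X :: "nat set" assume X: "X \<subseteq> {..<n}"
      have "inj_on (mperm n g) X" using permutes_inj [OF w] by (rule inj_on_subset) simp
      show "sign_char ?V X = 1 * sign_char U (mperm n g ` X)"
        unfolding mult_1 sign_char_image [OF \<open>inj_on _ X\<close>]
        unfolding sign_char_def using X by (intro prod.cong) auto
    qed
    finally show "1 * spectral n (sign_char U) * grp g \<approx> grp g * spectral n (\<lambda>X. 1 * sign_char U (mperm n g ` X)) * 1"
      by simp
  qed (use permutes_lt [OF w] in auto)
  then show ?thesis by simp
qed

end

section \<open>The twist\<close>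

text \<open>
  On the generators \<open>x\<^sub>i\<close> and \<open>y\<^sub>i\<close> the second factor is the product of all sign changes at smaller
  indices, written as the spectral element of a character.
\<close>

primrec twist_gen :: "nat \<Rightarrow> gen \<Rightarrow> gen ncpoly" where
  "twist_gen n (XGen i) = \<x> i * spectral n (sign_char {..<i})"
| "twist_gen n (YGen i) = \<y> i * spectral n (sign_char {..<i})"
| "twist_gen n (GrpGen g) = grp g * spectral n (inv_sign (mperm n g))"

abbreviation twist :: "nat \<Rightarrow> gen ncpoly \<Rightarrow> gen ncpoly" where
  "twist n \<equiv> substitution.eval ncscalar (twist_gen n)"

interpretation twist: substitution ncscalar "twist_gen n" for n
  by (rule substitution_ncpoly)

lemma twist_scale [simp]: "twist n (k *\<^sub>C f) = k *\<^sub>C twist n f"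
  by (simp add: twist.eval_scale scale_def)

lemma twist_x [simp]: "twist n (\<x> i) = \<x> i * spectral n (sign_char {..<i})"
  and twist_y [simp]: "twist n (\<y> i) = \<y> i * spectral n (sign_char {..<i})"
  and twist_grp [simp]: "twist n (grp g) = grp g * spectral n (inv_sign (mperm n g))"
  by (simp_all add: \<x>_def \<y>_def grp_def)

lemma sign_char_below_flip:
  assumes "X \<subseteq> {..<n}"
  shows "sign_char {..<i} (sym_diff X {j}) = (if j < i then - 1 else 1) * sign_char {..<i} X"
  using sign_char_flip [of X "{..<i}" j] finite_subset [OF assms] by simp

context full_twisted_cherednik
begin

lemma twist_grp_one: "twist n (grp (1\<^sub>m n)) \<approx> twist n 1"
proof -
  have "mperm n (1\<^sub>m n) = id" using mperm_sgn_mat [of n "{}"] by (simp add: sgn_mat_empty)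
  then have "twist n (grp (1\<^sub>m n)) = grp (1\<^sub>m n) * spectral n (\<lambda>_. 1)" by simp
  also have "\<dots> \<approx> 1 * 1" by (intro cong_mod_mult grp_one spectral_one_equiv)
  finally show ?thesis by simp
qed

lemma twist_grp_mult:
  assumes g: "g \<in> \<Gamma>" and h: "h \<in> \<Gamma>"
  shows "twist n (grp g * grp h) \<approx> twist n (grp (g * h))"
proof -
  let ?a = "inv_sign (mperm n g)" and ?b = "inv_sign (mperm n h)"
  note mg = mono_group_monomial [OF g] and mh = mono_group_monomial [OF h]
  have "twist n (grp g * grp h) = grp g * (spectral n ?a * grp h) * spectral n ?b"
    by (simp add: mult.assoc)
  also have "\<dots> \<approx> grp g * (grp h * spectral n (\<lambda>X. ?a (mperm n h ` X))) * spectral n ?b"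
    by (intro cong_mod_mult cong_mod_refl spectral_grp h)
  also have "\<dots> = (grp g * grp h) * (spectral n (\<lambda>X. ?a (mperm n h ` X)) * spectral n ?b)"
    by (simp add: mult.assoc)
  also have "\<dots> \<approx> grp (g * h) * spectral n (\<lambda>X. ?a (mperm n h ` X) * ?b X)"
    by (intro cong_mod_mult grp_mult spectral_mult g h)
  also have "spectral n (\<lambda>X. ?a (mperm n h ` X) * ?b X) = spectral n (inv_sign (mperm n (g * h)))"
  proof (rule spectral_cong)
    fix X :: "nat set" assume "X \<subseteq> {..<n}"
    then show "?a (mperm n h ` X) * ?b X = inv_sign (mperm n (g * h)) X"
      unfolding monomial_mat_mult(2) [OF mg mh]
      by (intro inv_sign_compose [symmetric] inj_on_subset [OF permutes_inj [OF mperm_permutes]] mg mh)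
        (auto intro: finite_subset)
  qed
  finally show ?thesis by simp
qed

text \<open>
  This is applied to \<open>u = x\<^sub>i\<close> and \<open>v = x\<^bsub>w i\<^esub>\<close>, where \<open>w\<close> is the permutation of \<open>g\<close>, and to the
  corresponding \<open>y\<close>; the signs on the two sides agree by
  \<open>inv_sign_flip\<close>.
\<close>

lemma twist_grp_generator:
  assumes g: "g \<in> \<Gamma>" and i: "i < n"
    and u: "\<And>f. spectral n f * u \<approx> u * spectral n (\<lambda>X. f (sym_diff X {i}))"
    and gu: "grp g * u \<approx> a *\<^sub>C (v * grp g)"
  shows "(grp g * spectral n (inv_sign (mperm n g))) * (u * spectral n (sign_char {..<i})) \<approx>
    a *\<^sub>C ((v * spectral n (sign_char {..<mperm n g i})) * (grp g * spectral n (inv_sign (mperm n g))))"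
proof -
  let ?w = "mperm n g"
  have w: "?w permutes {..<n}" by (rule mperm_permutes [OF mono_group_monomial [OF g]])
  have "(grp g * spectral n (inv_sign ?w)) * (u * spectral n (sign_char {..<i})) =
      grp g * (spectral n (inv_sign ?w) * u) * spectral n (sign_char {..<i})"
    by (simp add: mult.assoc)
  also have "\<dots> \<approx> grp g * (u * spectral n (\<lambda>X. inv_sign ?w (sym_diff X {i}))) * spectral n (sign_char {..<i})"
    by (intro cong_mod_mult cong_mod_refl u)
  also have "\<dots> = (grp g * u) * (spectral n (\<lambda>X. inv_sign ?w (sym_diff X {i})) * spectral n (sign_char {..<i}))"
    by (simp add: mult.assoc)
  also have "\<dots> \<approx> (a *\<^sub>C (v * grp g)) * spectral n (\<lambda>X. inv_sign ?w (sym_diff X {i}) * sign_char {..<i} X)"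
    by (intro cong_mod_mult gu spectral_mult)
  also have "spectral n (\<lambda>X. inv_sign ?w (sym_diff X {i}) * sign_char {..<i} X) =
      spectral n (\<lambda>X. sign_char {..<?w i} (?w ` X) * inv_sign ?w X)"
  proof (rule spectral_cong)
    fix X :: "nat set" assume "X \<subseteq> {..<n}"
    then have X: "finite X" by (rule finite_subset) simp
    have inj: "inj_on ?w Y" for Y using permutes_inj [OF w] by (rule inj_on_subset) simp
    show "inv_sign ?w (sym_diff X {i}) * sign_char {..<i} X = sign_char {..<?w i} (?w ` X) * inv_sign ?w X"
      using inv_sign_flip [OF X inj] by (simp add: sign_char_image [OF inj] mult.commute)
  qed
  also have "a *\<^sub>C (v * grp g) * spectral n (\<lambda>X. sign_char {..<?w i} (?w ` X) * inv_sign ?w X) \<approx>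
      a *\<^sub>C (v * grp g) * (spectral n (\<lambda>X. sign_char {..<?w i} (?w ` X)) * spectral n (inv_sign ?w))"
    by (intro cong_mod_mult_left cong_mod_sym [OF spectral_mult])
  also have "\<dots> = a *\<^sub>C (v * (grp g * spectral n (\<lambda>X. sign_char {..<?w i} (?w ` X))) * spectral n (inv_sign ?w))"
    by (simp add: scale_mult_left mult.assoc)
  also have "\<dots> \<approx> a *\<^sub>C (v * (spectral n (sign_char {..<?w i}) * grp g) * spectral n (inv_sign ?w))"
    by (intro cong_mod_scale cong_mod_mult cong_mod_refl cong_mod_sym [OF spectral_grp] g)
  finally show ?thesis by (simp add: mult.assoc)
qed

lemma twist_grp_x:
  "g \<in> \<Gamma> \<Longrightarrow> i < n \<Longrightarrow> twist n (grp g * \<x> i) \<approx> twist n (mcoef n g i *\<^sub>C (\<x> (mperm n g i) * grp g))"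
  using twist_grp_generator [OF _ _ spectral_x grp_x] by simp

lemma twist_grp_y:
  "g \<in> \<Gamma> \<Longrightarrow> i < n \<Longrightarrow> twist n (grp g * \<y> i) \<approx>
    twist n (inverse (mcoef n g i) *\<^sub>C (\<y> (mperm n g i) * grp g))"
  using twist_grp_generator [OF _ _ spectral_y grp_y] by simp

text \<open>
  The product of the two chains of sign changes attached to \<open>i\<close> and to \<open>j\<close>.
\<close>

definition below :: "nat \<Rightarrow> nat \<Rightarrow> gen ncpoly" where
  "below i j = spectral n (\<lambda>X. sign_char {..<i} X * sign_char {..<j} X)"

lemma below_commute: "below i j = below j i"
  by (simp add: below_def mult.commute)

lemma below_same: "below i i \<approx> 1"
  using spectral_one_equiv by (simp add: below_def)

lemma twist_product:
  assumes j: "j < n" and v: "v = \<x> j \<or> v = \<y> j"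
  shows "(u * spectral n (sign_char {..<i})) * (v * spectral n (sign_char {..<j})) \<approx>
    (if j < i then - 1 else 1) *\<^sub>C (u * v * below i j)"
proof -
  let ?s = "if j < i then - 1 else 1 :: complex"
  have "(u * spectral n (sign_char {..<i})) * (v * spectral n (sign_char {..<j})) =
      u * (spectral n (sign_char {..<i}) * v) * spectral n (sign_char {..<j})"
    by (simp add: mult.assoc)
  also have "\<dots> \<approx> u * (v * spectral n (\<lambda>X. sign_char {..<i} (sym_diff X {j}))) * spectral n (sign_char {..<j})"
    by (intro cong_mod_mult_left cong_mod_mult_right) (use v spectral_x spectral_y j in blast)
  also have "spectral n (\<lambda>X. sign_char {..<i} (sym_diff X {j})) = ?s *\<^sub>C spectral n (sign_char {..<i})"
    unfolding spectral_scale [symmetric] by (intro spectral_cong sign_char_below_flip)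
  also have "u * (v * ?s *\<^sub>C spectral n (sign_char {..<i})) * spectral n (sign_char {..<j}) =
      ?s *\<^sub>C (u * v * (spectral n (sign_char {..<i}) * spectral n (sign_char {..<j})))"
    by (simp only: scale_mult_left scale_mult_right mult.assoc)
  also have "\<dots> \<approx> ?s *\<^sub>C (u * v * below i j)"
    unfolding below_def by (intro cong_mod_scale cong_mod_mult_left spectral_mult)
  finally show ?thesis .
qed

text \<open>
  Exactly one of \<open>j < i\<close> and \<open>i < j\<close> holds, so exactly one of the two products acquires a sign when the
  sign changes are moved to the right. This turns a commutator with sign \<open>-\<eta>\<close> into one with sign \<open>\<eta>\<close>.
\<close>

lemma twist_commutation:
  assumes ij: "i < n" "j < n" "i \<noteq> j"
    and u: "u = \<x> i \<or> u = \<y> i" and v: "v = \<x> j \<or> v = \<y> j"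
  shows "(u * spectral n (sign_char {..<i})) * (v * spectral n (sign_char {..<j}))
      + \<eta> *\<^sub>C ((v * spectral n (sign_char {..<j})) * (u * spectral n (sign_char {..<i}))) \<approx>
    (if j < i then - 1 else 1) *\<^sub>C ((u * v - \<eta> *\<^sub>C (v * u)) * below i j)"
proof -
  have "(u * spectral n (sign_char {..<i})) * (v * spectral n (sign_char {..<j}))
      + \<eta> *\<^sub>C ((v * spectral n (sign_char {..<j})) * (u * spectral n (sign_char {..<i}))) \<approx>
    (if j < i then - 1 else 1) *\<^sub>C (u * v * below i j)
      + \<eta> *\<^sub>C (if i < j then - 1 else 1) *\<^sub>C (v * u * below j i)"
    by (intro cong_mod_add cong_mod_scale twist_product ij u v)
  also have "\<dots> = (if j < i then - 1 else 1) *\<^sub>C ((u * v - \<eta> *\<^sub>C (v * u)) * below i j)"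
    using ij by (cases "i < j")
      (simp_all add: below_commute [of j i] left_diff_distrib scale_mult_left ncpoly.scale_right_diff_distrib)
  finally show ?thesis .
qed

lemma twist_x_x:
  assumes "i < n" "j < n" "i \<noteq> j"
  shows "twist n (\<x> i * \<x> j - - \<eta> *\<^sub>C (\<x> j * \<x> i)) \<approx> 0"
proof -
  have "twist n (\<x> i * \<x> j - - \<eta> *\<^sub>C (\<x> j * \<x> i)) \<approx>
      (if j < i then - 1 else 1) *\<^sub>C ((\<x> i * \<x> j - \<eta> *\<^sub>C (\<x> j * \<x> i)) * below i j)"
    using twist_commutation [OF assms, of "\<x> i" "\<x> j"] by simp
  also have "\<dots> \<approx> (if j < i then - 1 else 1) *\<^sub>C (0 * below i j)"
    by (intro cong_mod_scale cong_mod_mult_right) (use x_x [OF assms] in \<open>simp add: cong_mod_def\<close>)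
  finally show ?thesis by simp
qed

lemma twist_y_y:
  assumes "i < n" "j < n" "i \<noteq> j"
  shows "twist n (\<y> i * \<y> j - - \<eta> *\<^sub>C (\<y> j * \<y> i)) \<approx> 0"
proof -
  have "twist n (\<y> i * \<y> j - - \<eta> *\<^sub>C (\<y> j * \<y> i)) \<approx>
      (if j < i then - 1 else 1) *\<^sub>C ((\<y> i * \<y> j - \<eta> *\<^sub>C (\<y> j * \<y> i)) * below i j)"
    using twist_commutation [OF assms, of "\<y> i" "\<y> j"] by simp
  also have "\<dots> \<approx> (if j < i then - 1 else 1) *\<^sub>C (0 * below i j)"
    by (intro cong_mod_scale cong_mod_mult_right) (use y_y [OF assms] in \<open>simp add: cong_mod_def\<close>)
  finally show ?thesis by simp
qed

text \<open>
  The substitution of \<open>-\<epsilon>\<close> for \<open>\<epsilon>\<close> permutes the summands and multiplies the reflection by the sign changes at \<open>i\<close>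
  and \<open>j\<close>. So for a function \<open>h\<close> that lives where \<open>\<kappa>\<close> times their eigenvalue is \<open>-1\<close>, the weighted sum
  equals its own negative.
\<close>

lemma spectral_average:
  fixes \<omega> :: "complex \<Rightarrow> complex"
  assumes ij: "i \<noteq> j" "i < n" "j < n" and \<theta>: "\<theta> = 1 \<or> \<theta> = - 1"
    and \<omega>: "\<And>\<epsilon>. \<omega> (- \<epsilon>) = \<kappa> * \<omega> \<epsilon>" and \<kappa>: "\<kappa> = 1 \<or> \<kappa> = - 1"
    and fg: "\<And>X. X \<subseteq> {..<n} \<Longrightarrow> \<kappa> * sign_char {i, j} X = 1 \<Longrightarrow> f X = g X"
  defines "s \<equiv> \<lambda>\<epsilon>. grp (swap_mat n i j (inverse \<epsilon>) (\<theta> * \<epsilon>))"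
  shows "(\<Sum>\<epsilon>\<in>unity_roots m. \<omega> \<epsilon> *\<^sub>C (s \<epsilon> * spectral n f)) \<approx>
    (\<Sum>\<epsilon>\<in>unity_roots m. \<omega> \<epsilon> *\<^sub>C (s \<epsilon> * spectral n g))"
proof -
  \<comment> \<open>By linearity it suffices that the sum \<open>S\<close> for the difference \<open>h\<close> vanishes.\<close>
  define h where "h X = f X - g X" for X
  define S where "S = (\<Sum>\<epsilon>\<in>unity_roots m. \<omega> \<epsilon> *\<^sub>C (s \<epsilon> * spectral n h))"
  have h: "\<kappa> * (sign_char {i, j} X * h X) = - 1 * h X" if "X \<subseteq> {..<n}" for X
  proof -
    have "sign_char {i, j} X * sign_char {i, j} X = 1" by simp
    then have "sign_char {i, j} X = 1 \<or> sign_char {i, j} X = - 1"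
      by (metis power2_eq_1_iff power2_eq_square)
    then show ?thesis using fg [OF that] \<kappa> by (auto simp: h_def)
  qed
  have minus: "s (- \<epsilon>) * spectral n h \<approx> s \<epsilon> * spectral n (\<lambda>X. sign_char {i, j} X * h X)"
    if \<epsilon>: "\<epsilon> \<in> unity_roots m" for \<epsilon>
  proof -
    have "s (- \<epsilon>) = grp (swap_mat n i j (inverse \<epsilon>) (\<theta> * \<epsilon>) * sgn_mat n {i, j})"
      using swap_mat_mult_sgn(2) [OF ij, of "inverse \<epsilon>" "\<theta> * \<epsilon>"] root_nonzero [OF \<epsilon>] \<theta>
      by (auto simp: s_def)
    also have "\<dots> \<approx> s \<epsilon> * spectral n (sign_char {i, j})"
      unfolding s_def using ij by (intro cong_mod_sym [OF grp_spectral_sign_char] swap_in ij \<epsilon> \<theta>) auto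
    finally have "s (- \<epsilon>) * spectral n h \<approx> s \<epsilon> * spectral n (sign_char {i, j}) * spectral n h"
      by (rule cong_mod_mult_right)
    also have "\<dots> \<approx> s \<epsilon> * spectral n (\<lambda>X. sign_char {i, j} X * h X)"
      unfolding mult.assoc by (intro cong_mod_mult_left spectral_mult)
    finally show ?thesis .
  qed
  have "S = (\<Sum>\<epsilon>\<in>unity_roots m. \<omega> (- \<epsilon>) *\<^sub>C (s (- \<epsilon>) * spectral n h))"
    unfolding S_def
    by (rule sum.reindex_bij_witness [of _ uminus uminus]) (auto simp: root_minus)
  also have "\<dots> \<approx> (\<Sum>\<epsilon>\<in>unity_roots m. \<omega> (- \<epsilon>) *\<^sub>C (s \<epsilon> * spectral n (\<lambda>X. sign_char {i, j} X * h X)))"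
    by (intro cong_mod_sum cong_mod_scale minus)
  also have "\<dots> = (\<Sum>\<epsilon>\<in>unity_roots m. \<omega> \<epsilon> *\<^sub>C (s \<epsilon> * spectral n (\<lambda>X. \<kappa> * (sign_char {i, j} X * h X))))"
    by (simp add: \<omega> spectral_scale scale_mult_right mult.commute)
  also have "spectral n (\<lambda>X. \<kappa> * (sign_char {i, j} X * h X)) = spectral n (\<lambda>X. - 1 * h X)"
    by (rule spectral_cong) (rule h)
  also have "(\<Sum>\<epsilon>\<in>unity_roots m. \<omega> \<epsilon> *\<^sub>C (s \<epsilon> * spectral n (\<lambda>X. - 1 * h X))) = - S"
    unfolding S_def spectral_scale by (simp add: sum_negf)
  finally have "(1 / 2) *\<^sub>C (S - - S) \<approx> (1 / 2) *\<^sub>C (- S - - S)"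
    by (intro cong_mod_scale cong_mod_diff cong_mod_refl)
  moreover have "(1 / 2) *\<^sub>C (S - - S) = S"
    using scale_add_left [of "1 / 2" "1 / 2" S] by (simp add: scale_add_right)
  ultimately have "S \<approx> 0" by simp
  moreover have "h = (\<lambda>X. f X - g X)" by (simp add: h_def fun_eq_iff)
  then have "S = (\<Sum>\<epsilon>\<in>unity_roots m. \<omega> \<epsilon> *\<^sub>C (s \<epsilon> * spectral n f)) -
      (\<Sum>\<epsilon>\<in>unity_roots m. \<omega> \<epsilon> *\<^sub>C (s \<epsilon> * spectral n g))"
    by (simp add: S_def spectral_diff right_diff_distrib ncpoly.scale_right_diff_distrib sum_subtractf)
  ultimately show ?thesis by (simp add: cong_mod_def)
qed

lemma swap_eta:
  assumes ij: "i \<noteq> j" "i < n" "j < n" and \<epsilon>: "\<epsilon> \<in> unity_roots m"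
  shows "grp (swap_mat n i j (inverse \<epsilon>) (\<eta> * \<epsilon>)) \<approx>
    grp (swap_mat n i j (inverse \<epsilon>) (- \<eta> * \<epsilon>)) * spectral n (sign_char {j})"
proof -
  have "swap_mat n i j (inverse \<epsilon>) (\<eta> * \<epsilon>) = swap_mat n i j (inverse \<epsilon>) (- \<eta> * \<epsilon>) * sgn_mat n {j}"
    using swap_mat_mult_sgn(1) [OF ij, of "inverse \<epsilon>" "- \<eta> * \<epsilon>"] root_nonzero [OF \<epsilon>] \<eta> by auto
  then show ?thesis
    using grp_spectral_sign_char [OF swap_in [OF ij \<epsilon>, of "- \<eta>"], of "{j}"] ij \<eta> by (auto intro: cong_mod_sym)
qed

text \<open>
  The weight \<open>\<epsilon>\<close> is odd, which leaves the eigenspaces with \<open>t\<^sub>i t\<^sub>j = -1\<close>. The chains of sign changes below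
  \<open>i\<close> and \<open>j\<close>, together with the sign change at \<open>j\<close> that relates the reflections for \<open>\<eta>\<close> and \<open>-\<eta>\<close>, act
  there as the inversion sign of the transposition, up to a global sign.
\<close>

lemma twist_y_x:
  assumes ij: "i < n" "j < n" "i \<noteq> j"
  shows "twist n (\<y> i * \<x> j - - \<eta> *\<^sub>C (\<x> j * \<y> i)) \<approx>
    twist n ((- \<eta> * c\<^sub>1) *\<^sub>C (\<Sum>\<epsilon>\<in>unity_roots m. \<epsilon> *\<^sub>C grp (swap_mat n i j (inverse \<epsilon>) (- \<eta> * \<epsilon>))))"
proof -
  let ?s = "if j < i then - 1 else 1 :: complex"
  let ?g = "\<lambda>\<epsilon>. grp (swap_mat n i j (inverse \<epsilon>) (- \<eta> * \<epsilon>))"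
  let ?f = "\<lambda>X. sign_char {j} X * (sign_char {..<i} X * sign_char {..<j} X)"
  have ij': "i \<noteq> j" "i < n" "j < n" using ij by auto
  have "twist n (\<y> i * \<x> j - - \<eta> *\<^sub>C (\<x> j * \<y> i)) \<approx>
      ?s *\<^sub>C ((\<y> i * \<x> j - \<eta> *\<^sub>C (\<x> j * \<y> i)) * below i j)"
    using twist_commutation [OF ij, of "\<y> i" "\<x> j"] by simp
  also have "\<dots> \<approx> ?s *\<^sub>C (((\<eta> * c\<^sub>1) *\<^sub>C (\<Sum>\<epsilon>\<in>unity_roots m. \<epsilon> *\<^sub>C (?g \<epsilon> * spectral n (sign_char {j})))) * below i j)"
  proof (intro cong_mod_scale cong_mod_mult_right)
    have "(\<eta> * c\<^sub>1) *\<^sub>C (\<Sum>\<epsilon>\<in>unity_roots m. \<epsilon> *\<^sub>C grp (swap_mat n i j (inverse \<epsilon>) (\<eta> * \<epsilon>))) \<approx>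
        (\<eta> * c\<^sub>1) *\<^sub>C (\<Sum>\<epsilon>\<in>unity_roots m. \<epsilon> *\<^sub>C (?g \<epsilon> * spectral n (sign_char {j})))"
      by (intro cong_mod_scale cong_mod_sum swap_eta ij')
    with y_x [OF ij] show "\<y> i * \<x> j - \<eta> *\<^sub>C (\<x> j * \<y> i) \<approx>
        (\<eta> * c\<^sub>1) *\<^sub>C (\<Sum>\<epsilon>\<in>unity_roots m. \<epsilon> *\<^sub>C (?g \<epsilon> * spectral n (sign_char {j})))"
      by (rule cong_mod_trans)
  qed
  also have "\<dots> = (\<eta> * c\<^sub>1 * ?s) *\<^sub>C (\<Sum>\<epsilon>\<in>unity_roots m. \<epsilon> *\<^sub>C (?g \<epsilon> * (spectral n (sign_char {j}) * below i j)))"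
    by (simp add: scale_mult_left sum_distrib_right mult.assoc mult.commute)
  also have "\<dots> \<approx> (\<eta> * c\<^sub>1 * ?s) *\<^sub>C (\<Sum>\<epsilon>\<in>unity_roots m. \<epsilon> *\<^sub>C (?g \<epsilon> * spectral n ?f))"
    unfolding below_def by (intro cong_mod_scale cong_mod_sum cong_mod_mult_left spectral_mult)
  also have "\<dots> = (- \<eta> * c\<^sub>1) *\<^sub>C (\<Sum>\<epsilon>\<in>unity_roots m. \<epsilon> *\<^sub>C (?g \<epsilon> * spectral n (\<lambda>X. - ?s * ?f X)))"
  proof -
    have "spectral n (\<lambda>X. - ?s * ?f X) = (- ?s) *\<^sub>C spectral n ?f" by (rule spectral_scale)
    then show ?thesis by (simp add: scale_mult_right ncpoly.scale_sum_right mult_ac)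
  qed
  also have "\<dots> \<approx> (- \<eta> * c\<^sub>1) *\<^sub>C (\<Sum>\<epsilon>\<in>unity_roots m. \<epsilon> *\<^sub>C (?g \<epsilon> * spectral n (inv_sign (transpose i j))))"
  proof (intro cong_mod_scale spectral_average [where \<kappa> = "- 1"] ij')
    fix X :: "nat set" assume X: "X \<subseteq> {..<n}" "- 1 * sign_char {i, j} X = 1"
    have fin: "finite X" using X by (auto intro: finite_subset)
    have "(i \<in> X) \<noteq> (j \<in> X)" using X(2) fin ij' by (auto simp: sign_char_pair split: if_splits)
    then show "- ?s * ?f X = inv_sign (transpose i j) X"
      using inv_sign_transpose_unequal [OF ij'(1) fin] by simp
  qed (use \<eta> in auto)
  also have "\<dots> = twist n ((- \<eta> * c\<^sub>1) *\<^sub>C (\<Sum>\<epsilon>\<in>unity_roots m. \<epsilon> *\<^sub>C ?g \<epsilon>))"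
  proof -
    have "mperm n (swap_mat n i j (inverse \<epsilon>) (- \<eta> * \<epsilon>)) = transpose i j" if "\<epsilon> \<in> unity_roots m" for \<epsilon>
      using root_nonzero [OF that] \<eta> by (intro mperm_swap_mat ij') auto
    then show ?thesis by simp
  qed
  finally show ?thesis .
qed

text \<open>
  The weight is constant, which leaves the eigenspaces with \<open>t\<^sub>i t\<^sub>j = 1\<close>. The inversion sign of the
  transposition is there the eigenvalue of \<open>t\<^sub>j\<close>, which turns the reflections for \<open>-\<eta>\<close> into those for \<open>\<eta>\<close>.
\<close>

lemma twist_y_x_same:
  assumes i: "i < n"
  shows "twist n (\<y> i * \<x> i - \<x> i * \<y> i) \<approx> twist n (\<t> *\<^sub>C 1
    - c\<^sub>1 *\<^sub>C (\<Sum>j\<in>{..<n} - {i}. \<Sum>\<epsilon>\<in>unity_roots m. grp (swap_mat n i j (inverse \<epsilon>) (- \<eta> * \<epsilon>)))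
    - (\<Sum>\<zeta>\<in>unity_roots k - {1}. c \<zeta> *\<^sub>C grp (t_mat n i \<zeta>)))"
proof -
  have pair: "(u * spectral n (sign_char {..<i})) * (v * spectral n (sign_char {..<i})) \<approx> u * v"
    if "v = \<x> i \<or> v = \<y> i" for u v
  proof -
    have "(u * spectral n (sign_char {..<i})) * (v * spectral n (sign_char {..<i})) \<approx> u * v * below i i"
      using twist_product [OF i that, of u i] by simp
    also have "\<dots> \<approx> u * v * 1" by (intro cong_mod_mult_left below_same)
    finally show ?thesis by simp
  qed
  have t: "grp (t_mat n i \<zeta>) \<approx> twist n (grp (t_mat n i \<zeta>))" if "\<zeta> \<in> unity_roots k" for \<zeta>
  proof -
    have "\<zeta> \<noteq> 0"
      using that k m by (auto simp: unity_roots_def power_0_left split: if_splits)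
    then have "mperm n (t_mat n i \<zeta>) = id"
      unfolding t_mat_mono by (intro mperm_mono_mat permutes_id) auto
    then have "twist n (grp (t_mat n i \<zeta>)) \<approx> grp (t_mat n i \<zeta>) * 1"
      using spectral_one_equiv by (simp add: cong_mod_mult_left del: mult_1_right)
    then show ?thesis by (simp add: cong_mod_sym)
  qed
  have s: "(\<Sum>\<epsilon>\<in>unity_roots m. grp (swap_mat n i j (inverse \<epsilon>) (\<eta> * \<epsilon>))) \<approx>
      twist n (\<Sum>\<epsilon>\<in>unity_roots m. grp (swap_mat n i j (inverse \<epsilon>) (- \<eta> * \<epsilon>)))"
    if "j \<in> {..<n} - {i}" for j
  proof -
    have ij': "i \<noteq> j" "i < n" "j < n" using that i by auto
    let ?g = "\<lambda>\<epsilon>. grp (swap_mat n i j (inverse \<epsilon>) (- \<eta> * \<epsilon>))"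
    have "(\<Sum>\<epsilon>\<in>unity_roots m. grp (swap_mat n i j (inverse \<epsilon>) (\<eta> * \<epsilon>))) \<approx>
        (\<Sum>\<epsilon>\<in>unity_roots m. 1 *\<^sub>C (?g \<epsilon> * spectral n (sign_char {j})))"
      unfolding scale_one by (intro cong_mod_sum swap_eta ij')
    also have "\<dots> \<approx> (\<Sum>\<epsilon>\<in>unity_roots m. 1 *\<^sub>C (?g \<epsilon> * spectral n (inv_sign (transpose i j))))"
    proof (rule spectral_average [where \<kappa> = 1, OF ij'])
      fix X :: "nat set" assume X: "X \<subseteq> {..<n}" "1 * sign_char {i, j} X = 1"
      have fin: "finite X" using X by (auto intro: finite_subset)
      have "(i \<in> X) = (j \<in> X)" using X(2) fin ij' by (auto simp: sign_char_pair split: if_splits)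
      then show "sign_char {j} X = inv_sign (transpose i j) X"
        using inv_sign_transpose_equal [OF ij'(1) fin] by simp
    qed (use \<eta> in auto)
    also have "\<dots> = twist n (\<Sum>\<epsilon>\<in>unity_roots m. ?g \<epsilon>)"
    proof -
      have "mperm n (swap_mat n i j (inverse \<epsilon>) (- \<eta> * \<epsilon>)) = transpose i j" if "\<epsilon> \<in> unity_roots m" for \<epsilon>
        using root_nonzero [OF that] \<eta> by (intro mperm_swap_mat ij') auto
      then show ?thesis by simp
    qed
    finally show ?thesis .
  qed
  have "twist n (\<y> i * \<x> i - \<x> i * \<y> i) \<approx> \<y> i * \<x> i - \<x> i * \<y> i"
    by (simp add: cong_mod_diff pair)
  also note y_x_same [OF i]
  also have "\<t> *\<^sub>C 1
      - c\<^sub>1 *\<^sub>C (\<Sum>j\<in>{..<n} - {i}. \<Sum>\<epsilon>\<in>unity_roots m. grp (swap_mat n i j (inverse \<epsilon>) (\<eta> * \<epsilon>)))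
      - (\<Sum>\<zeta>\<in>unity_roots k - {1}. c \<zeta> *\<^sub>C grp (t_mat n i \<zeta>)) \<approx>
      \<t> *\<^sub>C 1
      - c\<^sub>1 *\<^sub>C (\<Sum>j\<in>{..<n} - {i}. twist n (\<Sum>\<epsilon>\<in>unity_roots m. grp (swap_mat n i j (inverse \<epsilon>) (- \<eta> * \<epsilon>))))
      - (\<Sum>\<zeta>\<in>unity_roots k - {1}. c \<zeta> *\<^sub>C twist n (grp (t_mat n i \<zeta>)))"
    by (intro cong_mod_diff cong_mod_refl cong_mod_scale cong_mod_sum s t) auto
  finally show ?thesis
    by (simp only: twist.eval_diff twist_scale twist.eval_sum twist.eval_one)
qed

theorem twist_rels:
  assumes r: "r \<in> twisted_rels (- \<eta>) m k n \<t> c\<^sub>1 c"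
  shows "twist n r \<in> gen_ideal rels"
proof -
  have "twist n r \<approx> 0"
    using r [unfolded twisted_rels_def]
  proof (elim UnE CollectE exE conjE)
    show ?thesis if "r \<in> {grp (1\<^sub>m n) - 1}"
      using that twist_grp_one by (simp add: cong_mod_def del: twist_grp)
    show ?thesis if "r = grp g * grp h - grp (g * h)" "g \<in> \<Gamma>" "h \<in> \<Gamma>" for g h
      unfolding that(1) twist.eval_diff using twist_grp_mult [OF that(2,3)] by (simp only: cong_mod_def diff_0_right)
    show ?thesis if "r = grp g * \<x> i - mcoef n g i *\<^sub>C (\<x> (mperm n g i) * grp g)" "g \<in> \<Gamma>" "i < n" for g i
      unfolding that(1) twist.eval_diff using twist_grp_x [OF that(2,3)] by (simp only: cong_mod_def diff_0_right)
    show ?thesis if "r = grp g * \<y> i - inverse (mcoef n g i) *\<^sub>C (\<y> (mperm n g i) * grp g)" "g \<in> \<Gamma>" "i < n" for g i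
      unfolding that(1) twist.eval_diff using twist_grp_y [OF that(2,3)] by (simp only: cong_mod_def diff_0_right)
    show ?thesis if "r = \<x> i * \<x> j - - \<eta> *\<^sub>C (\<x> j * \<x> i)" "i < n" "j < n" "i \<noteq> j" for i j
      unfolding that(1) by (rule twist_x_x [OF that(2-)])
    show ?thesis if "r = \<y> i * \<y> j - - \<eta> *\<^sub>C (\<y> j * \<y> i)" "i < n" "j < n" "i \<noteq> j" for i j
      unfolding that(1) by (rule twist_y_y [OF that(2-)])
    show ?thesis if "r = \<y> i * \<x> j - - \<eta> *\<^sub>C (\<x> j * \<y> i) -
        (- \<eta> * c\<^sub>1) *\<^sub>C (\<Sum>\<epsilon>\<in>unity_roots m. \<epsilon> *\<^sub>C grp (swap_mat n i j (inverse \<epsilon>) (- \<eta> * \<epsilon>)))"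
      "i < n" "j < n" "i \<noteq> j" for i j
      unfolding that(1) twist.eval_diff [of n "_ - _"]
      using twist_y_x [OF that(2-)] by (simp only: cong_mod_def diff_0_right)
    show ?thesis if "r = \<y> i * \<x> i - \<x> i * \<y> i - (\<t> *\<^sub>C 1
        - c\<^sub>1 *\<^sub>C (\<Sum>j\<in>{..<n} - {i}. \<Sum>\<epsilon>\<in>unity_roots m. grp (swap_mat n i j (inverse \<epsilon>) (- \<eta> * \<epsilon>)))
        - (\<Sum>\<zeta>\<in>unity_roots k - {1}. c \<zeta> *\<^sub>C grp (t_mat n i \<zeta>)))" "i < n" for i
      unfolding that(1) twist.eval_diff [of n "_ - _" "_ - _"]
      using twist_y_x_same [OF that(2)] by (simp only: cong_mod_def diff_0_right)
  qed
  then show ?thesis by (simp add: cong_mod_def)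
qed

lemma twist_spectral: "twist n (spectral n f) \<approx> spectral n f"
proof -
  have "twist n (spectral n f) = (\<Sum>U\<in>Pow {..<n}. fourier n f U *\<^sub>C (grp (sgn_mat n U) * spectral n (\<lambda>_. 1)))"
    by (simp add: spectral_def [of n f])
  also have "\<dots> \<approx> (\<Sum>U\<in>Pow {..<n}. fourier n f U *\<^sub>C (grp (sgn_mat n U) * 1))"
    by (intro cong_mod_sum cong_mod_scale cong_mod_mult_left spectral_one_equiv)
  finally show ?thesis by (simp add: spectral_def [of n f])
qed

lemma twist_twist: "twist n (twist n f) \<approx> f"
proof -
  have step: "u * spectral n f * twist n (spectral n f) \<approx> u" if "\<And>X. f X * f X = 1" for u f
  proof -
    have "u * spectral n f * twist n (spectral n f) \<approx> u * spectral n f * spectral n f"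
      by (intro cong_mod_mult_left twist_spectral)
    also have "\<dots> \<approx> u * spectral n (\<lambda>X. f X * f X)"
      unfolding mult.assoc by (intro cong_mod_mult_left spectral_mult)
    also have "\<dots> \<approx> u * 1"
      using spectral_one_equiv by (intro cong_mod_mult_left) (simp add: that)
    finally show ?thesis by simp
  qed
  have "f \<in> Free UNIV" by simp
  then show ?thesis
  proof (induction rule: free_algebra_induct)
    case (letter a)
    show ?case
      by (cases a) (simp_all add: \<x>_def [symmetric] \<y>_def [symmetric] grp_def [symmetric] step)
  qed (simp_all add: cong_mod_add cong_mod_mult)
qed

end

section \<open>Passing to a subgroup of index at most two\<close>

text \<open>
  Two-by-two matrices as a ring, so that polynomials can be evaluated at them; the entries are listed by
  rows.
\<close>

datatype 'a mat2 = Mat2 'a 'a 'a 'a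

instantiation mat2 :: (ring_1) ring_1
begin

definition zero_mat2 :: "'a mat2" where "0 = Mat2 0 0 0 0"
definition one_mat2 :: "'a mat2" where "1 = Mat2 1 0 0 1"

fun plus_mat2 :: "'a mat2 \<Rightarrow> 'a mat2 \<Rightarrow> 'a mat2" where
  "Mat2 a b c d + Mat2 a' b' c' d' = Mat2 (a + a') (b + b') (c + c') (d + d')"

fun minus_mat2 :: "'a mat2 \<Rightarrow> 'a mat2 \<Rightarrow> 'a mat2" where
  "Mat2 a b c d - Mat2 a' b' c' d' = Mat2 (a - a') (b - b') (c - c') (d - d')"

fun uminus_mat2 :: "'a mat2 \<Rightarrow> 'a mat2" where
  "- Mat2 a b c d = Mat2 (- a) (- b) (- c) (- d)"

fun times_mat2 :: "'a mat2 \<Rightarrow> 'a mat2 \<Rightarrow> 'a mat2" where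
  "Mat2 a b c d * Mat2 a' b' c' d' =
    Mat2 (a * a' + b * c') (a * b' + b * d') (c * a' + d * c') (c * b' + d * d')"

instance
proof
  fix x y z :: "'a mat2"
  show "x + y + z = x + (y + z)" by (cases x; cases y; cases z) (simp add: add.assoc)
  show "x + y = y + x" by (cases x; cases y) (simp add: add.commute)
  show "0 + x = x" by (cases x) (simp add: zero_mat2_def)
  show "- x + x = 0" by (cases x) (simp add: zero_mat2_def)
  show "x - y = x + - y" by (cases x; cases y) simp
  show "x * y * z = x * (y * z)" by (cases x; cases y; cases z) (simp add: algebra_simps)
  show "1 * x = x" "x * 1 = x" by (cases x; simp add: one_mat2_def)+
  show "(x + y) * z = x * z + y * z" by (cases x; cases y; cases z) (simp add: algebra_simps)
  show "x * (y + z) = x * y + x * z" by (cases x; cases y; cases z) (simp add: algebra_simps)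
  show "(0 :: 'a mat2) \<noteq> 1" by (simp add: zero_mat2_def one_mat2_def)
qed

end

lemma sum_mat2: "(\<Sum>i\<in>I. Mat2 (a i) (b i) (c i) (d i)) = Mat2 (sum a I) (sum b I) (sum c I) (sum d I)"
  by (induction I rule: infinite_finite_induct) (simp_all add: zero_mat2_def)

text \<open>
  The scalars by which conjugation with the sign change at index \<open>0\<close> acts on the generators.
\<close>

definition flip0 :: "nat \<Rightarrow> complex" where
  "flip0 i = (if i = 0 then - 1 else 1)"

lemma flip0_square [simp]: "flip0 i * flip0 i = 1"
  and flip0_square_left [simp]: "flip0 i * (flip0 i * z) = z"
  and inverse_flip0 [simp]: "inverse (flip0 i) = flip0 i"
  and flip0_cases: "flip0 i = 1 \<or> flip0 i = - 1"
  by (simp_all add: flip0_def)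

lemma sum_unity_roots_flip:
  assumes "even m" "q = 1 \<or> q = - 1"
  shows "(\<Sum>\<epsilon>\<in>unity_roots m. f (q * \<epsilon>)) = (\<Sum>\<epsilon>\<in>unity_roots m. f \<epsilon>)"
  by (rule sum.reindex_bij_witness [of _ "(*) q" "(*) q"])
    (use assms in \<open>auto simp: unity_roots_def power_mult_distrib\<close>)

text \<open>
  The small group has exponent \<open>k\<close> for its determinants and the large one \<open>K\<close>; the parameters \<open>C\<close> of the
  large group extend the parameters \<open>c\<close> of the small one by \<open>0\<close>.
\<close>

locale index_two = twisted_cherednik "- 1" m k n \<t> c\<^sub>1 c
  for m k n :: nat and \<t> c\<^sub>1 :: complex and c :: "complex \<Rightarrow> complex" +
  fixes K :: nat and C :: "complex \<Rightarrow> complex"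
  assumes n_pos: "n > 0"
    and K: "K = k \<or> odd k \<and> K = 2 * k"
    and C: "\<And>\<zeta>. \<zeta> \<in> unity_roots k - {1} \<Longrightarrow> C \<zeta> = c \<zeta>"
    and C_zero: "\<And>\<zeta>. \<zeta> \<in> unity_roots K - unity_roots k \<Longrightarrow> C \<zeta> = 0"
begin

notation equiv_rels (infix "\<approx>" 50)

abbreviation \<tau> :: "complex mat" where "\<tau> \<equiv> sgn_mat n {0}"

abbreviation \<Gamma>' :: "complex mat set" where "\<Gamma>' \<equiv> mono_group m K n"

lemma mono_group_carrier [simp]: "g \<in> \<Gamma>' \<Longrightarrow> g \<in> carrier_mat n n"
  by (simp add: mono_group_def monomial_mat_def)

lemma \<tau>_carrier [simp]: "\<tau> \<in> carrier_mat n n"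
  by (simp add: sgn_mat_def)

lemma \<tau>_square: "\<tau> * \<tau> = 1\<^sub>m n"
  by (simp add: sgn_mat_mult sgn_mat_empty)

lemma \<tau>_cancel [simp]: "A \<in> carrier_mat n n \<Longrightarrow> \<tau> * (\<tau> * A) = A"
  using assoc_mult_mat [of \<tau> n n \<tau> n A n] by (simp add: \<tau>_square)

lemmas assoc_n = assoc_mult_mat [of _ n n _ n _ n]

lemma det_\<tau>: "det \<tau> = - 1"
proof -
  have "det \<tau> = (\<Prod>i<n. if i = 0 then - 1 else 1)"
    by (simp add: det_monomial_mat [OF sgn_mat_monomial] sign_id)
  also have "\<dots> = (\<Prod>i\<in>{0::nat}. - 1)"
    by (rule prod.mono_neutral_cong_right) (use n_pos in auto)
  finally show ?thesis by simp
qed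

lemma subgroup_subset: "\<Gamma> \<subseteq> \<Gamma>'"
  using K by (auto simp: mono_group_def mult.commute [of 2] power_mult)

lemma not_in_subgroup:
  assumes "g \<in> \<Gamma>'" "g \<notin> \<Gamma>"
  shows "odd k" "det g ^ k = - 1"
proof -
  show odd: "odd k" using assms K by auto
  have "(det g ^ k) ^ 2 = 1" "det g ^ k \<noteq> 1"
    using assms K by (auto simp: mono_group_def mult.commute [of 2] power_mult)
  then show "det g ^ k = - 1" by (simp add: power2_eq_1_iff)
qed

lemma in_subgroup_iff: "g \<in> \<Gamma>' \<Longrightarrow> g \<in> \<Gamma> \<longleftrightarrow> det g ^ k = 1"
  by (auto simp: mono_group_def)

lemma mult_in_subgroup_iff:
  assumes "g \<in> \<Gamma>'" "h \<in> \<Gamma>'"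
  shows "g * h \<in> \<Gamma> \<longleftrightarrow> (g \<in> \<Gamma> \<longleftrightarrow> h \<in> \<Gamma>)"
proof -
  have "det (g * h) ^ k = det g ^ k * det h ^ k"
    using assms by (simp add: mono_group_def det_mult_monomial [of n] power_mult_distrib)
  moreover have "det g ^ k = (if g \<in> \<Gamma> then 1 else - 1)" "det h ^ k = (if h \<in> \<Gamma> then 1 else - 1)"
    using assms not_in_subgroup by (simp_all add: in_subgroup_iff)
  ultimately show ?thesis
    using in_subgroup_iff [OF mono_group_mult [OF assms]] by auto
qed

lemma mult_\<tau>:
  assumes "monomial_mat n g"
  shows "monomial_mat n (g * \<tau>)" "mperm n (g * \<tau>) = mperm n g"
    "i < n \<Longrightarrow> mcoef n (g * \<tau>) i = mcoef n g i * flip0 i"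
    "monomial_mat n (\<tau> * g)" "mperm n (\<tau> * g) = mperm n g"
    "i < n \<Longrightarrow> mcoef n (\<tau> * g) i = flip0 (mperm n g i) * mcoef n g i"
    "det (g * \<tau>) = - det g" "det (\<tau> * g) = - det g"
  using assms
  by (simp_all add: monomial_mat_mult monomial_mat_column(1) flip0_def det_mult_monomial [of n] det_\<tau>)

lemma conj_in:
  assumes g: "g \<in> \<Gamma>"
  shows "\<tau> * g * \<tau> \<in> \<Gamma>"
proof -
  have "flip0 i ^ m = 1" for i using m flip0_cases [of i] by auto
  then show ?thesis
    using g by (auto simp: mono_group_def mult_\<tau> power_mult_distrib monomial_mat_column(1))
qed

lemma shift_in:
  assumes g: "g \<in> \<Gamma>'" "g \<notin> \<Gamma>"
  shows "g * \<tau> \<in> \<Gamma>" "\<tau> * g \<in> \<Gamma>"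
proof -
  have "flip0 i ^ m = 1" for i using m flip0_cases [of i] by auto
  moreover have "(- det g) ^ k = 1" using not_in_subgroup [OF g] by simp
  ultimately show "g * \<tau> \<in> \<Gamma>" "\<tau> * g \<in> \<Gamma>"
    using g by (auto simp: mono_group_def mult_\<tau> power_mult_distrib monomial_mat_column(1))
qed

text \<open>
  If the index is two, this is the action on the module induced from the small algebra, in terms of the
  coset representatives \<open>1\<close> and \<open>\<tau>\<close>. A small group element \<open>g\<close> becomes the diagonal matrix of its two conjugates, and \<open>g = (g \<tau>) \<tau>\<close>
  in the other coset becomes an antidiagonal matrix whose entries lie in the small group again. If the two
  groups coincide, only the diagonal matrices occur.
\<close>

primrec induced_gen :: "gen \<Rightarrow> gen ncpoly mat2" where
  "induced_gen (XGen i) = Mat2 (\<x> i) 0 0 (flip0 i *\<^sub>C \<x> i)"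
| "induced_gen (YGen i) = Mat2 (\<y> i) 0 0 (flip0 i *\<^sub>C \<y> i)"
| "induced_gen (GrpGen g) =
    (if g \<in> \<Gamma> then Mat2 (grp g) 0 0 (grp (\<tau> * g * \<tau>)) else Mat2 0 (grp (g * \<tau>)) (grp (\<tau> * g)) 0)"

sublocale induced: substitution "\<lambda>z. Mat2 (ncscalar z) 0 0 (ncscalar z)" induced_gen
proof
  fix z :: complex and M :: "gen ncpoly mat2"
  show "Mat2 (ncscalar z) 0 0 (ncscalar z) * M = M * Mat2 (ncscalar z) 0 0 (ncscalar z)"
    by (cases M) (simp add: scalar_central)
qed (simp_all add: single_add mult_single one_mat2_def)

abbreviation induced :: "gen ncpoly \<Rightarrow> gen ncpoly mat2" where
  "induced \<equiv> induced.eval"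

lemma induced_scale: "induced f = Mat2 p q r s \<Longrightarrow> induced (z *\<^sub>C f) = Mat2 (z *\<^sub>C p) (z *\<^sub>C q) (z *\<^sub>C r) (z *\<^sub>C s)"
  by (simp add: induced.eval_scale scale_def)

lemma induced_x [simp]: "induced (\<x> i) = Mat2 (\<x> i) 0 0 (flip0 i *\<^sub>C \<x> i)"
  and induced_y [simp]: "induced (\<y> i) = Mat2 (\<y> i) 0 0 (flip0 i *\<^sub>C \<y> i)"
  and induced_grp_in: "g \<in> \<Gamma> \<Longrightarrow> induced (grp g) = Mat2 (grp g) 0 0 (grp (\<tau> * g * \<tau>))"
  and induced_grp_out: "g \<notin> \<Gamma> \<Longrightarrow> induced (grp g) = Mat2 0 (grp (g * \<tau>)) (grp (\<tau> * g)) 0"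
  by (simp_all add: \<x>_def \<y>_def grp_def)

lemma induced_sum:
  "(\<And>i. i \<in> I \<Longrightarrow> induced (f i) = Mat2 (p i) (q i) (r i) (s i)) \<Longrightarrow>
    induced (sum f I) = Mat2 (sum p I) (sum q I) (sum r I) (sum s I)"
  by (simp add: sum_mat2 [symmetric])

abbreviation rel2 :: "gen ncpoly mat2 \<Rightarrow> gen ncpoly mat2 \<Rightarrow> bool" (infix "\<approx>\<^sub>2" 50) where
  "M \<approx>\<^sub>2 N \<equiv> rel_mat2 (cong_mod rels) M N"

lemma induced_grp_mult:
  assumes g: "g \<in> \<Gamma>'" and h: "h \<in> \<Gamma>'"
  shows "induced (grp g * grp h) \<approx>\<^sub>2 induced (grp (g * h))"
proof -
  have mult: "grp a * grp b \<approx> grp e" if "a \<in> \<Gamma>" "b \<in> \<Gamma>" "a * b = e" for a b e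
    using grp_mult [OF that(1,2)] that(3) by simp
  have gh: "g \<in> carrier_mat n n" "h \<in> carrier_mat n n" using g h by simp_all
  have eqs: "g * (h * \<tau>) = g * h * \<tau>" "\<tau> * g * \<tau> * (\<tau> * h * \<tau>) = \<tau> * (g * h) * \<tau>"
    "\<tau> * g * \<tau> * (\<tau> * h) = \<tau> * (g * h)" "g * \<tau> * (\<tau> * h * \<tau>) = g * h * \<tau>"
    "\<tau> * g * h = \<tau> * (g * h)" "g * \<tau> * (\<tau> * h) = g * h" "\<tau> * g * (h * \<tau>) = \<tau> * (g * h) * \<tau>"
    using gh by (simp_all add: assoc_n mult_carrier_mat [of _ n n _ n] del: assoc_mult_mat)
  note iff = mult_in_subgroup_iff [OF g h]
  show ?thesis
  proof (cases "g \<in> \<Gamma>"; cases "h \<in> \<Gamma>")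
    assume "g \<in> \<Gamma>" "h \<in> \<Gamma>"
    then show ?thesis
      using iff by (auto simp: induced_grp_in intro: mult conj_in eqs)
  next
    assume "g \<in> \<Gamma>" "h \<notin> \<Gamma>"
    then show ?thesis
      using iff shift_in [OF h] by (auto simp: induced_grp_in induced_grp_out intro: mult conj_in eqs)
  next
    assume "g \<notin> \<Gamma>" "h \<in> \<Gamma>"
    then show ?thesis
      using iff shift_in [OF g] by (auto simp: induced_grp_in induced_grp_out intro: mult conj_in eqs)
  next
    assume "g \<notin> \<Gamma>" "h \<notin> \<Gamma>"
    then show ?thesis
      using iff shift_in [OF g] shift_in [OF h]
      by (auto simp: induced_grp_in induced_grp_out intro: mult eqs)
  qed
qed

text \<open>
  Common to the \<open>x\<^sub>i\<close>, with \<open>\<iota>\<close> the identity, and to the \<open>y\<^sub>i\<close>, with \<open>\<iota>\<close> the inverse.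
\<close>

lemma induced_grp_generator:
  fixes u :: "nat \<Rightarrow> gen ncpoly" and \<iota> :: "complex \<Rightarrow> complex"
  assumes g: "g \<in> \<Gamma>'" and i: "i < n"
    and u: "\<And>i. induced (u i) = Mat2 (u i) 0 0 (flip0 i *\<^sub>C u i)"
    and gu: "\<And>h i. h \<in> \<Gamma> \<Longrightarrow> i < n \<Longrightarrow> grp h * u i \<approx> \<iota> (mcoef n h i) *\<^sub>C (u (mperm n h i) * grp h)"
    and \<iota>: "\<And>a b. \<iota> (a * b) = \<iota> a * \<iota> b" "\<And>i. \<iota> (flip0 i) = flip0 i"
  shows "induced (grp g * u i) \<approx>\<^sub>2 induced (\<iota> (mcoef n g i) *\<^sub>C (u (mperm n g i) * grp g))"
proof -
  let ?w = "mperm n g i" and ?a = "\<iota> (mcoef n g i)"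
  have mg: "monomial_mat n g" using g by (rule mono_group_monomial)
  show ?thesis
  proof (cases "g \<in> \<Gamma>")
    case True
    have "grp (\<tau> * g * \<tau>) * u i \<approx> \<iota> (mcoef n (\<tau> * g * \<tau>) i) *\<^sub>C (u (mperm n (\<tau> * g * \<tau>) i) * grp (\<tau> * g * \<tau>))"
      using conj_in [OF True] i by (rule gu)
    then have "flip0 i *\<^sub>C (grp (\<tau> * g * \<tau>) * u i) \<approx> flip0 i *\<^sub>C (flip0 ?w * ?a * flip0 i) *\<^sub>C (u ?w * grp (\<tau> * g * \<tau>))"
      using i mg by (intro cong_mod_scale) (simp add: mult_\<tau> \<iota>)
    moreover have "induced (?a *\<^sub>C (u ?w * grp g)) = Mat2 (?a *\<^sub>C (u ?w * grp g)) 0 0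
        ((flip0 ?w * ?a) *\<^sub>C (u ?w * grp (\<tau> * g * \<tau>)))"
    proof -
      have "induced (u ?w * grp g) = Mat2 (u ?w * grp g) 0 0 (flip0 ?w *\<^sub>C (u ?w * grp (\<tau> * g * \<tau>)))"
        using True by (simp add: u induced_grp_in scale_mult_left)
      from induced_scale [OF this, of ?a] show ?thesis by (simp add: mult.commute)
    qed
    ultimately show ?thesis
      using gu [OF True i] True by (simp add: u induced_grp_in scale_mult_right mult_ac)
  next
    case False
    have "grp (g * \<tau>) * u i \<approx> \<iota> (mcoef n (g * \<tau>) i) *\<^sub>C (u (mperm n (g * \<tau>) i) * grp (g * \<tau>))"
      using shift_in(1) [OF g False] i by (rule gu)
    then have "flip0 i *\<^sub>C (grp (g * \<tau>) * u i) \<approx> flip0 i *\<^sub>C (?a * flip0 i) *\<^sub>C (u ?w * grp (g * \<tau>))"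
      using i mg by (intro cong_mod_scale) (simp add: mult_\<tau> \<iota>)
    moreover have "grp (\<tau> * g) * u i \<approx> \<iota> (mcoef n (\<tau> * g) i) *\<^sub>C (u (mperm n (\<tau> * g) i) * grp (\<tau> * g))"
      using shift_in(2) [OF g False] i by (rule gu)
    then have "grp (\<tau> * g) * u i \<approx> (flip0 ?w * ?a) *\<^sub>C (u ?w * grp (\<tau> * g))"
      using i mg by (simp add: mult_\<tau> \<iota>)
    moreover have "induced (?a *\<^sub>C (u ?w * grp g)) = Mat2 0 (?a *\<^sub>C (u ?w * grp (g * \<tau>)))
        ((flip0 ?w * ?a) *\<^sub>C (u ?w * grp (\<tau> * g))) 0"
    proof -
      have "induced (u ?w * grp g) = Mat2 0 (u ?w * grp (g * \<tau>)) (flip0 ?w *\<^sub>C (u ?w * grp (\<tau> * g))) 0"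
        using False by (simp add: u induced_grp_out scale_mult_left)
      from induced_scale [OF this, of ?a] show ?thesis by (simp add: mult.commute)
    qed
    ultimately show ?thesis
      using False by (simp add: u induced_grp_out scale_mult_right mult_ac)
  qed
qed

lemma swap_neg_in: "i \<noteq> j \<Longrightarrow> i < n \<Longrightarrow> j < n \<Longrightarrow> \<epsilon> \<in> unity_roots m \<Longrightarrow>
    swap_mat n i j (inverse \<epsilon>) (- 1 * \<epsilon>) \<in> \<Gamma>"
  using swap_mat_group [of i j n m \<epsilon> "- 1" k] m by (simp add: unity_roots_def)

text \<open>
  Conjugation with \<open>\<tau>\<close> at most changes the sign of the parameter \<open>\<epsilon>\<close>, so it permutes the reflections in each
  sum over the roots of unity.
\<close>

lemma conj_swap:
  assumes ij: "i \<noteq> j" "i < n" "j < n" and \<epsilon>: "\<epsilon> \<in> unity_roots m"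
  defines "q \<equiv> flip0 i * flip0 j"
  shows "\<tau> * swap_mat n i j (inverse \<epsilon>) (- 1 * \<epsilon>) * \<tau> = swap_mat n i j (inverse (q * \<epsilon>)) (- 1 * (q * \<epsilon>))"
proof -
  have q: "inverse q = q" "q \<noteq> 0" using flip0_cases [of i] flip0_cases [of j] by (auto simp: q_def)
  note e = root_nonzero [OF \<epsilon>]
  have nz: "inverse \<epsilon> \<noteq> 0" "- 1 * \<epsilon> \<noteq> 0" "inverse (q * \<epsilon>) \<noteq> 0" "- 1 * (q * \<epsilon>) \<noteq> 0"
    using q e by simp_all
  note swap = swap_mat_monomial [OF ij] mperm_swap_mat [OF ij] mcoef_swap_mat [OF ij]
  have "mcoef n (\<tau> * swap_mat n i j (inverse \<epsilon>) (- 1 * \<epsilon>) * \<tau>) l =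
      mcoef n (swap_mat n i j (inverse (q * \<epsilon>)) (- 1 * (q * \<epsilon>))) l" if l: "l < n" for l
    using l ij swap [OF nz(1,2)] swap [OF nz(3,4)] q
    by (auto simp: mult_\<tau> q_def transpose_def mult_ac)
  then show ?thesis
    using swap [OF nz(1,2)] swap [OF nz(3,4)] by (intro monomial_mat_eqI [of n]) (simp_all add: mult_\<tau>)
qed

lemma induced_sum_swap:
  assumes ij: "i \<noteq> j" "i < n" "j < n"
  defines "q \<equiv> flip0 i * flip0 j" and "s \<equiv> \<lambda>\<epsilon>. grp (swap_mat n i j (inverse \<epsilon>) (- 1 * \<epsilon>))"
  assumes \<omega>: "\<And>\<epsilon>. \<omega> (q * \<epsilon>) = z * \<omega> \<epsilon>"
  shows "induced (\<Sum>\<epsilon>\<in>unity_roots m. \<omega> \<epsilon> *\<^sub>C s \<epsilon>) =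
    Mat2 (\<Sum>\<epsilon>\<in>unity_roots m. \<omega> \<epsilon> *\<^sub>C s \<epsilon>) 0 0 (z *\<^sub>C (\<Sum>\<epsilon>\<in>unity_roots m. \<omega> \<epsilon> *\<^sub>C s \<epsilon>))"
proof -
  have q: "q = 1 \<or> q = - 1" using flip0_cases [of i] flip0_cases [of j] by (auto simp: q_def)
  then have qq: "q * (q * \<epsilon>) = \<epsilon>" for \<epsilon> by auto
  have "induced (\<omega> \<epsilon> *\<^sub>C s \<epsilon>) = Mat2 (\<omega> \<epsilon> *\<^sub>C s \<epsilon>) (\<omega> \<epsilon> *\<^sub>C 0) (\<omega> \<epsilon> *\<^sub>C 0) (\<omega> \<epsilon> *\<^sub>C s (q * \<epsilon>))"
    if \<epsilon>: "\<epsilon> \<in> unity_roots m" for \<epsilon>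
  proof (rule induced_scale)
    show "induced (s \<epsilon>) = Mat2 (s \<epsilon>) 0 0 (s (q * \<epsilon>))"
      unfolding s_def induced_grp_in [OF swap_neg_in [OF ij \<epsilon>]] conj_swap [OF ij \<epsilon>] q_def ..
  qed
  then have "induced (\<Sum>\<epsilon>\<in>unity_roots m. \<omega> \<epsilon> *\<^sub>C s \<epsilon>) =
      Mat2 (\<Sum>\<epsilon>\<in>unity_roots m. \<omega> \<epsilon> *\<^sub>C s \<epsilon>) (\<Sum>\<epsilon>\<in>unity_roots m. \<omega> \<epsilon> *\<^sub>C 0)
        (\<Sum>\<epsilon>\<in>unity_roots m. \<omega> \<epsilon> *\<^sub>C 0) (\<Sum>\<epsilon>\<in>unity_roots m. \<omega> \<epsilon> *\<^sub>C s (q * \<epsilon>))"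
    by (rule induced_sum)
  also have "(\<Sum>\<epsilon>\<in>unity_roots m. \<omega> \<epsilon> *\<^sub>C s (q * \<epsilon>)) = (\<Sum>\<epsilon>\<in>unity_roots m. \<omega> (q * \<epsilon>) *\<^sub>C s (q * (q * \<epsilon>)))"
    by (rule sum_unity_roots_flip [OF m(2) q, symmetric])
  also have "\<dots> = z *\<^sub>C (\<Sum>\<epsilon>\<in>unity_roots m. \<omega> \<epsilon> *\<^sub>C s \<epsilon>)"
    by (simp add: qq \<omega> ncpoly.scale_sum_right)
  finally show ?thesis by simp
qed

lemma induced_y_x:
  assumes ij: "i < n" "j < n" "i \<noteq> j"
  shows "induced (\<y> i * \<x> j - - 1 *\<^sub>C (\<x> j * \<y> i)) \<approx>\<^sub>2
    induced ((- 1 * c\<^sub>1) *\<^sub>C (\<Sum>\<epsilon>\<in>unity_roots m. \<epsilon> *\<^sub>C grp (swap_mat n i j (inverse \<epsilon>) (- 1 * \<epsilon>))))"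
    (is "induced ?L \<approx>\<^sub>2 induced (?c *\<^sub>C ?S)")
proof -
  let ?q = "flip0 i * flip0 j"
  have rel: "?L \<approx> ?c *\<^sub>C ?S" by (rule y_x [OF ij])
  have "induced ?S = Mat2 ?S 0 0 (?q *\<^sub>C ?S)"
    using ij by (intro induced_sum_swap) auto
  from induced_scale [OF this, of ?c]
  have S: "induced (?c *\<^sub>C ?S) = Mat2 (?c *\<^sub>C ?S) 0 0 (?q *\<^sub>C ?c *\<^sub>C ?S)"
    by (simp add: mult_ac)
  have "induced (- 1 *\<^sub>C (\<x> j * \<y> i)) =
      Mat2 (- 1 *\<^sub>C (\<x> j * \<y> i)) (- 1 *\<^sub>C 0) (- 1 *\<^sub>C 0) (- 1 *\<^sub>C ?q *\<^sub>C (\<x> j * \<y> i))"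
    by (rule induced_scale) (simp add: scale_mult_left scale_mult_right)
  then have "induced ?L = Mat2 ?L 0 0 (?q *\<^sub>C ?L)"
    by (simp add: scale_mult_left scale_mult_right mult.commute scale_add_right)
  then show ?thesis
    unfolding S using rel cong_mod_scale [OF rel, of ?q] by simp
qed

lemma reflection_sum: "(\<Sum>\<zeta>\<in>unity_roots K - {1}. C \<zeta> *\<^sub>C grp (t_mat n i \<zeta>)) =
    (\<Sum>\<zeta>\<in>unity_roots k - {1}. c \<zeta> *\<^sub>C grp (t_mat n i \<zeta>))"
proof (rule sum.mono_neutral_cong_right)
  have "K > 0" using K k m by (auto intro: Nat.gr0I)
  then show "finite (unity_roots K - {1})"
    unfolding unity_roots_def by (simp add: finite_roots_unity)
  show "unity_roots k - {1} \<subseteq> unity_roots K - {1}"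
    using K by (auto simp: unity_roots_def mult.commute [of 2] power_mult)
  show "\<forall>\<zeta>\<in>unity_roots K - {1} - (unity_roots k - {1}). C \<zeta> *\<^sub>C grp (t_mat n i \<zeta>) = 0"
    using C_zero by auto
qed (simp add: C)

lemma induced_y_x_same:
  assumes i: "i < n"
  shows "induced (\<y> i * \<x> i - \<x> i * \<y> i) \<approx>\<^sub>2 induced (\<t> *\<^sub>C 1
    - c\<^sub>1 *\<^sub>C (\<Sum>j\<in>{..<n} - {i}. \<Sum>\<epsilon>\<in>unity_roots m. grp (swap_mat n i j (inverse \<epsilon>) (- 1 * \<epsilon>)))
    - (\<Sum>\<zeta>\<in>unity_roots k - {1}. c \<zeta> *\<^sub>C grp (t_mat n i \<zeta>)))"
    (is "_ \<approx>\<^sub>2 induced (_ - c\<^sub>1 *\<^sub>C ?S - ?T)")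
proof -
  have "induced (\<Sum>\<epsilon>\<in>unity_roots m. grp (swap_mat n i j (inverse \<epsilon>) (- 1 * \<epsilon>))) =
      Mat2 (\<Sum>\<epsilon>\<in>unity_roots m. grp (swap_mat n i j (inverse \<epsilon>) (- 1 * \<epsilon>))) 0 0
        (\<Sum>\<epsilon>\<in>unity_roots m. grp (swap_mat n i j (inverse \<epsilon>) (- 1 * \<epsilon>)))" if "j \<in> {..<n} - {i}" for j
    using induced_sum_swap [of i j "\<lambda>_. 1" 1] that i by auto
  then have "induced ?S = Mat2 ?S (\<Sum>j\<in>{..<n} - {i}. 0) (\<Sum>j\<in>{..<n} - {i}. 0) ?S"
    by (rule induced_sum)
  then have "induced ?S = Mat2 ?S 0 0 ?S" by simp
  from induced_scale [OF this, of c\<^sub>1]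
  have S: "induced (c\<^sub>1 *\<^sub>C ?S) = Mat2 (c\<^sub>1 *\<^sub>C ?S) 0 0 (c\<^sub>1 *\<^sub>C ?S)" by simp
  have "induced (c \<zeta> *\<^sub>C grp (t_mat n i \<zeta>)) = Mat2 (c \<zeta> *\<^sub>C grp (t_mat n i \<zeta>)) (c \<zeta> *\<^sub>C 0) (c \<zeta> *\<^sub>C 0)
      (c \<zeta> *\<^sub>C grp (t_mat n i \<zeta>))" if "\<zeta> \<in> unity_roots k - {1}" for \<zeta>
  proof (rule induced_scale)
    have t: "t_mat n i \<zeta> \<in> \<Gamma>" using that by (simp add: t_mat_in)
    have "\<tau> * t_mat n i \<zeta> * \<tau> = t_mat n i \<zeta>"
      unfolding t_mat_mono sgn_mat_def
      by (simp add: mono_mat_mult permutes_id comp_def) (rule mono_mat_cong, simp)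
    then show "induced (grp (t_mat n i \<zeta>)) = Mat2 (grp (t_mat n i \<zeta>)) 0 0 (grp (t_mat n i \<zeta>))"
      using induced_grp_in [OF t] by simp
  qed
  then have "induced ?T = Mat2 ?T (\<Sum>\<zeta>\<in>unity_roots k - {1}. c \<zeta> *\<^sub>C 0) (\<Sum>\<zeta>\<in>unity_roots k - {1}. c \<zeta> *\<^sub>C 0) ?T"
    by (rule induced_sum)
  then have T: "induced ?T = Mat2 ?T 0 0 ?T" by simp
  have one: "induced (\<t> *\<^sub>C 1) = Mat2 (\<t> *\<^sub>C 1) 0 0 (\<t> *\<^sub>C 1)"
    using induced_scale [of 1 1 0 0 1 \<t>] by (simp add: one_mat2_def)
  have "induced (\<y> i * \<x> i - \<x> i * \<y> i) = Mat2 (\<y> i * \<x> i - \<x> i * \<y> i) 0 0 (\<y> i * \<x> i - \<x> i * \<y> i)"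
    by (simp add: scale_mult_left scale_mult_right)
  moreover have "induced (\<t> *\<^sub>C 1 - c\<^sub>1 *\<^sub>C ?S - ?T) =
      Mat2 (\<t> *\<^sub>C 1 - c\<^sub>1 *\<^sub>C ?S - ?T) 0 0 (\<t> *\<^sub>C 1 - c\<^sub>1 *\<^sub>C ?S - ?T)"
    by (simp only: induced.eval_diff one S T minus_mat2.simps diff_zero)
  ultimately show ?thesis
    using y_x_same [OF i] by (simp only: mat2.rel_inject cong_mod_refl simp_thms)
qed

lemma induced_commutation:
  assumes u: "\<And>i. induced (u i) = Mat2 (u i) 0 0 (flip0 i *\<^sub>C u i)" and rel: "u i * u j \<approx> - 1 *\<^sub>C (u j * u i)"
  shows "induced (u i * u j) \<approx>\<^sub>2 induced (- 1 *\<^sub>C (u j * u i))"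
proof -
  let ?q = "flip0 i * flip0 j"
  have "induced (- 1 *\<^sub>C (u j * u i)) =
      Mat2 (- 1 *\<^sub>C (u j * u i)) (- 1 *\<^sub>C 0) (- 1 *\<^sub>C 0) (- 1 *\<^sub>C ?q *\<^sub>C (u j * u i))"
    by (rule induced_scale) (simp add: u scale_mult_left scale_mult_right)
  moreover have "induced (u i * u j) = Mat2 (u i * u j) 0 0 (?q *\<^sub>C (u i * u j))"
    by (simp add: u scale_mult_left scale_mult_right mult.commute)
  ultimately show ?thesis
    using rel cong_mod_scale [OF rel, of ?q] by simp
qed

lemma induced_rels:
  assumes r: "r \<in> twisted_rels (- 1) m K n \<t> c\<^sub>1 C"
  shows "pred_mat2 (\<lambda>f. f \<in> gen_ideal rels) (induced r)"
proof -
  have diff: "pred_mat2 (\<lambda>f. f \<in> gen_ideal rels) (induced (f - g))" if "induced f \<approx>\<^sub>2 induced g" for f g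
    using that by (cases "induced f"; cases "induced g") (simp add: cong_mod_def)
  show ?thesis
    using r [unfolded twisted_rels_def]
  proof (elim UnE CollectE exE conjE)
    assume r: "r \<in> {grp (1\<^sub>m n) - 1}"
    have "induced (grp (1\<^sub>m n)) = Mat2 (grp (1\<^sub>m n)) 0 0 (grp (1\<^sub>m n))"
      using mono_group_one [of n m k] by (simp add: induced_grp_in \<tau>_square right_mult_one_mat [OF \<tau>_carrier])
    then have "induced (grp (1\<^sub>m n)) \<approx>\<^sub>2 induced 1"
      using grp_one by (simp add: one_mat2_def)
    from diff [OF this] show ?thesis using r by simp
  next
    fix g h assume "r = grp g * grp h - grp (g * h)" "g \<in> \<Gamma>'" "h \<in> \<Gamma>'"
    then show ?thesis using diff induced_grp_mult by blast
  next
    fix g i assume r: "r = grp g * \<x> i - mcoef n g i *\<^sub>C (\<x> (mperm n g i) * grp g)" and g: "g \<in> \<Gamma>'" "i < n"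
    show ?thesis
      unfolding r by (rule diff, rule induced_grp_generator [where \<iota> = "\<lambda>z. z", OF g])
        (simp_all add: grp_x)
  next
    fix g i assume r: "r = grp g * \<y> i - inverse (mcoef n g i) *\<^sub>C (\<y> (mperm n g i) * grp g)" and g: "g \<in> \<Gamma>'" "i < n"
    show ?thesis
      unfolding r by (rule diff, rule induced_grp_generator [where \<iota> = inverse, OF g])
        (simp_all add: grp_y)
  next
    fix i j assume r: "r = \<x> i * \<x> j - - 1 *\<^sub>C (\<x> j * \<x> i)" and ij: "i < n" "j < n" "i \<noteq> j"
    show ?thesis
      unfolding r by (rule diff, rule induced_commutation) (simp, rule x_x [OF ij])
  next
    fix i j assume r: "r = \<y> i * \<y> j - - 1 *\<^sub>C (\<y> j * \<y> i)" and ij: "i < n" "j < n" "i \<noteq> j"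
    show ?thesis
      unfolding r by (rule diff, rule induced_commutation) (simp, rule y_y [OF ij])
  next
    fix i j assume r: "r = \<y> i * \<x> j - - 1 *\<^sub>C (\<x> j * \<y> i) -
        (- 1 * c\<^sub>1) *\<^sub>C (\<Sum>\<epsilon>\<in>unity_roots m. \<epsilon> *\<^sub>C grp (swap_mat n i j (inverse \<epsilon>) (- 1 * \<epsilon>)))"
      and ij: "i < n" "j < n" "i \<noteq> j"
    show ?thesis unfolding r by (rule diff [OF induced_y_x [OF ij]])
  next
    fix i assume r: "r = \<y> i * \<x> i - \<x> i * \<y> i - (\<t> *\<^sub>C 1
        - c\<^sub>1 *\<^sub>C (\<Sum>j\<in>{..<n} - {i}. \<Sum>\<epsilon>\<in>unity_roots m. grp (swap_mat n i j (inverse \<epsilon>) (- 1 * \<epsilon>)))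
        - (\<Sum>\<zeta>\<in>unity_roots K - {1}. C \<zeta> *\<^sub>C grp (t_mat n i \<zeta>)))" and i: "i < n"
    show ?thesis unfolding r reflection_sum by (rule diff [OF induced_y_x_same [OF i]])
  qed
qed

lemma rels_subset: "rels \<subseteq> twisted_rels (- 1) m K n \<t> c\<^sub>1 C"
  using subgroup_subset unfolding twisted_rels_def reflection_sum by blast

text \<open>
  If \<open>f\<close> uses group letters from the small group only, then its matrix is diagonal with upper left entry \<open>f\<close>,
  and all entries of the matrix of an element of the large ideal lie in the small ideal.
\<close>

theorem subgroup_ideal:
  assumes f: "f \<in> Free S" and S: "\<And>g. GrpGen g \<in> S \<Longrightarrow> g \<in> \<Gamma>"
    and ideal: "f \<in> gen_ideal (twisted_rels (- 1) m K n \<t> c\<^sub>1 C)"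
  shows "f \<in> gen_ideal rels"
proof -
  let ?P = "pred_mat2 (\<lambda>f. f \<in> gen_ideal rels)"
  have "induced f \<in> {M. ?P M}"
  proof (rule induced.eval_gen_ideal [OF _ _ _ _ ideal])
    fix M N A B :: "gen ncpoly mat2"
    assume M: "M \<in> {M. ?P M}"
    then show "A * M * B \<in> {M. ?P M}"
      by (cases M; cases A; cases B) (simp add: gen_ideal_add gen_ideal_mult_left gen_ideal_mult_right)
    assume "N \<in> {M. ?P M}"
    then show "M + N \<in> {M. ?P M}"
      using M by (cases M; cases N) (simp add: gen_ideal_add)
  qed (use induced_rels in \<open>auto simp: zero_mat2_def gen_ideal.zero\<close>)
  moreover have "\<exists>f'. induced f = Mat2 f 0 0 f'"
    using f
  proof (induction rule: free_algebra_induct)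
    case (letter a)
    then show ?case
      using S by (cases a) (auto simp: \<x>_def \<y>_def grp_def)
  qed auto
  ultimately show ?thesis by auto
qed

end

section \<open>The embedding\<close>

definition gens :: "nat \<Rightarrow> complex mat set \<Rightarrow> gen set" where
  "gens n G = XGen ` {..<n} \<union> YGen ` {..<n} \<union> GrpGen ` G"

lemma cherednik_gens_eq: "cherednik_gens n \<Gamma> = gens n (carrier \<Gamma>)"
  by (simp add: cherednik_gens_def gens_def)

lemma gens_iff [simp]:
  "XGen i \<in> gens n G \<longleftrightarrow> i < n" "YGen i \<in> gens n G \<longleftrightarrow> i < n" "GrpGen g \<in> gens n G \<longleftrightarrow> g \<in> G"
  by (auto simp: gens_def)

lemma Free_gens [simp]:
  "\<x> i \<in> Free (gens n G) \<longleftrightarrow> i < n" "\<y> i \<in> Free (gens n G) \<longleftrightarrow> i < n" "grp g \<in> Free (gens n G) \<longleftrightarrow> g \<in> G"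
  by (simp_all add: \<x>_def \<y>_def grp_def)

lemma (in twisted_cherednik) rels_Free:
  assumes swap: "\<eta> = - 1 \<or> even k"
  shows "rels \<subseteq> Free (gens n \<Gamma>)"
proof -
  have sw: "swap_mat n i j (inverse \<epsilon>) (\<eta> * \<epsilon>) \<in> \<Gamma>"
    if "i \<noteq> j" "i < n" "j < n" "\<epsilon> \<in> unity_roots m" for i j \<epsilon>
    using that swap \<eta> m by (intro swap_mat_group) (auto simp: unity_roots_def)
  have p: "mperm n g i < n" if "g \<in> \<Gamma>" "i < n" for g i
    using monomial_mat_column(1) [OF mono_group_monomial] that by blast
  show ?thesis
    unfolding twisted_rels_def
    by (intro Un_least subsetI)
      (auto intro!: Free_diff Free_mult Free_scale Free_sum sw t_mat_in p mono_group_mult mono_group_one)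
qed

context full_twisted_cherednik
begin

lemma spectral_Free: "spectral n f \<in> Free (gens n \<Gamma>)"
  unfolding spectral_def by (intro Free_sum Free_scale) (simp add: sgn_in)

lemma twist_gen_Free: "a \<in> gens n \<Gamma> \<Longrightarrow> twist_gen n a \<in> Free (gens n \<Gamma>)"
  by (cases a) (auto intro!: Free_mult spectral_Free)

lemma t_chain_Free: "i \<le> n \<Longrightarrow> t_chain n i \<in> Free (gens n \<Gamma>)"
  unfolding t_chain_def by (intro Free_prod_list) (auto simp: t_mat_sgn sgn_in)

lemma t_chain_spectral: "i \<le> n \<Longrightarrow> t_chain n i \<approx> spectral n (sign_char {..<i})"
proof (induction i)
  case 0
  then show ?case
    using spectral_one_equiv by (simp add: t_chain_def cong_mod_sym)
next
  case (Suc i)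
  have "t_chain n (Suc i) = grp (sgn_mat n {i}) * t_chain n i"
    by (simp add: t_chain_def t_mat_sgn)
  also have "\<dots> \<approx> grp (sgn_mat n {i}) * grp (sgn_mat n {..<i})"
    using Suc by (intro cong_mod_mult_left) (simp add: spectral_sign_char)
  also have "\<dots> \<approx> grp (sgn_mat n {i} * sgn_mat n {..<i})"
    by (intro grp_mult sgn_in)
  also have "sgn_mat n {i} * sgn_mat n {..<i} = sgn_mat n {..<Suc i}"
    unfolding sgn_mat_mult by (rule arg_cong [of _ _ "sgn_mat n"]) auto
  finally show ?case using Suc.prems by (subst spectral_sign_char) auto
qed

text \<open>
  On the eigenspaces of \<open>t\<^sub>i\<close> and \<open>t\<^bsub>i+1\<^esub>\<close> the inversion sign of an adjacent transposition is \<open>-1\<close> only if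
  both eigenvalues are \<open>-1\<close>, so it is \<open>(1 + t\<^sub>i + t\<^bsub>i+1\<^esub> - t\<^sub>i t\<^bsub>i+1\<^esub>) / 2\<close>. Multiplying \<open>\<sigma>\<^sub>i\<close> by the four
  sign changes gives the four matrices of the formula.
\<close>

lemma twist_sigma:
  assumes i: "Suc i < n"
  shows "twist n (grp (\<sigma>_mat n i (i + 1) 1)) \<approx>
    (1 / 2) *\<^sub>C (grp (s_mat n i (i + 1) 1) + grp (s_mat n i (i + 1) (- 1))
      + grp (\<sigma>_mat n i (i + 1) 1) - grp (mono_inv n (\<sigma>_mat n i (i + 1) 1)))"
proof -
  let ?\<sigma> = "swap_mat n i (Suc i) 1 (- 1)"
  have ij: "i \<noteq> Suc i" "i < n" "Suc i < n" using i by auto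
  have \<sigma>: "?\<sigma> \<in> \<Gamma>" using swap_in [OF ij, of 1 "- 1"] by (simp add: unity_roots_def)
  have "spectral n (inv_sign (transpose i (Suc i))) =
      spectral n (\<lambda>X. \<Sum>U\<in>{{}, {i}, {Suc i}, {i, Suc i}}. (if U = {i, Suc i} then - 1 / 2 else 1 / 2) * sign_char U X)"
  proof (rule spectral_cong)
    fix X :: "nat set" assume "X \<subseteq> {..<n}"
    then have X: "finite X" by (rule finite_subset) simp
    have "{i<..<Suc i} = {}" by auto
    then show "inv_sign (transpose i (Suc i)) X =
        (\<Sum>U\<in>{{}, {i}, {Suc i}, {i, Suc i}}. (if U = {i, Suc i} then - 1 / 2 else 1 / 2) * sign_char U X)"
      using X by (simp add: inv_sign_transpose sign_char_singleton sign_char_pair doubleton_eq_iff)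
  qed
  also have "\<dots> = (1 / 2) *\<^sub>C (spectral n (sign_char {Suc i}) + spectral n (sign_char {i}) + spectral n (sign_char {})
      - spectral n (sign_char {i, Suc i}))"
    unfolding spectral_linear by (simp add: doubleton_eq_iff scale_add_right ncpoly.scale_right_diff_distrib)
  finally have spectral: "spectral n (inv_sign (transpose i (Suc i))) = \<dots>" .
  have mat: "?\<sigma> * sgn_mat n {Suc i} = swap_mat n i (Suc i) 1 1" "?\<sigma> * sgn_mat n {i} = swap_mat n i (Suc i) (- 1) (- 1)"
    "?\<sigma> * sgn_mat n {} = ?\<sigma>" "?\<sigma> * sgn_mat n {i, Suc i} = mono_inv n ?\<sigma>"
  proof -
    have "swap_mat n i (Suc i) 1 (- 1) \<in> carrier_mat n n" by (simp add: swap_mat_mono [OF ij])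
    then show "?\<sigma> * sgn_mat n {} = ?\<sigma>" unfolding sgn_mat_empty by (rule right_mult_one_mat)
    show "?\<sigma> * sgn_mat n {Suc i} = swap_mat n i (Suc i) 1 1"
      using swap_mat_mult_sgn(1) [OF ij, of 1 "- 1"] by simp
    note swap = swap_mat_monomial [OF ij] mperm_swap_mat [OF ij] mcoef_swap_mat [OF ij]
    show "?\<sigma> * sgn_mat n {i} = swap_mat n i (Suc i) (- 1) (- 1)"
      by (rule monomial_mat_eqI [of n]) (use ij in \<open>simp_all add: monomial_mat_mult swap\<close>)
    have "?\<sigma> * sgn_mat n {i, Suc i} = mono_mat n (transpose i (Suc i)) (\<lambda>l. if l = i then - 1 else 1)"
      using swap_mat_mult_sgn(2) [OF ij, of 1 "- 1"] by (simp add: swap_mat_mono [OF ij] cong: if_cong)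
    also have "\<dots> = mono_inv n ?\<sigma>"
    proof -
      have w: "mperm n ?\<sigma> = transpose i (Suc i)" by (rule mperm_swap_mat [OF ij]) simp_all
      have "mcoef n ?\<sigma> (transpose i (Suc i) l) = (if l = i then - 1 else 1)" if "l < n" for l
        using ij that by (subst mcoef_swap_mat [OF ij]) (auto simp: transpose_def)
      then show ?thesis
        unfolding mono_inv_def w by (intro mono_mat_cong) simp
    qed
    finally show "?\<sigma> * sgn_mat n {i, Suc i} = mono_inv n ?\<sigma>" .
  qed
  have names: "\<sigma>_mat n i (i + 1) 1 = ?\<sigma>" "s_mat n i (i + 1) 1 = swap_mat n i (Suc i) 1 1"
    "s_mat n i (i + 1) (- 1) = swap_mat n i (Suc i) (- 1) (- 1)"
    by (simp_all add: \<sigma>_mat_def s_mat_def)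
  have neg_one_neq_zero: "- 1 \<noteq> (0 :: complex)" by simp
  have twist: "twist n (grp ?\<sigma>) = (1 / 2) *\<^sub>C (grp ?\<sigma> * spectral n (sign_char {Suc i})
      + grp ?\<sigma> * spectral n (sign_char {i}) + grp ?\<sigma> * spectral n (sign_char {}) - grp ?\<sigma> * spectral n (sign_char {i, Suc i}))"
    unfolding twist_grp mperm_swap_mat [OF ij one_neq_zero neg_one_neq_zero] spectral
    by (simp only: scale_mult_right distrib_left right_diff_distrib)
  show ?thesis
    unfolding names twist mat(1,2,4) [symmetric]
  proof (intro cong_mod_scale cong_mod_diff cong_mod_add)
    show "grp ?\<sigma> * spectral n (sign_char {}) \<approx> grp ?\<sigma>"
      using grp_spectral_sign_char [OF \<sigma>, of "{}"] unfolding mat(3) by blast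
  qed (rule grp_spectral_sign_char [OF \<sigma>]; use i in auto)+
qed

end

lemma Tmpn_mono_group:
  assumes "g \<in> Tmpn m p n"
  shows "g \<in> mono_group m (m div p) n" "mperm n g = id"
proof -
  have g: "monomial_mat n g" and diag: "diagonal_mat g"
    and prod: "\<forall>i<n. mcoef n g i ^ m = 1" "(\<Prod>i<n. mcoef n g i) ^ (m div p) = 1"
    using assms nonzero_positions_roots
    by (auto simp: Tmpn_def Gmpn_def mat_monoid_def) (auto simp: unity_roots_def)
  have "mperm n g i = i" if "i < n" for i
    using monomial_mat_column [OF g that] g diag that
    by (metis carrier_matD diagonal_mat_def mcoef_def monomial_mat_def)
  then show "mperm n g = id" by (auto simp: mperm_def fun_eq_iff)
  then show "g \<in> mono_group m (m div p) n"
    using g prod det_monomial_mat [OF g] by (simp add: mono_group_def sign_id)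
qed

theorem theorem4p2:
  fixes m p p' n :: nat
    and \<t> c\<^sub>1 cbar\<^sub>1 :: complex
    and c cbar :: "complex \<Rightarrow> complex"
  assumes "m > 0" and "p > 0" and "p dvd m" and "even m" and "n \<ge> 2"
    and "p' = (if even (m div p) then p else p div 2)"
    and "c\<^sub>1 = - cbar\<^sub>1"
    and "\<forall>\<zeta> \<in> unity_roots (m div p) - {1}. c \<zeta> = - cbar \<zeta>"
    and "\<forall>\<zeta> \<in> unity_roots (m div p') - unity_roots (m div p). c \<zeta> = 0"
  shows "\<exists>\<phi> \<in> algebra_hom (braided_cherednik_algebra m p n \<t> cbar\<^sub>1 cbar)
                         (cherednik_algebra m p' n \<t> c\<^sub>1 c).
    inj_on \<phi> (carrier (braided_cherednik_algebra m p n \<t> cbar\<^sub>1 cbar)) \<and>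
    (let \<beta> = braided_cherednik_class m p n \<t> cbar\<^sub>1 cbar;
         \<eta> = cherednik_class m p' n \<t> c\<^sub>1 c
     in (\<forall>i<n. \<phi> (\<beta> (\<x> i)) = \<eta> (\<x> i * t_chain n i)) \<and>
        (\<forall>i<n. \<phi> (\<beta> (\<y> i)) = \<eta> (\<y> i * t_chain n i)) \<and>
        (\<forall>i<n - 1. \<phi> (\<beta> (grp (\<sigma>_mat n i (i + 1) 1))) =
           \<eta> ((1 / 2) *\<^sub>C (grp (s_mat n i (i + 1) 1) + grp (s_mat n i (i + 1) (- 1))
                  + grp (\<sigma>_mat n i (i + 1) 1)
                  - grp (inv\<^bsub>Gmpn m p' n\<^esub> (\<sigma>_mat n i (i + 1) 1))))) \<and>
        (\<forall>g \<in> Tmpn m p n. \<phi> (\<beta> (grp g)) = \<eta> (grp g)))"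
proof -
  define k where "k = m div p"
  define K where "K = m div p'"
  have m_eq: "m = p * k" using assms(3) by (simp add: k_def)
  then have k_dvd: "k dvd m" by (metis dvd_triv_right)
  have p': "p' = (if even k then p else p div 2)" using assms(6) by (simp add: k_def)
  have K: "even K \<and> K dvd m \<and> (K = k \<or> odd k \<and> K = 2 * k)"
  proof (cases "even k")
    case True
    then have "K = k" by (simp add: K_def k_def p')
    then show ?thesis using True k_dvd by simp
  next
    case False
    have "even p" using assms(4) False unfolding m_eq by simp
    then obtain q where q: "p = 2 * q" ..
    then have "p' = q" "q > 0" using assms(2) False by (simp_all add: p')
    moreover have m: "m = q * (2 * k)" using m_eq q by (simp only: mult_ac)
    ultimately have "K = 2 * k" unfolding K_def by simp
    then show ?thesis using False m by (simp only: even_mult_iff dvd_triv_right simp_thms even_numeral)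
  qed
  have c: "\<forall>\<zeta> \<in> unity_roots k - {1}. c \<zeta> = - cbar \<zeta>"
    and c_zero: "\<forall>\<zeta> \<in> unity_roots K - unity_roots k. c \<zeta> = 0"
    using assms(8,9) by (simp_all add: k_def K_def)
  let ?c = "\<lambda>\<zeta>. - cbar \<zeta>"
  interpret B: full_twisted_cherednik 1 m K n \<t> c\<^sub>1 c
    by unfold_locales (use assms K in auto)
  interpret A': full_twisted_cherednik "- 1" m K n \<t> c\<^sub>1 c
    by unfold_locales (use assms K in auto)
  interpret A: index_two m k n \<t> c\<^sub>1 ?c K c
    by unfold_locales (use assms(1,4,5) c c_zero K k_dvd in auto)
  define S where "S = gens n (mono_group m k n)"
  define S' where "S' = gens n (mono_group m K n)"
  have S: "cherednik_gens n (\<mu>Gmpn m p n) = S" "braided_cherednik_rels m p n \<t> cbar\<^sub>1 cbar = A.rels"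
    using braided_cherednik_rels_twisted [of m p n \<t> cbar\<^sub>1 cbar]
    by (simp_all add: S_def cherednik_gens_eq carrier_\<mu>Gmpn k_def assms(7))
  have S': "cherednik_gens n (Gmpn m p' n) = S'" "cherednik_rels m p' n \<t> c\<^sub>1 c = B.rels"
    using K carrier_Gmpn_even [of m p'] cherednik_rels_twisted [of m p']
    by (simp_all add: S'_def cherednik_gens_eq K_def)
  have SS': "S \<subseteq> S'" unfolding S_def S'_def gens_def using A.subgroup_subset by auto
  have R: "A.rels \<subseteq> Free S" "B.rels \<subseteq> Free S'"
    unfolding S_def S'_def using A.rels_Free B.rels_Free K by auto
  have ideal: "twist n f \<in> gen_ideal R'" if "\<And>r. r \<in> R \<Longrightarrow> twist n r \<in> gen_ideal R'" "f \<in> gen_ideal R" for f R R'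
    by (rule twist.eval_gen_ideal [OF _ _ _ _ that(2)])
      (use that(1) in \<open>auto intro: gen_ideal.zero gen_ideal_add gen_ideal_mult_left gen_ideal_mult_right\<close>)
  obtain \<phi> where \<phi>: "\<phi> \<in> algebra_hom (presented_algebra S A.rels) (presented_algebra S' B.rels)"
      "inj_on \<phi> (carrier (presented_algebra S A.rels))"
      "\<And>f. f \<in> Free S \<Longrightarrow> \<phi> (presented_class S A.rels f) = presented_class S' B.rels (twist n f)"
  proof -
    have "\<exists>\<phi> \<in> algebra_hom (presented_algebra S A.rels) (presented_algebra S' B.rels).
        inj_on \<phi> (carrier (presented_algebra S A.rels)) \<and>
        (\<forall>f \<in> Free S. \<phi> (presented_class S A.rels f) = presented_class S' B.rels (twist n f))"
    proof (rule presented_algebra_embedding [OF R])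
      show "twist_gen n a \<in> Free S'" if "a \<in> S" for a
        using B.twist_gen_Free SS' that by (auto simp: S'_def)
      show "twist n r \<in> gen_ideal B.rels" if "r \<in> A.rels" for r
        using B.twist_rels A.rels_subset that by auto
      show "f \<in> gen_ideal A.rels" if f: "f \<in> Free S" "twist n f \<in> gen_ideal B.rels" for f
      proof (rule A.subgroup_ideal [OF f(1)])
        \<comment> \<open>The twist also maps the rational relations into the braided ideal, and twisting twice returns \<open>f\<close>.\<close>
        have "twist n (twist n f) \<in> gen_ideal A'.rels"
          by (rule ideal [OF _ f(2)]) (use A'.twist_rels in simp)
        moreover have "twist n (twist n f) - f \<in> gen_ideal A'.rels"
          using A'.twist_twist [of f] by (simp add: cong_mod_def)
        ultimately have "twist n (twist n f) + - (twist n (twist n f) - f) \<in> gen_ideal A'.rels"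
          by (intro gen_ideal_add gen_ideal_uminus)
        then show "f \<in> gen_ideal A'.rels" by simp
      qed (auto simp: S_def gens_def)
    qed
    then show ?thesis using that by blast
  qed
  have image: "\<phi> (presented_class S A.rels f) = presented_class S' B.rels g"
    if "f \<in> Free S" "g \<in> Free S'" "cong_mod B.rels (twist n f) g" for f g
  proof -
    have "twist n f \<in> Free S'"
      using that(1)
    proof (induction rule: free_algebra_induct)
      case (letter a)
      then show ?case using B.twist_gen_Free SS' by (auto simp: S'_def)
    qed (auto simp: Free_add Free_mult)
    then show ?thesis
      using that by (simp add: \<phi>(3) presented_class_eq_iff [OF R(2)] cong_mod_def)
  qed
  show ?thesis
    unfolding braided_cherednik_algebra_def cherednik_algebra_def braided_cherednik_class_def
      cherednik_class_def S S' Let_def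
  proof (intro bexI [of _ \<phi>] conjI allI impI ballI)
    fix i assume i: "i < n"
    show "\<phi> (presented_class S A.rels (\<x> i)) = presented_class S' B.rels (\<x> i * t_chain n i)"
      using i by (intro image) (auto simp: S_def S'_def intro!: Free_mult B.t_chain_Free
          cong_mod_mult_left cong_mod_sym [OF B.t_chain_spectral])
    show "\<phi> (presented_class S A.rels (\<y> i)) = presented_class S' B.rels (\<y> i * t_chain n i)"
      using i by (intro image) (auto simp: S_def S'_def intro!: Free_mult B.t_chain_Free
          cong_mod_mult_left cong_mod_sym [OF B.t_chain_spectral])
  next
    fix i assume "i < n - 1"
    then have i: "Suc i < n" by simp
    have \<Gamma>: "Gmpn m p' n = mat_monoid n (mono_group m K n)"
      using carrier_Gmpn_even [of m p' n] K by (simp add: K_def Gmpn_def mat_monoid_def)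
    have swap: "i \<noteq> Suc i" "i < n" "Suc i < n" using i by auto
    have \<sigma>: "\<sigma>_mat n i (i + 1) 1 \<in> mono_group m k n"
      using A.swap_neg_in [OF swap, of 1] by (simp add: \<sigma>_mat_def unity_roots_def)
    then have \<sigma>': "\<sigma>_mat n i (i + 1) 1 \<in> mono_group m K n" using A.subgroup_subset by auto
    have s: "s_mat n i (i + 1) \<epsilon> \<in> mono_group m K n" if "\<epsilon> \<in> unity_roots m" for \<epsilon>
      using B.swap_in [OF swap that, of 1] by (simp add: s_mat_def)
    show "\<phi> (presented_class S A.rels (grp (\<sigma>_mat n i (i + 1) 1))) =
        presented_class S' B.rels ((1 / 2) *\<^sub>C (grp (s_mat n i (i + 1) 1) + grp (s_mat n i (i + 1) (- 1))
          + grp (\<sigma>_mat n i (i + 1) 1) - grp (inv\<^bsub>Gmpn m p' n\<^esub> (\<sigma>_mat n i (i + 1) 1))))"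
      unfolding m_inv_mono_group [OF \<Gamma> \<sigma>']
    proof (rule image)
      show "grp (\<sigma>_mat n i (i + 1) 1) \<in> Free S" using \<sigma> by (simp add: S_def)
      show "(1 / 2) *\<^sub>C (grp (s_mat n i (i + 1) 1) + grp (s_mat n i (i + 1) (- 1))
          + grp (\<sigma>_mat n i (i + 1) 1) - grp (mono_inv n (\<sigma>_mat n i (i + 1) 1))) \<in> Free S'"
        unfolding S'_def Free_gens
        using \<sigma>' mono_group_inv [OF \<sigma>'] s [of 1] s [of "- 1"] assms(4)
        by (intro Free_scale Free_diff Free_add) (simp_all add: unity_roots_def)
    qed (rule B.twist_sigma [OF i])
  next
    fix g assume g: "g \<in> Tmpn m p n"
    have "g \<in> mono_group m k n" using Tmpn_mono_group(1) [OF g] by (simp add: k_def)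
    moreover have "cong_mod B.rels (twist n (grp g)) (grp g)"
      using cong_mod_mult_left [OF B.spectral_one_equiv, of "grp g"]
      by (simp add: Tmpn_mono_group(2) [OF g])
    ultimately show "\<phi> (presented_class S A.rels (grp g)) = presented_class S' B.rels (grp g)"
      using A.subgroup_subset by (intro image) (auto simp: S_def S'_def)
  qed (rule \<phi>)+
qed

end
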